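(* Let $d=1$, $\sigma^2=\operatorname{Var}(X)$, and suppose $\rho/\sqrt N\to\alpha\in(0,\infty)$, with $L=N/\rho$. Then for every $\epsilon>0$, uniformly in integers $0\le j\le(1-\epsilon)N$, $$H_{N-j}(L)\sim\frac{C_0e^{G_L(1-L^{-2})}}{N}\Big(1-\frac jN\Big)^{-3/2}\sum_{n=0}^\infty(-1)^n\binom{-2\theta}{n}(\theta+n)\exp\Big(\frac{-(\theta+n)^2}{2\alpha^2\sigma^2(1-\frac jN)}\Big)\qquad(N\to\infty),$$ where $C_0:=\frac{e^{\sqrt2\sigma^{-1}\theta}(1-e^{-\sqrt2\sigma^{-1}})^{2\theta}}{\sqrt{2\pi}\,\alpha\sigma}$ and $\binom{t}{n}:=\frac{1}{n!}t(t-1)\cdots(t-n+1)$.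
   Context: $\theta>0$ is fixed. $X$ is a real random variable with density $\varphi$, a Schwartz function, with $\mathbb E X=0$ and variance $\operatorname{Var}(X)$; $\varphi^{*j}$ is the $j$-fold convolution. $W_{L,j}:=\theta L\sum_{k\in\mathbb Z}\varphi^{*j}(Lk)$, $G_L(z):=\sum_{j\ge1}W_{L,j}z^j/j$ for $|z|<1$, and $H_n(L)$ is defined by $\sum_{n\ge0}H_n(L)z^n=e^{G_L(z)}$. *)

theory Defs
  imports "HOL-Analysis.Analysis" "HOL-Computational_Algebra.Formal_Power_Series"
begin

definition schwartz :: "(real \<Rightarrow> real) \<Rightarrow> bool" where
  "schwartz f \<longleftrightarrow>
     (\<forall>n x. ((deriv ^^ n) f) differentiable (at x)) \<and>
     (\<forall>m n. \<exists>C. \<forall>x. \<bar>x\<bar> ^ m * \<bar>(deriv ^^ n) f x\<bar> \<le> C)"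

definition is_density :: "(real \<Rightarrow> real) \<Rightarrow> bool" where
  "is_density f \<longleftrightarrow> (\<forall>x. 0 \<le> f x) \<and> integrable lborel f \<and> (LINT x|lborel. f x) = 1"

definition mean_of :: "(real \<Rightarrow> real) \<Rightarrow> real" where
  "mean_of f = (LINT x|lborel. x * f x)"

definition var_of :: "(real \<Rightarrow> real) \<Rightarrow> real" where
  "var_of f = (LINT x|lborel. (x - mean_of f)^2 * f x)"

definition rconv :: "(real \<Rightarrow> real) \<Rightarrow> (real \<Rightarrow> real) \<Rightarrow> real \<Rightarrow> real" where
  "rconv f g x = (LINT y|lborel. f y * g (x - y))"

text \<open>j-fold convolution power (only used for j \<ge> 1; the value at j = 0 is a dummy).\<close>
fun conv_pow :: "(real \<Rightarrow> real) \<Rightarrow> nat \<Rightarrow> real \<Rightarrow> real" where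
  "conv_pow f 0 = (\<lambda>_. 0)"
| "conv_pow f (Suc 0) = f"
| "conv_pow f (Suc (Suc n)) = rconv (conv_pow f (Suc n)) f"

definition W :: "real \<Rightarrow> (real \<Rightarrow> real) \<Rightarrow> real \<Rightarrow> nat \<Rightarrow> real" where
  "W \<theta> \<phi> L j = \<theta> * L * (\<Sum>\<^sub>\<infinity>k::int. conv_pow \<phi> j (L * of_int k))"

definition G_fps :: "real \<Rightarrow> (real \<Rightarrow> real) \<Rightarrow> real \<Rightarrow> real fps" where
  "G_fps \<theta> \<phi> L = Abs_fps (\<lambda>j. if j = 0 then 0 else W \<theta> \<phi> L j / real j)"

definition G_val :: "real \<Rightarrow> (real \<Rightarrow> real) \<Rightarrow> real \<Rightarrow> real \<Rightarrow> real" where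
  "G_val \<theta> \<phi> L z = (\<Sum>j. W \<theta> \<phi> L (Suc j) * z ^ Suc j / real (Suc j))"

definition H :: "real \<Rightarrow> (real \<Rightarrow> real) \<Rightarrow> real \<Rightarrow> nat \<Rightarrow> real" where
  "H \<theta> \<phi> L n = fps_nth (fps_exp 1 oo G_fps \<theta> \<phi> L) n"

end

theory Submission
  imports Defs "HOL-Probability.Probability" "HOL-Complex_Analysis.Complex_Analysis"
    "HOL-Real_Asymp.Real_Asymp"
begin

text \<open>Let \<open>\<psi>\<close> be the characteristic function of \<open>X\<close>. Poisson summation gives
  \<open>W\<^sub>L\<^sub>,\<^sub>j = \<theta> \<Sum>\<^sub>m \<psi>(2\<pi>m/L)\<^sup>j\<close>, so \<open>exp G\<^sub>L(z)\<close> is formally the product of the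
  \<open>(1 - z \<psi>(2\<pi>m/L))\<^bsup>-\<theta>\<^esup>\<close>. Cauchy's formula on the circle of radius \<open>r = 1 - 1/L^2\<close>, with angle
  \<open>u/L^2\<close>, writes \<open>H\<^sub>n\<close> as a Fourier integral of \<open>exp (G\<^sub>L(r e\<^bsup>iu/L^2\<^esup>) - G\<^sub>L(r))\<close>. The \<open>u\<close>-derivative of
  the exponent tends to a multiple of \<open>\<Sum>\<^sub>m 1/(w + 2\<pi>\<^sup>2\<sigma>\<^sup>2m\<^sup>2)\<close> with \<open>w = 1 - iu\<close>, a hyperbolic cotangent
  (Poisson summation again, for \<open>e\<^bsup>-c|x|\<^esup>\<close>), so the limiting integrand is a power of a hyperbolic sine of
  \<open>\<surd>w\<close>. Since the weights are nonnegative and \<open>W\<^sub>L\<^sub>,\<^sub>j\<close> is at least of order \<open>L / \<surd>j\<close> (local limit theorem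
  at \<open>0\<close>), the integrand is dominated by \<open>exp (-\<kappa> \<surd>|u|)\<close>; dominated convergence is then uniform in \<open>n\<close>.
  The binomial series turns the limit into a sum of inverse Laplace transforms of \<open>e\<^bsup>-a\<surd>w\<^esup>\<close>, which are the
  Levy densities in the statement.\<close>

section \<open>Poisson summation\<close>

text \<open>The radius and the angular scale come from N/L^2 = (rho/sqrt N)^2, which tends to
  alpha^2: the frequency s = n/L^2 of the n-th coefficient stays in a compact interval, (1 -
  1/L^2)^n is close to exp(-s), and exp(G_L(1 - 1/L^2)) remains in the statement as an unevaluated
  size. No logarithm of the infinite product has to be chosen: only the derivative in u is expanded
  over m, where the series is absolutely summable, and the exponent is recovered by integrating from
  u = 0. The main obstacle is domination. The scaling limit describes bounded u only, whereas the
  integral runs over |u| <= pi L^2, so the decay must come from an inequality valid on the whole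
  circle; it is obtained by discarding all but a window of the nonnegative terms of G_L. The index n
  enters only through a phase of modulus one, which gives an absolute error uniform in n. Passing to
  a relative error uses that the limit is continuous and positive on a compact range of s,
  positivity being visible because (-1)^n binom(-2 theta, n) is a rising factorial of 2 theta over
  n!.\<close>

text \<open>A majorant that factors reduces joint integrability to two one-variable integrals. It
  serves both for two Lebesgue integrals and for exchanging an integral with a sum over the
  integers.\<close>

lemma Fubini_product_bound:
  fixes f :: "'a \<Rightarrow> 'b \<Rightarrow> complex"
  assumes "sigma_finite_measure M1" "sigma_finite_measure M2"
    and m: "case_prod f \<in> borel_measurable (M1 \<Otimes>\<^sub>M M2)"
    and a: "integrable M1 a" and b: "integrable M2 b"
    and le: "\<And>x y. norm (f x y) \<le> a x * b y"
  shows "(LINT x|M1. (LINT y|M2. f x y)) = (LINT y|M2. (LINT x|M1. f x y))"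
proof -
  interpret M1: sigma_finite_measure M1 by fact
  interpret M2: sigma_finite_measure M2 by fact
  interpret pair_sigma_finite M1 M2 ..
  note [measurable] = m
  have [measurable]: "a \<in> borel_measurable M1" "b \<in> borel_measurable M2"
    using a b by auto
  have iy: "integrable M2 (\<lambda>y. f x y)" if "x \<in> space M1" for x
  proof (rule Bochner_Integration.integrable_bound)
    show "integrable M2 (\<lambda>y. a x * b y)" using b by simp
    show "(\<lambda>y. f x y) \<in> borel_measurable M2" using that by measurable
    show "AE y in M2. norm (f x y) \<le> norm (a x * b y)"
      using le by (auto intro: order_trans[OF _ abs_ge_self])
  qed
  have "integrable (M1 \<Otimes>\<^sub>M M2) (case_prod f)"
  proof (rule Fubini_integrable)
    show "case_prod f \<in> borel_measurable (M1 \<Otimes>\<^sub>M M2)" by fact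
    show "AE x in M1. integrable M2 (\<lambda>y. case (x, y) of (x, y) \<Rightarrow> f x y)"
      using iy by auto
    show "integrable M1 (\<lambda>x. LINT y|M2. norm (case (x, y) of (x, y) \<Rightarrow> f x y))"
    proof (rule Bochner_Integration.integrable_bound)
      show "integrable M1 (\<lambda>x. a x * (LINT y|M2. b y))" using a by simp
      show "(\<lambda>x. LINT y|M2. norm (case (x, y) of (x, y) \<Rightarrow> f x y)) \<in> borel_measurable M1"
        by measurable
      show "AE x in M1. norm (LINT y|M2. norm (case (x, y) of (x, y) \<Rightarrow> f x y))
              \<le> norm (a x * (LINT y|M2. b y))"
      proof (rule AE_I2)
        fix x assume x: "x \<in> space M1"
        have "norm (LINT y|M2. norm (f x y)) = (LINT y|M2. norm (f x y))" by simp
        also have "\<dots> \<le> (LINT y|M2. a x * b y)"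
          using b iy[OF x] le by (intro integral_mono) auto
        also have "\<dots> \<le> norm (a x * (LINT y|M2. b y))" by simp
        finally show "norm (LINT y|M2. norm (case (x, y) of (x, y) \<Rightarrow> f x y))
              \<le> norm (a x * (LINT y|M2. b y))" by simp
      qed
    qed
  qed
  from Fubini_integral[OF this] show ?thesis by simp
qed

lemma norm_integral_le:
  fixes f :: "'a \<Rightarrow> 'b::{banach,second_countable_topology}"
  assumes g: "integrable M g" and le: "\<And>x. x \<in> space M \<Longrightarrow> norm (f x) \<le> g x"
  shows "norm (LINT x|M. f x) \<le> (LINT x|M. g x)"
proof (cases "integrable M f")
  case True
  have "norm (LINT x|M. f x) \<le> (LINT x|M. norm (f x))" by simp
  also have "\<dots> \<le> (LINT x|M. g x)" using True g le by (intro integral_mono) auto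
  finally show ?thesis .
next
  case False
  \<comment> \<open>A non-integrable function has Bochner integral 0 by convention, and
    \<open>g\<close> dominates a norm, so the bound persists.\<close>
  have "0 \<le> (LINT x|M. g x)"
    by (intro Bochner_Integration.integral_nonneg_AE AE_I2 order_trans[OF norm_ge_zero le])
  then show ?thesis using False by (simp add: not_integrable_integral_eq)
qed

text \<open>Bilateral series are treated as integrals against counting measure on the integers, so
  that Fubini and dominated convergence apply to them directly. This is the way back to one-sided
  series, where geometric sums can be evaluated.\<close>

lemma integral_count_space_int:
  fixes f :: "int \<Rightarrow> complex"
  assumes "summable (\<lambda>n. norm (f (int n)))" "summable (\<lambda>n. norm (f (- int (Suc n))))"
  shows "integrable (count_space UNIV) f"
    and "(LINT m|count_space UNIV. f m) = (\<Sum>n. f (int n)) + (\<Sum>n. f (- int (Suc n)))"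
proof -
  let ?A = "range int" and ?B = "range (\<lambda>n. - int (Suc n))"
  have U: "UNIV = ?A \<union> ?B"
  proof (intro equalityI subsetI)
    fix m :: int
    show "m \<in> ?A \<union> ?B"
      by (cases m rule: int_cases) auto
  qed auto
  have dis: "?A \<inter> ?B = {}" by auto
  have i1: "inj int" by (auto simp: inj_on_def)
  have i2: "inj (\<lambda>n. - int (Suc n))" by (auto simp: inj_on_def)
  have A: "Infinite_Set_Sum.abs_summable_on f ?A"
    using assms(1) abs_summable_on_reindex_iff[OF i1, of f] by (simp add: abs_summable_on_nat_iff')
  have B: "Infinite_Set_Sum.abs_summable_on f ?B"
    using assms(2) abs_summable_on_reindex_iff[OF i2, of f] by (simp add: abs_summable_on_nat_iff')
  have "Infinite_Set_Sum.abs_summable_on f (?A \<union> ?B)" using A B by (rule abs_summable_on_union)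
  then show "integrable (count_space UNIV) f" 
    unfolding U[symmetric] by (simp add: abs_summable_on_def)
  have "infsetsum f UNIV = infsetsum f ?A + infsetsum f ?B"
    unfolding U by (rule infsetsum_Un_disjoint[OF A B dis])
  also have "infsetsum f ?A = infsetsum (\<lambda>n. f (int n)) UNIV"
    by (rule infsetsum_reindex[OF i1])
  also have "\<dots> = (\<Sum>n. f (int n))"
    using assms(1) by (intro infsetsum_nat') (simp add: abs_summable_on_nat_iff')
  also have "infsetsum f ?B = infsetsum (\<lambda>n. f (- int (Suc n))) UNIV"
    by (rule infsetsum_reindex[OF i2])
  also have "\<dots> = (\<Sum>n. f (- int (Suc n)))"
    using assms(2) by (intro infsetsum_nat') (simp add: abs_summable_on_nat_iff')
  finally show "(LINT m|count_space UNIV. f m) = (\<Sum>n. f (int n)) + (\<Sum>n. f (- int (Suc n)))"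
    by (simp add: infsetsum_def)
qed

lemma integrable_int_quadratic:
  assumes "c > 0"
  shows "integrable (count_space (UNIV::int set)) (\<lambda>m. 1 / (1 + c * (real_of_int m)^2))"
proof -
  have s: "summable (\<lambda>n. norm (complex_of_real (1 / (1 + c * (real n)^2))))"
  proof (rule summable_comparison_test_ev)
    show "\<forall>\<^sub>F n in sequentially. norm (norm (complex_of_real (1 / (1 + c * (real n)^2)))) \<le> (1/c) * (1 / (real n)^2)"
    proof (rule eventually_mono[OF eventually_gt_at_top[of 0]])
      fix n :: nat assume "n > 0"
      have "\<bar>1 / (1 + c * (real n)^2)\<bar> = 1 / (1 + c * (real n)^2)"
        using assms by (intro abs_of_nonneg) auto
      also have "\<dots> \<le> 1 / (c * (real n)^2)"
        using \<open>n > 0\<close> assms by (intro divide_left_mono) (auto intro!: mult_pos_pos add_pos_nonneg)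
      finally show "norm (norm (complex_of_real (1 / (1 + c * (real n)^2)))) \<le> (1/c) * (1 / (real n)^2)"
        by (simp only: norm_of_real) simp
    qed
    show "summable (\<lambda>n. (1/c) * (1 / (real n)^2))"
      using inverse_power_summable[of 2, where 'a=real] by (intro summable_mult) (simp add: field_simps)
  qed
  have "integrable (count_space (UNIV::int set)) (\<lambda>m. complex_of_real (1 / (1 + c * (real_of_int m)^2)))"
  proof (rule integral_count_space_int)
    show "summable (\<lambda>n. norm (complex_of_real (1 / (1 + c * (real_of_int (int n))^2))))" using s by simp
    have "summable (\<lambda>n. norm (complex_of_real (1 / (1 + c * (real (Suc n))^2))))"
      using s by (subst summable_Suc_iff)
    then show "summable (\<lambda>n. norm (complex_of_real (1 / (1 + c * (real_of_int (- int (Suc n)))^2))))"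
      by (simp only: of_int_minus power2_minus of_int_of_nat_eq)
  qed
  then show ?thesis by (simp only: complex_of_real_integrable_eq)
qed

lemma integrable_inverse_1_plus_square: "integrable lborel (\<lambda>x::real. 1 / (1 + x^2))"
  using Sinc_Integral.integrable_inverse_1_plus_square
  by (simp add: set_integrable_def einterval_def inverse_eq_divide)

lemma integrable_quadratic_bound:
  fixes f :: "real \<Rightarrow> 'a::{banach,second_countable_topology}"
  assumes "f \<in> borel_measurable lborel" "\<And>x. norm (f x) \<le> C / (1 + x^2)"
  shows "integrable lborel f"
proof (rule Bochner_Integration.integrable_bound)
  show "integrable lborel (\<lambda>x. C * (1 / (1 + x^2)))"
    by (intro integrable_mult_right integrable_inverse_1_plus_square)
  show "AE x in lborel. norm (f x) \<le> norm (C * (1 / (1 + x^2)))"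
    using order_trans[OF assms(2) abs_ge_self] by (auto simp: abs_mult)
qed fact

text \<open>Sign and normalisation are those of the characteristic function: positive exponent, no
  factor 2 pi.\<close>

definition ft :: "(real \<Rightarrow> complex) \<Rightarrow> real \<Rightarrow> complex" where
  "ft f t = (LINT x|lborel. iexp (t * x) * f x)"

section \<open>The Poisson kernel of the disc with period 1: Abel means of Fourier series\<close>

definition poisson_kernel :: "real \<Rightarrow> real \<Rightarrow> real" where
  "poisson_kernel r x = (1 - r^2) / (1 - 2 * r * cos (2 * pi * x) + r^2)"

text \<open>This form shows positivity and yields both estimates of the kernel: the first square
  bounds it everywhere, the sine term bounds it away from the integers.\<close>

lemma poisson_kernel_denom:
  "1 - 2 * r * cos (2 * pi * x) + r^2 = (1 - r)^2 + 4 * r * (sin (pi * x))^2"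
proof -
  have "cos (2 * pi * x) = 1 - 2 * (sin (pi * x))^2"
    using cos_double_sin[of "pi * x"] by (simp add: mult.assoc)
  then show ?thesis by algebra
qed

lemma poisson_kernel_nonneg: "0 \<le> r \<Longrightarrow> r < 1 \<Longrightarrow> 0 \<le> poisson_kernel r x"
  unfolding poisson_kernel_def poisson_kernel_denom
  by (intro divide_nonneg_nonneg) (auto simp: power_le_one)

lemma poisson_kernel_measurable [measurable]: "poisson_kernel r \<in> borel_measurable borel"
  unfolding poisson_kernel_def by measurable

text \<open>The two half-series are geometric in q = r exp(2 pi i x) and in its conjugate; over a
  common denominator the numerator is 1 - |q|^2.\<close>

lemma poisson_kernel_series:
  assumes r: "0 \<le> r" "r < 1"
  shows "integrable (count_space (UNIV::int set)) (\<lambda>m. r ^ nat \<bar>m\<bar>)" (is ?int)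
    and "(LINT m|count_space (UNIV::int set). complex_of_real (r ^ nat \<bar>m\<bar>) * iexp (2 * pi * m * x))
           = of_real (poisson_kernel r x)"
proof -
  define q where "q = of_real r * iexp (2 * pi * x)"
  have nq: "norm q = r" using r by (simp add: q_def norm_mult)
  have e: "complex_of_real (r ^ n) * iexp (2 * pi * real n * x) = q ^ n" for n
    by (simp add: q_def power_mult_distrib exp_of_nat_mult[symmetric] mult_ac)
  have e': "complex_of_real (r ^ n) * iexp (2 * pi * (- real n) * x) = (cnj q) ^ n" for n
    by (simp add: q_def power_mult_distrib exp_of_nat_mult[symmetric] exp_cnj mult_ac)
  have s0: "summable (\<lambda>n. r ^ n)" using r by (intro summable_geometric) auto
  have s1: "summable (\<lambda>n. norm (complex_of_real (r ^ nat \<bar>int n\<bar>) * iexp (2 * pi * int n * x)))" for x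
    using s0 r by (simp add: norm_mult norm_power)
  have s2: "summable (\<lambda>n. norm (complex_of_real (r ^ nat \<bar>- int (Suc n)\<bar>) * iexp (2 * pi * (- int (Suc n)) * x)))" for x
  proof -
    have "nat \<bar>- int (Suc n)\<bar> = Suc n" for n by simp
    then show ?thesis using s0 r
      by (simp add: norm_mult norm_power summable_mult del: of_nat_Suc)
  qed
  have "integrable (count_space (UNIV::int set)) (\<lambda>m. complex_of_real (r ^ nat \<bar>m\<bar>) * iexp (2 * pi * m * 0))"
    by (rule integral_count_space_int(1)[OF s1 s2])
  then have "integrable (count_space (UNIV::int set)) (\<lambda>m. complex_of_real (r ^ nat \<bar>m\<bar>))" by simp
  then show ?int by (simp only: complex_of_real_integrable_eq)
  have ne: "q \<noteq> 1" "cnj q \<noteq> 1" using nq r by auto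
  have "(LINT m|count_space (UNIV::int set). complex_of_real (r ^ nat \<bar>m\<bar>) * iexp (2 * pi * m * x))
     = (\<Sum>n. complex_of_real (r ^ nat \<bar>int n\<bar>) * iexp (2 * pi * int n * x))
       + (\<Sum>n. complex_of_real (r ^ nat \<bar>- int (Suc n)\<bar>) * iexp (2 * pi * (- int (Suc n)) * x))"
    by (rule integral_count_space_int(2)[OF s1 s2])
  also have "(\<lambda>n. complex_of_real (r ^ nat \<bar>int n\<bar>) * iexp (2 * pi * int n * x)) = (\<lambda>n. q ^ n)"
    using e by (intro ext) simp
  also have "(\<lambda>n. complex_of_real (r ^ nat \<bar>- int (Suc n)\<bar>) * iexp (2 * pi * (- int (Suc n)) * x)) = (\<lambda>n. cnj q * (cnj q) ^ n)"
  proof (rule ext)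
    fix n
    have "nat \<bar>- int (Suc n)\<bar> = Suc n" by simp
    then show "complex_of_real (r ^ nat \<bar>- int (Suc n)\<bar>) * iexp (2 * pi * (- int (Suc n)) * x) = cnj q * (cnj q) ^ n"
      using e'[of "Suc n"] by (simp only: of_int_minus of_int_of_nat_eq power_Suc)
  qed
  also have "(\<Sum>n. q ^ n) = 1 / (1 - q)" using nq r by (intro suminf_geometric) simp
  also have "(\<Sum>n. cnj q * cnj q ^ n) = cnj q * (1 / (1 - cnj q))" 
    using nq r by (subst suminf_mult) (auto intro!: summable_geometric simp: suminf_geometric)
  also have "1 / (1 - q) + cnj q * (1 / (1 - cnj q)) = (1 - q * cnj q) / ((1 - q) * (1 - cnj q))"
    using ne by (simp add: divide_simps) (simp add: algebra_simps)
  also have "q * cnj q = of_real (r^2)" using nq by (simp add: complex_norm_square[symmetric])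
  also have "(1 - q) * (1 - cnj q) = of_real (1 - 2 * r * cos (2 * pi * x) + r^2)"
  proof -
    have "Re q = r * cos (2 * pi * x)" by (simp add: q_def Re_exp)
    moreover have "(1 - q) * (1 - cnj q) = 1 - of_real (2 * Re q) + q * cnj q"
      by (subst complex_add_cnj[symmetric]) (simp add: algebra_simps)
    ultimately show ?thesis using \<open>q * cnj q = of_real (r^2)\<close> by simp
  qed
  finally show "(LINT m|count_space (UNIV::int set). complex_of_real (r ^ nat \<bar>m\<bar>) * iexp (2 * pi * m * x))
           = of_real (poisson_kernel r x)" by (simp add: poisson_kernel_def)
qed

lemma sigma_finite_count_int: "sigma_finite_measure (count_space (UNIV::int set))"
  by (rule sigma_finite_measure_count_space)

text \<open>Poisson summation in Abel-regularised form: the damping r^|m| makes the exchange of sum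
  and integral absolutely convergent for every integrable \<open>f\<close>.\<close>

lemma poisson_kernel_integral:
  fixes f :: "real \<Rightarrow> complex"
  assumes r: "0 \<le> r" "r < 1" and f: "integrable lborel f"
  shows "(LINT x|lborel. f x * of_real (poisson_kernel r x)) =
         (LINT m|count_space (UNIV::int set). of_real (r ^ nat \<bar>m\<bar>) * ft f (2 * pi * m))"
proof -
  have [measurable]: "f \<in> borel_measurable borel" using f by auto
  have "(LINT x|lborel. f x * of_real (poisson_kernel r x)) =
     (LINT x|lborel. (LINT m|count_space (UNIV::int set). f x * (of_real (r ^ nat \<bar>m\<bar>) * iexp (2 * pi * m * x))))"
    by (simp only: integral_mult_right_zero poisson_kernel_series(2)[OF r])
  also have "\<dots> = (LINT m|count_space (UNIV::int set). (LINT x|lborel. f x * (of_real (r ^ nat \<bar>m\<bar>) * iexp (2 * pi * m * x))))"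
  proof (rule sym, rule Fubini_product_bound[OF sigma_finite_count_int lborel.sigma_finite_measure_axioms])
    show "integrable (count_space UNIV) (\<lambda>m::int. r ^ nat \<bar>m\<bar>)" by (rule poisson_kernel_series(1)[OF r])
    show "integrable lborel (\<lambda>x. norm (f x))" using f by simp
    show "(\<lambda>(m::int, x). f x * (of_real (r ^ nat \<bar>m\<bar>) * iexp (2 * pi * m * x))) \<in> borel_measurable (count_space UNIV \<Otimes>\<^sub>M lborel)"
      by (rule measurable_pair_measure_countable1) auto
    show "norm (f x * (of_real (r ^ nat \<bar>m\<bar>) * iexp (2 * pi * m * x))) \<le> r ^ nat \<bar>m\<bar> * norm (f x)" for m :: int and x
      using r by (simp add: norm_mult norm_power)
  qed
  also have "\<dots> = (LINT m|count_space (UNIV::int set). of_real (r ^ nat \<bar>m\<bar>) * ft f (2 * pi * m))"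
    unfolding ft_def by (subst integral_mult_right_zero[symmetric]) (simp add: mult_ac)
  finally show ?thesis .
qed


lemma integral_unit_exp:
  "(LINT x|lborel. iexp (2 * pi * of_int m * x) * of_real (indicator {-1/2..1/2} x)) = (if m = 0 then 1 else 0)"
proof (cases "m = 0")
  case True
  then show ?thesis by (simp add: measure_def)
next
  case False
  define F where "F x = iexp (2 * pi * of_int m * x) / (2 * pi * \<i> * of_int m)" for x :: real
  have "((\<lambda>x. iexp (2 * pi * of_int m * x)) has_integral (F (1/2) - F (-1/2))) {-1/2..1/2}"
  proof (rule fundamental_theorem_of_calculus)
    fix x :: real
    have "((\<lambda>z. exp (\<i> * (2 * pi * of_int m * z)) / (2 * pi * \<i> * of_int m)) has_field_derivative
            iexp (2 * pi * of_int m * x)) (at (of_real x))"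
      using False by (auto intro!: derivative_eq_intros simp: field_simps)
    from has_vector_derivative_real_field[OF this]
    show "(F has_vector_derivative iexp (2 * pi * of_int m * x)) (at x within {-1/2..1/2})"
      by (simp add: F_def[abs_def])
  qed simp
  moreover have "F (1/2) = F (-1/2)"
  proof -
    have "\<i> * complex_of_real (2 * pi * of_int m * (1/2)) = \<i> * complex_of_real (2 * pi * of_int m * (-1/2)) + \<i> * (of_int m * (of_real pi * 2))"
      by (simp add: algebra_simps)
    then have "iexp (2 * pi * of_int m * (1/2)) = iexp (2 * pi * of_int m * (-1/2)) * exp (\<i> * (of_int m * (of_real pi * 2)))"
      by (simp only: exp_add)
    then show ?thesis by (simp add: F_def)
  qed
  ultimately have "integral {-1/2..1/2} (\<lambda>x. iexp (2 * pi * of_int m * x)) = 0"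
    by (simp add: integral_unique)
  moreover have "set_integrable lborel {-1/2..1/2} (\<lambda>x. iexp (2 * pi * of_int m * x))"
    by (intro borel_integrable_atLeastAtMost' continuous_intros)
  ultimately have "(LINT x:{-1/2..1/2}|lborel. iexp (2 * pi * of_int m * x)) = 0"
    by (subst set_borel_integral_eq_integral) auto
  then show ?thesis using False
    by (simp add: set_lebesgue_integral_def scaleR_conv_of_real mult.commute)
qed

lemma poisson_kernel_mass:
  assumes r: "0 \<le> r" "r < 1"
  shows "(LINT x|lborel. complex_of_real (indicator {-1/2..1/2} x) * of_real (poisson_kernel r x)) = 1"
proof -
  have "integrable lborel (\<lambda>x. complex_of_real (indicator {-1/2..1/2::real} x))"
    by (simp add: complex_of_real_integrable_eq)
  \<comment> \<open>Applied to the indicator of one period, the regularised formula keeps only m =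
    0, whose weight is r^0 = 1.\<close>
  from poisson_kernel_integral[OF r this]
  have "(LINT x|lborel. complex_of_real (indicator {-1/2..1/2} x) * of_real (poisson_kernel r x)) =
     (LINT m|count_space (UNIV::int set). of_real (r ^ nat \<bar>m\<bar>) * (if m = 0 then 1 else 0))"
    by (simp only: ft_def integral_unit_exp)
  also have "\<dots> = (LINT m|count_space (UNIV::int set). indicator {0} m *\<^sub>R 1)"
    by (intro Bochner_Integration.integral_cong) (auto simp: indicator_def)
  also have "\<dots> = 1" by (simp add: integral_scaleR_left)
  finally show ?thesis .
qed

lemma poisson_kernel_mass_real:
  assumes r: "0 \<le> r" "r < 1"
  shows "integrable lborel (\<lambda>x. indicator {-1/2..1/2} x * poisson_kernel r x)" (is ?I)
    and "(LINT x|lborel. indicator {-1/2..1/2} x * poisson_kernel r x) = 1" (is ?M)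
proof -
  show ?M using poisson_kernel_mass[OF r] unfolding of_real_mult[symmetric] integral_complex_of_real
    by (simp only: of_real_eq_1_iff)
  \<comment> \<open>A non-integrable function would have integral 0, so the value 1 already
    certifies integrability.\<close>
  then show ?I using not_integrable_integral_eq by fastforce
qed

text \<open>Sine is concave on [0, pi/2] and so lies above its chord.\<close>

lemma jordan_sine:
  assumes "0 \<le> x" "x \<le> pi / 2"
  shows "2 * x / pi \<le> sin x"
proof -
  have "convex_on {0..pi/2} (\<lambda>x. - sin x)"
    by (rule f''_ge0_imp_convex[where f' = "\<lambda>x. - cos x" and f'' = sin])
       (auto intro!: derivative_eq_intros sin_ge_zero)
  from convex_onD[OF this, of "2 * x / pi" 0 "pi/2"] show ?thesis
    using assms by simp
qed

lemma poisson_kernel_bound: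
  fixes d :: real
  assumes r: "0 < r" "r < 1" and x: "d \<le> \<bar>x\<bar>" "\<bar>x\<bar> \<le> 1/2" and d: "d > 0"
  shows "poisson_kernel r x \<le> (1 - r^2) / (16 * r * d^2)"
proof -
  have "2 * \<bar>x\<bar> \<le> sin (pi * \<bar>x\<bar>)"
    using x jordan_sine[of "pi * \<bar>x\<bar>"] by simp
  then have "(2 * d)^2 \<le> (sin (pi * \<bar>x\<bar>))^2"
    using x d by (intro power_mono) auto
  also have "(sin (pi * \<bar>x\<bar>))^2 = (sin (pi * x))^2" by (cases "x \<ge> 0") auto
  finally have "4 * r * (2 * d)^2 \<le> (1 - r)^2 + 4 * r * (sin (pi * x))^2"
    using r by (simp add: add_increasing)
  then have "16 * r * d^2 \<le> 1 - 2 * r * cos (2 * pi * x) + r^2"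
    unfolding poisson_kernel_denom by (simp add: power_mult_distrib)
  then show ?thesis unfolding poisson_kernel_def
    using r d by (intro divide_left_mono) (auto simp: power_le_one intro!: mult_pos_pos intro: less_le_trans[rotated])
qed


lemma poisson_kernel_bounded:
  assumes r: "0 \<le> r" "r < 1"
  shows "poisson_kernel r x \<le> (1 - r^2) / (1 - r)^2"
  unfolding poisson_kernel_def poisson_kernel_denom using r
  by (intro divide_left_mono) (auto simp: power_le_one intro!: mult_pos_pos add_pos_nonneg)

text \<open>The usual approximate-identity argument: near 0 continuity is weighed against total mass
  1, and away from 0 the kernel itself tends to 0 uniformly.\<close>

lemma poisson_kernel_approx_identity:
  fixes h :: "real \<Rightarrow> complex"
  assumes h: "continuous_on UNIV h"
  shows "((\<lambda>r. LINT x|lborel. indicator {-1/2..1/2} x *\<^sub>R h x * of_real (poisson_kernel r x)) \<longlongrightarrow> h 0) (at_left 1)"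
proof (rule tendstoI)
  fix e :: real assume e: "e > 0"
  have "isCont h 0" using h by (simp add: continuous_on_eq_continuous_at)
  then obtain d0 where d0: "d0 > 0" "\<And>x. \<bar>x\<bar> < d0 \<Longrightarrow> norm (h x - h 0) < e / 2"
    using e unfolding continuous_at_eps_delta dist_norm by (metis diff_zero half_gt_zero real_norm_def)
  have "compact (h ` {-1/2..1/2})"
    by (intro compact_continuous_image continuous_on_subset[OF h]) auto
  then obtain B where B: "B > 0" "\<And>x. x \<in> {-1/2..1/2} \<Longrightarrow> norm (h x) \<le> B"
    using compact_imp_bounded[of "h ` {-1/2..1/2}"] unfolding bounded_pos by (metis imageI)
  have [measurable]: "h \<in> borel_measurable borel" using h by (rule borel_measurable_continuous_onI)
  \<comment> \<open>The contribution of |x| >= d0: the oscillation of \<open>h\<close> is at most 2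
    B there, and the other factor is the bound of \<open>poisson_kernel_bound\<close>. It vanishes
    as r tends to 1.\<close>
  define c where "c r = 2 * B * ((1 - r^2) / (16 * r * d0^2))" for r
  have "((\<lambda>r. e/2 + c r) \<longlongrightarrow> e/2 + c 1) (at_left 1)"
    unfolding c_def using d0 by (intro tendsto_intros) auto
  then have ev: "eventually (\<lambda>r. e/2 + c r < e) (at_left 1)"
    using e by (intro order_tendstoD(2)[where y="e/2 + c 1"]) (auto simp: c_def)
  have ev2: "eventually (\<lambda>r::real. r \<in> {0<..<1}) (at_left 1)"
    by (rule eventually_at_leftI[of 0]) auto
  show "eventually (\<lambda>r. dist (LINT x|lborel. indicator {-1/2..1/2} x *\<^sub>R h x * of_real (poisson_kernel r x)) (h 0) < e) (at_left 1)"
    using ev ev2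
  proof eventually_elim
    case (elim r)
    then have r: "0 < r" "r < 1" by auto
    let ?I = "\<lambda>x::real. indicator {-1/2..1/2} x :: real"
    define K where "K = (1 - r^2) / (1 - r)^2"
    have K: "poisson_kernel r x \<le> K" "0 \<le> poisson_kernel r x" for x
      using poisson_kernel_bounded[of r x] poisson_kernel_nonneg[of r x] r by (auto simp: K_def)
    have int1: "integrable lborel (\<lambda>x. ?I x *\<^sub>R (g x * of_real (poisson_kernel r x)))"
      if [measurable]: "g \<in> borel_measurable borel" and g: "\<And>x. x \<in> {-1/2..1/2} \<Longrightarrow> norm (g x) \<le> D" for g :: "real \<Rightarrow> complex" and D
    proof (rule Bochner_Integration.integrable_bound)
      show "integrable lborel (\<lambda>x. ?I x *\<^sub>R (D * K))" by simp
      show "AE x in lborel. norm (?I x *\<^sub>R (g x * of_real (poisson_kernel r x))) \<le> norm (?I x *\<^sub>R (D * K))"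
      proof (rule AE_I2)
        fix x
        show "norm (?I x *\<^sub>R (g x * of_real (poisson_kernel r x))) \<le> norm (?I x *\<^sub>R (D * K))"
        proof (cases "x \<in> {-1/2..1/2}")
          case True
          have "norm (g x) * poisson_kernel r x \<le> D * K"
            using g[OF True] K[of x] by (intro mult_mono) (auto intro: order_trans[OF norm_ge_zero])
          then show ?thesis using True K[of x] by (simp add: norm_mult)
        qed auto
      qed
    qed measurable
    have i1: "integrable lborel (\<lambda>x. ?I x *\<^sub>R (h x * of_real (poisson_kernel r x)))"
      by (rule int1[of _ B]) (use B in auto)
    have i2: "integrable lborel (\<lambda>x. ?I x *\<^sub>R (h 0 * of_real (poisson_kernel r x)))"
      by (rule int1[of _ "norm (h 0)"]) auto
    have r': "0 \<le> r" "r < 1" using r by auto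
    note i3' = poisson_kernel_mass_real(1)[OF r'] and m3 = poisson_kernel_mass_real(2)[OF r']
    have split: "?I x * (e / 2 * poisson_kernel r x + c r) = e / 2 * (?I x * poisson_kernel r x) + c r * ?I x" for x
      by (simp only: distrib_left distrib_right mult_ac)
    have i4: "integrable lborel (\<lambda>x. ?I x * (e / 2 * poisson_kernel r x + c r))"
    proof -
      have "integrable lborel (\<lambda>x. e / 2 * (?I x * poisson_kernel r x) + c r * ?I x)"
        using i3' by (intro Bochner_Integration.integrable_add integrable_mult_right) auto
      then show ?thesis unfolding split .
    qed
    have "(LINT x|lborel. ?I x *\<^sub>R (h 0 * of_real (poisson_kernel r x))) = 
        (LINT x|lborel. h 0 * of_real (?I x * poisson_kernel r x))"
      by (simp add: scaleR_conv_of_real mult_ac)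
    also have "\<dots> = h 0" by (simp only: integral_mult_right_zero integral_complex_of_real m3) simp
    finally have h0: "(LINT x|lborel. ?I x *\<^sub>R (h 0 * of_real (poisson_kernel r x))) = h 0" .
    have eq: "(LINT x|lborel. ?I x *\<^sub>R h x * of_real (poisson_kernel r x)) - h 0 =
          (LINT x|lborel. ?I x *\<^sub>R (h x * of_real (poisson_kernel r x)) - ?I x *\<^sub>R (h 0 * of_real (poisson_kernel r x)))"
      unfolding Bochner_Integration.integral_diff[OF i1 i2] h0 mult_scaleR_left ..
    have "norm ((LINT x|lborel. ?I x *\<^sub>R h x * of_real (poisson_kernel r x)) - h 0) \<le> (LINT x|lborel. ?I x * (e / 2 * poisson_kernel r x + c r))"
      unfolding eq
    proof (rule norm_integral_le)

      show "integrable lborel (\<lambda>x. ?I x * (e / 2 * poisson_kernel r x + c r))" by fact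
      fix x :: real
      have c0: "c r \<ge> 0" unfolding c_def using r B by (auto simp: power_le_one)
      have "norm ((h x - h 0) * of_real (poisson_kernel r x)) \<le> e / 2 * poisson_kernel r x + c r" if x: "x \<in> {-1/2..1/2}"
      proof (cases "\<bar>x\<bar> < d0")
        case True
        then have "norm (h x - h 0) * poisson_kernel r x \<le> e / 2 * poisson_kernel r x"
          using d0(2)[of x] K(2)[of x] by (intro mult_right_mono) auto
        then show ?thesis using c0 K(2)[of x] by (simp add: norm_mult)
      next
        case False
        have "norm (h x - h 0) \<le> 2 * B"
          using norm_triangle_ineq4[of "h x" "h 0"] B(2)[OF x] B(2)[of 0] by simp
        moreover have "poisson_kernel r x \<le> (1 - r^2) / (16 * r * d0^2)"
          using r x False d0 by (intro poisson_kernel_bound) auto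
        ultimately have "norm (h x - h 0) * poisson_kernel r x \<le> c r"
          unfolding c_def using K(2)[of x] B(1) by (intro mult_mono) auto
        moreover have "0 \<le> e / 2 * poisson_kernel r x" using e K(2)[of x] by simp
        ultimately show ?thesis using K(2)[of x] by (simp add: norm_mult)
      qed
      then show "norm (?I x *\<^sub>R (h x * of_real (poisson_kernel r x)) - ?I x *\<^sub>R (h 0 * of_real (poisson_kernel r x)))
           \<le> ?I x * (e / 2 * poisson_kernel r x + c r)"
        unfolding scaleR_diff_right[symmetric] left_diff_distrib[symmetric]
        by (cases "x \<in> {-1/2..1/2}") (simp_all only: indicator_simps if_True if_False not_False_eq_True scaleR_one scaleR_zero_left mult_1_left mult_zero_left norm_zero order_refl simp_thms)
    qed
    also have "(LINT x|lborel. ?I x * (e / 2 * poisson_kernel r x + c r)) = 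
         (LINT x|lborel. e / 2 * (?I x * poisson_kernel r x)) + (LINT x|lborel. c r * ?I x)"
      unfolding split
      by (intro Bochner_Integration.integral_add integrable_mult_right i3') simp
    also have "\<dots> = e / 2 + c r"
      unfolding integral_mult_right_zero m3 by (simp add: measure_def)
    also have "\<dots> < e" by fact
    finally show ?case by (simp add: dist_norm)
  qed
qed

lemma integral_unit_partition:
  fixes g :: "real \<Rightarrow> complex"
  assumes g: "integrable lborel g"
  shows "(LINT k|count_space (UNIV::int set). (LINT x|lborel. indicator {-(1/2)..<1/2} x *\<^sub>R g (x + of_int k))) = (LINT x|lborel. g x)"
proof -
  let ?J = "\<lambda>x::real. indicator {-(1/2)..<1/2} x :: real"
  interpret C: sigma_finite_measure "count_space (UNIV::int set)" by (rule sigma_finite_count_int)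
  interpret pair_sigma_finite lborel "count_space (UNIV::int set)" ..
  have [measurable]: "g \<in> borel_measurable borel" using g by auto
  \<comment> \<open>The half-open interval makes its integer translates a partition: exactly one
    \<open>k\<close> catches each \<open>x\<close>, the nearest integer with ties rounded
    up.\<close>
  have J: "?J (x - of_int k) = indicator {\<lfloor>x + 1/2\<rfloor>} k" for x and k :: int
    by (auto simp: indicator_def floor_eq_iff) linarith+
  have c: "integrable (count_space (UNIV::int set)) (indicator {\<lfloor>x + 1/2\<rfloor>} :: int \<Rightarrow> real)" for x :: real
    by simp
  have int: "integrable (lborel \<Otimes>\<^sub>M count_space UNIV) (\<lambda>(x, k::int). ?J (x - of_int k) *\<^sub>R g x)"
  proof (rule Fubini_integrable)
    show "(\<lambda>(x, k::int). ?J (x - of_int k) *\<^sub>R g x) \<in> borel_measurable (lborel \<Otimes>\<^sub>M count_space UNIV)"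
    proof (subst measurable_pair_swap_iff, rule measurable_pair_measure_countable1)
    qed auto
    show "integrable lborel (\<lambda>x. LINT k|count_space (UNIV::int set). norm (case (x, k) of (x, k) \<Rightarrow> ?J (x - of_int k) *\<^sub>R g x))"
      using g c by (simp add: J)
    show "AE x in lborel. integrable (count_space (UNIV::int set)) (\<lambda>k. case (x, k) of (x, k) \<Rightarrow> ?J (x - of_int k) *\<^sub>R g x)"
      using c by (auto simp: J)
  qed
  have "(LINT x|lborel. ?J x *\<^sub>R g (x + of_int k)) = (LINT x|lborel. ?J (x - of_int k) *\<^sub>R g x)" for k :: int
    using lborel_integral_real_affine[of 1 "\<lambda>x. ?J (x - of_int k) *\<^sub>R g x" "of_int k"] by (simp add: add.commute)
  then have "(LINT k|count_space (UNIV::int set). (LINT x|lborel. ?J x *\<^sub>R g (x + of_int k))) =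
     (LINT k|count_space (UNIV::int set). (LINT x|lborel. ?J (x - of_int k) *\<^sub>R g x))" by simp
  also have "\<dots> = (LINT x|lborel. (LINT k|count_space (UNIV::int set). ?J (x - of_int k) *\<^sub>R g x))"
    by (rule Fubini_integral[OF int])
  also have "\<dots> = (LINT x|lborel. g x)"
    using c by (simp add: J)
  finally show ?thesis .
qed

lemma poisson_kernel_periodic: "poisson_kernel r (x + of_int k) = poisson_kernel r x"
proof -
  have "cos (2 * pi * (x + of_int k)) = cos (2 * pi * x)"
    using cos_integer_2pi[of "of_int k"] sin_integer_2pi[of "of_int k"]
    by (simp add: distrib_left cos_add)
  then show ?thesis by (simp add: poisson_kernel_def)
qed

text \<open>The integral of \<open>f\<close> against the Poisson kernel is evaluated in two ways.
  Folded onto one period it becomes a sum of local averages, each tending to f(k); expanded into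
  harmonics it becomes an Abel mean of the transform values. Both sums pass to the limit r -> 1 by
  dominated convergence.\<close>

lemma poisson_summation:
  fixes f :: "real \<Rightarrow> complex"
  assumes f: "continuous_on UNIV f" and C: "\<And>x. norm (f x) \<le> C / (1 + x^2)"
    and s: "integrable (count_space (UNIV::int set)) (\<lambda>m. ft f (2 * pi * m))"
  shows "(LINT k|count_space (UNIV::int set). f k) = (LINT m|count_space (UNIV::int set). ft f (2 * pi * m))"
proof -
  define q :: "nat \<Rightarrow> real" where "q n = 1 - 1 / (real n + 2)" for n
  have q: "0 < q n" "q n < 1" for n by (auto simp: q_def field_simps)
  have ql: "filterlim q (at_left 1) sequentially"
    unfolding q_def by real_asymp
  have [measurable]: "f \<in> borel_measurable borel" using f by (rule borel_measurable_continuous_onI)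
  have fi: "integrable lborel f" by (rule integrable_quadratic_bound[OF _ C]) simp
  have C0: "C \<ge> 0" using order_trans[OF norm_ge_zero C[of 0]] by simp
  let ?I = "\<lambda>x::real. indicator {-1/2..1/2} x :: real"
  define a where "a n k = (LINT x|lborel. ?I x *\<^sub>R f (x + of_int k) * of_real (poisson_kernel (q n) x))" for n k
  have shift: "norm (f (x + of_int k)) \<le> 4 * C / (1 + (of_int k)^2)" if "x \<in> {-1/2..1/2}" for x and k :: int
  proof -
    have "(1 + (real_of_int k)^2) \<le> 4 * (1 + (x + of_int k)^2)"
    proof -
      have "\<bar>x\<bar> \<le> 1/2" using that by auto
      then have "x^2 \<le> 1/4" using power_mono[of "\<bar>x\<bar>" "1/2" 2] by (simp add: power2_eq_square)
      \<comment> \<open>The difference 4 (1 + (x + k)^2) - (1 + k^2) equals 3 - 2 x^2 plus these two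
        squares, and x^2 <= 1/4.\<close>
      moreover have "0 \<le> (2 * x + of_int k)^2 + 2 * (x + of_int k)^2" by simp
      ultimately show ?thesis by (simp add: power2_eq_square algebra_simps)
    qed
    then have "C / (1 + (x + of_int k)^2) \<le> C / ((1 + (of_int k)^2) / 4)"
      using C0 by (intro divide_left_mono) (auto intro!: mult_pos_pos add_pos_nonneg)
    also have "C / ((1 + (real_of_int k)^2) / 4) = 4 * C / (1 + (of_int k)^2)" by simp
    finally show ?thesis using C[of "x + of_int k"] by linarith
  qed
  have L1: "(\<lambda>n. LINT m|count_space (UNIV::int set). of_real (q n ^ nat \<bar>m\<bar>) * ft f (2 * pi * m))
          \<longlonglongrightarrow> (LINT m|count_space (UNIV::int set). ft f (2 * pi * m))"
  proof (rule integral_dominated_convergence[where w="\<lambda>m::int. norm (ft f (2 * pi * m))"])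
    show "AE m in count_space (UNIV::int set). (\<lambda>n. of_real (q n ^ nat \<bar>m\<bar>) * ft f (2 * pi * m)) \<longlonglongrightarrow> ft f (2 * pi * m)"
    proof (rule AE_I2)
      fix m :: int
      have "q \<longlonglongrightarrow> 1" unfolding q_def by real_asymp
      then have "(\<lambda>n. of_real (q n ^ nat \<bar>m\<bar>) * ft f (2 * pi * m)) \<longlonglongrightarrow> of_real (1 ^ nat \<bar>m\<bar>) * ft f (2 * pi * m)"
        by (intro tendsto_intros)
      then show "(\<lambda>n. of_real (q n ^ nat \<bar>m\<bar>) * ft f (2 * pi * m)) \<longlonglongrightarrow> ft f (2 * pi * m)" by simp
    qed
    show "AE m in count_space (UNIV::int set). norm (of_real (q n ^ nat \<bar>m\<bar>) * ft f (2 * pi * m)) \<le> norm (ft f (2 * pi * m))" for n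
      using q[of n] by (auto simp: norm_mult norm_power intro!: mult_left_le_one_le power_le_one)
  qed (use s in auto)
  have L2: "(\<lambda>n. LINT k|count_space (UNIV::int set). a n k) \<longlonglongrightarrow> (LINT k|count_space (UNIV::int set). f k)"
  proof (rule integral_dominated_convergence[where w="\<lambda>k. 4 * C * (1 / (1 + 1 * (of_int k)^2))"])
    show "integrable (count_space (UNIV::int set)) (\<lambda>k. 4 * C * (1 / (1 + 1 * (real_of_int k)^2)))"
      by (intro integrable_mult_right integrable_int_quadratic) simp
    show "AE k in count_space (UNIV::int set). (\<lambda>n. a n k) \<longlonglongrightarrow> f k"
    proof (rule AE_I2)
      fix k :: int
      have "continuous_on UNIV (\<lambda>x. f (x + of_int k))"
        by (intro continuous_on_compose2[OF f]) (auto intro!: continuous_intros)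
      from filterlim_compose[OF poisson_kernel_approx_identity[OF this] ql]
      show "(\<lambda>n. a n k) \<longlonglongrightarrow> f k" by (simp add: a_def)
    qed
    fix n
    show "AE k in count_space (UNIV::int set). norm (a n k) \<le> 4 * C * (1 / (1 + 1 * (of_int k)^2))"
    proof (rule AE_I2)
      fix k :: int
      let ?D = "4 * C / (1 + (real_of_int k)^2)"
      have r: "0 \<le> q n" "q n < 1" using q[of n] by auto
      note ii = poisson_kernel_mass_real(1)[OF r] and mm = poisson_kernel_mass_real(2)[OF r]
      have "norm (a n k) \<le> (LINT x|lborel. ?D * (?I x * poisson_kernel (q n) x))"
        unfolding a_def
      proof (rule norm_integral_le)
        show "integrable lborel (\<lambda>x. ?D * (?I x * poisson_kernel (q n) x))" using ii by (rule integrable_mult_right)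
        show "norm (?I x *\<^sub>R f (x + of_int k) * of_real (poisson_kernel (q n) x)) \<le> ?D * (?I x * poisson_kernel (q n) x)" for x
        proof (cases "x \<in> {-1/2..1/2}")
          case True
          have P: "0 \<le> poisson_kernel (q n) x" using poisson_kernel_nonneg[of "q n" x] q[of n] by simp
          have "norm (f (x + of_int k)) * poisson_kernel (q n) x \<le> ?D * poisson_kernel (q n) x"
            by (rule mult_right_mono[OF shift[OF True] P])
          moreover have "norm (?I x *\<^sub>R f (x + of_int k) * of_real (poisson_kernel (q n) x)) = norm (f (x + of_int k)) * poisson_kernel (q n) x"
            using True P by (simp only: norm_mult norm_scaleR norm_of_real abs_of_nonneg indicator_simps)
          ultimately show ?thesis using True by (simp only: indicator_simps mult_1_left)
        qed simp
      qed
      also have "\<dots> = ?D" by (simp only: integral_mult_right_zero mm)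
      finally show "norm (a n k) \<le> 4 * C * (1 / (1 + 1 * (of_int k)^2))" by simp
    qed
  qed auto
  have "(LINT k|count_space (UNIV::int set). a n k) =
        (LINT m|count_space (UNIV::int set). of_real (q n ^ nat \<bar>m\<bar>) * ft f (2 * pi * m))" for n
  proof -
    have fp: "integrable lborel (\<lambda>x. f x * of_real (poisson_kernel (q n) x))"
    proof (rule Bochner_Integration.integrable_bound)
      show "integrable lborel (\<lambda>x. f x * of_real ((1 - (q n)^2) / (1 - q n)^2))" using fi by simp
      show "AE x in lborel. norm (f x * of_real (poisson_kernel (q n) x)) \<le> norm (f x * of_real ((1 - (q n)^2) / (1 - q n)^2))"
      proof (rule AE_I2)
        fix x
        have "\<bar>poisson_kernel (q n) x\<bar> \<le> \<bar>(1 - (q n)^2) / (1 - q n)^2\<bar>"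
          using poisson_kernel_bounded[of "q n" x] poisson_kernel_nonneg[of "q n" x] q[of n] by linarith
        then show "norm (f x * of_real (poisson_kernel (q n) x)) \<le> norm (f x * of_real ((1 - (q n)^2) / (1 - q n)^2))"
          unfolding norm_mult norm_of_real by (rule mult_left_mono) simp
      qed
    qed measurable
    have "a n k = (LINT x|lborel. indicator {-(1/2)..<1/2} x *\<^sub>R (f (x + of_int k) * of_real (poisson_kernel (q n) (x + of_int k))))" for k
      unfolding a_def poisson_kernel_periodic
    proof (rule integral_cong_AE)
      show "AE x in lborel. ?I x *\<^sub>R f (x + of_int k) * of_real (poisson_kernel (q n) x) =
          indicator {-(1/2)..<1/2} x *\<^sub>R (f (x + of_int k) * of_real (poisson_kernel (q n) x))"
        using AE_lborel_singleton[of "1/2"] by eventually_elim (auto simp: indicator_def)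
    qed measurable
    then have "(LINT k|count_space (UNIV::int set). a n k) = (LINT x|lborel. f x * of_real (poisson_kernel (q n) x))"
      using integral_unit_partition[OF fp] by simp
    also have "\<dots> = (LINT m|count_space (UNIV::int set). of_real (q n ^ nat \<bar>m\<bar>) * ft f (2 * pi * m))"
      using q[of n] by (intro poisson_kernel_integral fi) auto
    finally show ?thesis .
  qed
  then have "(\<lambda>n. LINT m|count_space (UNIV::int set). of_real (q n ^ nat \<bar>m\<bar>) * ft f (2 * pi * m))
     \<longlonglongrightarrow> (LINT k|count_space (UNIV::int set). f k)" using L2 by simp
  from LIMSEQ_unique[OF this L1] show ?thesis .
qed

section \<open>Fourier inversion and convolution\<close>

lemma integrable_bound_le:
  fixes f :: "'a \<Rightarrow> 'b::{banach,second_countable_topology}"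
  assumes "integrable M g" "f \<in> borel_measurable M" "\<And>x. norm (f x) \<le> g x"
  shows "integrable M f"
  by (rule Bochner_Integration.integrable_bound[OF assms(1,2)])
     (simp add: assms(3) order_trans[OF assms(3) abs_ge_self])

lemma ft_measurable [measurable]:
  assumes [measurable]: "f \<in> borel_measurable borel"
  shows "ft f \<in> borel_measurable borel"
  unfolding ft_def by measurable

lemma norm_ft_le:
  assumes "integrable lborel f"
  shows "norm (ft f t) \<le> (LINT x|lborel. norm (f x))"
  unfolding ft_def by (rule norm_integral_le) (use assms in \<open>auto simp: norm_mult\<close>)

lemma std_normal_ft: "(LINT s|lborel. iexp (s * x) * of_real (std_normal_density s)) = of_real (exp (- (x^2) / 2))"
proof -
  have "char std_normal_distribution x = (LINT s|lborel. std_normal_density s *\<^sub>R iexp (x * s))"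
    unfolding char_def by (subst integral_density) (auto simp: normal_density_nonneg)
  then have "(LINT s|lborel. std_normal_density s *\<^sub>R iexp (x * s)) = of_real (exp (- (x^2) / 2))"
    by (simp add: char_std_normal_distribution)
  then show ?thesis by (simp add: scaleR_conv_of_real mult.commute)
qed

text \<open>Gaussian regularisation: pairing the transform with a dilated normal density moves the
  dilation onto \<open>f\<close> by Fubini, where it concentrates at 0 as the parameter
  \<open>h\<close> shrinks. Inversion at the single point 0 is what the local limit theorem for
  \<open>conv_pow\<close> at 0 requires.\<close>

lemma fourier_inversion_zero:
  fixes f :: "real \<Rightarrow> complex"
  assumes f: "integrable lborel f" and cont: "isCont f 0" and B: "\<And>x. norm (f x) \<le> B"
    and g: "integrable lborel (ft f)"
  shows "(LINT t|lborel. ft f t) = 2 * pi * f 0"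
proof -
  define h :: "nat \<Rightarrow> real" where "h n = 1 / real (Suc n)" for n
  have h: "h n > 0" for n by (simp add: h_def)
  have hl: "h \<longlonglongrightarrow> 0" unfolding h_def by (rule LIMSEQ_Suc[OF lim_1_over_n])
  let ?n = "std_normal_density"
  have [measurable]: "f \<in> borel_measurable borel" using f by auto
  have id: "(LINT t|lborel. ft f t * of_real (?n (h k * t))) = (LINT y|lborel. f (h k * y) * of_real (exp (- (y^2) / 2)))" for k
  proof -
    have "(LINT s|lborel. ft f (s / h k) * of_real (?n s)) = 
          (LINT s|lborel. (LINT x|lborel. iexp (s * x / h k) * f x * of_real (?n s)))"
      by (simp add: ft_def)
    also have "\<dots> = (LINT x|lborel. (LINT s|lborel. iexp (s * x / h k) * f x * of_real (?n s)))"
    proof (rule Fubini_product_bound[OF lborel.sigma_finite_measure_axioms lborel.sigma_finite_measure_axioms])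
      show "integrable lborel (\<lambda>s. ?n s)" by simp
      show "integrable lborel (\<lambda>x. norm (f x))" using f by simp
      show "norm (iexp (s * x / h k) * f x * of_real (?n s)) \<le> ?n s * norm (f x)" for s x
        using normal_density_nonneg[of 0 1 s] by (simp add: norm_mult)
    qed measurable
    also have "\<dots> = (LINT x|lborel. f x * (LINT s|lborel. iexp (s * (x / h k)) * of_real (?n s)))"
      by (subst integral_mult_right_zero[symmetric]) (simp add: mult_ac)
    also have "\<dots> = (LINT x|lborel. f x * of_real (exp (- ((x / h k)^2) / 2)))"
      by (simp only: std_normal_ft)
    finally have 1: "(LINT s|lborel. ft f (s / h k) * of_real (?n s)) = (LINT x|lborel. f x * of_real (exp (- ((x / h k)^2) / 2)))" .
    have "(LINT s|lborel. ft f (s / h k) * of_real (?n s)) = h k *\<^sub>R (LINT t|lborel. ft f t * of_real (?n (h k * t)))"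
      using lborel_integral_real_affine[of "h k" "\<lambda>s. ft f (s / h k) * of_real (?n s)" 0] h[of k] by simp
    moreover have "(LINT x|lborel. f x * of_real (exp (- ((x / h k)^2) / 2))) = h k *\<^sub>R (LINT y|lborel. f (h k * y) * of_real (exp (- (y^2) / 2)))"
      using lborel_integral_real_affine[of "h k" "\<lambda>x. f x * of_real (exp (- ((x / h k)^2) / 2))" 0] h[of k] by simp
    ultimately show ?thesis using 1 h[of k] by simp
  qed
  have nb: "?n x \<le> ?n 0" for x by (simp add: std_normal_density_def divide_right_mono)
  have "isCont ?n 0" unfolding std_normal_density_def by (intro continuous_intros) auto
  have L1: "(\<lambda>k. LINT t|lborel. ft f t * of_real (?n (h k * t))) \<longlonglongrightarrow> (LINT t|lborel. ft f t * of_real (?n 0))"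
  proof (rule integral_dominated_convergence[where w="\<lambda>t. norm (ft f t) * ?n 0"])
    show "integrable lborel (\<lambda>t. norm (ft f t) * ?n 0)" using g by simp
    show "AE t in lborel. (\<lambda>k. ft f t * of_real (?n (h k * t))) \<longlonglongrightarrow> ft f t * of_real (?n 0)"
    proof (rule AE_I2)
      fix t
      have "(\<lambda>k. h k * t) \<longlonglongrightarrow> 0 * t" by (intro tendsto_intros hl)
      then have "(\<lambda>k. ?n (h k * t)) \<longlonglongrightarrow> ?n 0" by (intro isCont_tendsto_compose[OF \<open>isCont ?n 0\<close>]) simp
      then show "(\<lambda>k. ft f t * of_real (?n (h k * t))) \<longlonglongrightarrow> ft f t * of_real (?n 0)" by (intro tendsto_intros)
    qed
    show "AE t in lborel. norm (ft f t * of_real (?n (h k * t))) \<le> norm (ft f t) * ?n 0" for k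
      using nb normal_density_nonneg[of 0 1] by (auto simp: norm_mult intro!: mult_left_mono)
  qed measurable
  have e: "integrable lborel (\<lambda>y::real. exp (- (y^2) / 2))" "(LINT y|lborel. exp (- (y^2) / 2)) = sqrt (2 * pi)"
  proof -
    have *: "(\<lambda>y. exp (- (y^2) / 2)) = (\<lambda>y. sqrt (2 * pi) * ?n y)" by (auto simp: std_normal_density_def)
    show "integrable lborel (\<lambda>y::real. exp (- (y^2) / 2))" unfolding * by (intro integrable_mult_right) simp
    show "(LINT y|lborel. exp (- (y^2) / 2)) = sqrt (2 * pi)" unfolding * by (simp add: integral_normal_density)
  qed
  have L2: "(\<lambda>k. LINT y|lborel. f (h k * y) * of_real (exp (- (y^2) / 2))) \<longlonglongrightarrow> (LINT y|lborel. f 0 * of_real (exp (- (y^2) / 2)))"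
  proof (rule integral_dominated_convergence[where w="\<lambda>y. B * exp (- (y^2) / 2)"])
    show "integrable lborel (\<lambda>y. B * exp (- (y^2) / 2))" using e by simp
    show "AE y in lborel. (\<lambda>k. f (h k * y) * of_real (exp (- (y^2) / 2))) \<longlonglongrightarrow> f 0 * of_real (exp (- (y^2) / 2))"
    proof (rule AE_I2)
      fix y
      have "(\<lambda>k. h k * y) \<longlonglongrightarrow> 0 * y" by (intro tendsto_intros hl)
      then have "(\<lambda>k. f (h k * y)) \<longlonglongrightarrow> f 0" by (intro isCont_tendsto_compose[OF cont]) simp
      then show "(\<lambda>k. f (h k * y) * of_real (exp (- (y^2) / 2))) \<longlonglongrightarrow> f 0 * of_real (exp (- (y^2) / 2))" by (intro tendsto_intros)
    qed
    show "AE y in lborel. norm (f (h k * y) * of_real (exp (- (y^2) / 2))) \<le> B * exp (- (y^2) / 2)" for k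
      using B by (auto simp: norm_mult intro!: mult_right_mono)
  qed measurable
  have "(LINT t|lborel. ft f t * of_real (?n 0)) = (LINT y|lborel. f 0 * of_real (exp (- (y^2) / 2)))"
    using LIMSEQ_unique[OF L1 L2[folded id]] .
  then have "(LINT t|lborel. ft f t) * of_real (?n 0) = f 0 * of_real (sqrt (2 * pi))"
    by (simp only: integral_mult_left_zero integral_mult_right_zero integral_complex_of_real e)
  then have "(LINT t|lborel. ft f t) * of_real (?n 0) * of_real (sqrt (2 * pi)) = f 0 * of_real (sqrt (2 * pi)) * of_real (sqrt (2 * pi))"
    by (simp only:)
  then have "(LINT t|lborel. ft f t) * of_real (?n 0 * sqrt (2 * pi)) = f 0 * of_real (sqrt (2 * pi) * sqrt (2 * pi))"
    by (simp only: of_real_mult mult.assoc)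
  moreover have "?n 0 * sqrt (2 * pi) = 1" by (simp add: std_normal_density_def)
  moreover have "sqrt (2 * pi) * sqrt (2 * pi) = 2 * pi" by simp
  ultimately have "(LINT t|lborel. ft f t) * of_real 1 = f 0 * of_real (2 * pi)" by (simp only:)
  then show ?thesis by simp
qed

section \<open>Nonnegative continuous functions with quadratic decay, a class stable under
  convolution\<close>

definition tame_density :: "(real \<Rightarrow> real) \<Rightarrow> bool" where
  "tame_density f \<longleftrightarrow> continuous_on UNIV f \<and> (\<forall>x. 0 \<le> f x) \<and> (\<exists>C. \<forall>x. f x \<le> C / (1 + x^2))"

lemma tame_densityD:
  assumes "tame_density f"
  shows "continuous_on UNIV f" "0 \<le> f x" "integrable lborel f" "f \<in> borel_measurable borel"
    and "integrable lborel (\<lambda>x. complex_of_real (f x))"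
    and "\<exists>C\<ge>0. (\<forall>x. f x \<le> C / (1 + x^2)) \<and> (\<forall>x. f x \<le> C)"
proof -
  show c: "continuous_on UNIV f" and p: "0 \<le> f x" for x using assms by (auto simp: tame_density_def)
  then show m: "f \<in> borel_measurable borel" by (intro borel_measurable_continuous_onI)
  from assms obtain C where C: "\<And>x. f x \<le> C / (1 + x^2)" by (auto simp: tame_density_def)
  show i: "integrable lborel f" by (rule integrable_quadratic_bound[of _ C]) (use m C p in auto)
  then show "integrable lborel (\<lambda>x. complex_of_real (f x))" by (simp add: complex_of_real_integrable_eq)
  have "C \<ge> 0" using order_trans[OF p C, of 0] by simp
  moreover have "f x \<le> C" for x
  proof -
    have "C / (1 + x^2) \<le> C / 1" using \<open>C \<ge> 0\<close> by (intro divide_left_mono) (auto intro!: add_pos_nonneg)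
    then show ?thesis using C[of x] by simp
  qed
  ultimately show "\<exists>C\<ge>0. (\<forall>x. f x \<le> C / (1 + x^2)) \<and> (\<forall>x. f x \<le> C)" using C by auto
qed


text \<open>Since 1 + (y + z)^2 is at most twice the sum of the two weights, the decay in y + z can
  be pulled out of a convolution, and each remaining summand is integrable by itself.\<close>

lemma quadratic_weight_split: "1 / ((1 + y^2) * (1 + z^2)) \<le> 2 / (1 + (y + z)^2) * (1 / (1 + y^2) + 1 / (1 + z^2))"
  for y z :: real
proof -
  have "1 + (y + z)^2 \<le> 2 * ((1 + y^2) + (1 + z^2))"
    using sum_squares_ge_zero[of "y - z" 1] zero_le_power2[of "y - z"] by (simp add: power2_eq_square algebra_simps)
  then have "1 \<le> 2 / (1 + (y + z)^2) * ((1 + y^2) + (1 + z^2))"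
    by (simp add: field_simps add_pos_nonneg)
  then have "1 * (1 / ((1 + y^2) * (1 + z^2))) \<le> 2 / (1 + (y + z)^2) * ((1 + y^2) + (1 + z^2)) * (1 / ((1 + y^2) * (1 + z^2)))"
    by (rule mult_right_mono) simp
  also have "\<dots> = 2 / (1 + (y + z)^2) * (1 / (1 + y^2) + 1 / (1 + z^2))"
  proof -
    have "1 + y^2 \<noteq> 0" "1 + z^2 \<noteq> 0" by (simp_all add: add_nonneg_eq_0_iff)
    then have "((1 + y^2) + (1 + z^2)) * (1 / ((1 + y^2) * (1 + z^2))) = 1 / (1 + y^2) + 1 / (1 + z^2)"
      by (simp add: field_simps)
    then show ?thesis by (simp only: mult.assoc)
  qed
  finally show ?thesis by simp
qed

text \<open>Stability under convolution provides, for every convolution power, the hypotheses of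
  Poisson summation on the space side; smoothness enters only through the decay of the transform of
  the first factor.\<close>

lemma tame_rconv:
  assumes f: "tame_density f" and g: "tame_density g"
  shows "tame_density (rconv f g)"
    and "ft (\<lambda>x. of_real (rconv f g x)) t = ft (\<lambda>x. of_real (f x)) t * ft (\<lambda>x. of_real (g x)) t"
proof -
  note F = tame_densityD[OF f] and G = tame_densityD[OF g]
  obtain A where A: "A \<ge> 0" "\<And>x. f x \<le> A / (1 + x^2)" "\<And>x. f x \<le> A" using F(6) by blast
  obtain B where B: "B \<ge> 0" "\<And>x. g x \<le> B / (1 + x^2)" "\<And>x. g x \<le> B" using G(6) by blast
  have [measurable]: "f \<in> borel_measurable borel" "g \<in> borel_measurable borel" using F G by auto
  have "continuous_on UNIV (rconv f g)"
    unfolding continuous_on_sequentially o_def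
  proof (intro allI ballI impI)
    fix X :: "nat \<Rightarrow> real" and a assume X: "(\<forall>n. X n \<in> UNIV) \<and> X \<longlonglongrightarrow> a"
    show "(\<lambda>n. rconv f g (X n)) \<longlonglongrightarrow> rconv f g a"
      unfolding rconv_def
    proof (rule integral_dominated_convergence[where w="\<lambda>y. f y * B"])
      show "integrable lborel (\<lambda>y. f y * B)" using F by simp
      show "AE y in lborel. (\<lambda>n. f y * g (X n - y)) \<longlonglongrightarrow> f y * g (a - y)"
      proof (rule AE_I2)
        fix y
        have "isCont g (a - y)" using G(1) by (simp add: continuous_on_eq_continuous_at)
        moreover have "(\<lambda>n. X n - y) \<longlonglongrightarrow> a - y" using X by (intro tendsto_intros) auto
        ultimately have "(\<lambda>n. g (X n - y)) \<longlonglongrightarrow> g (a - y)" by (rule isCont_tendsto_compose)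
        then show "(\<lambda>n. f y * g (X n - y)) \<longlonglongrightarrow> f y * g (a - y)" by (intro tendsto_intros)
      qed
      show "AE y in lborel. norm (f y * g (X n - y)) \<le> f y * B" for n
        using F(2) G(2) B(3) by (auto simp: abs_mult intro!: mult_left_mono)
    qed measurable
  qed
  moreover have "0 \<le> rconv f g x" for x
    unfolding rconv_def using F(2) G(2) by (intro Bochner_Integration.integral_nonneg) auto
  moreover have "rconv f g x \<le> 2 * A * B * (2 * pi) / (1 + x^2)" for x
  proof -
    let ?w = "\<lambda>y::real. 1 / (1 + y^2)"
    have w: "integrable lborel ?w" by (rule integrable_inverse_1_plus_square)
    have wpi: "(LINT y|lborel. ?w y) = pi"
      using LBINT_inverse_1_plus_square by (simp add: interval_lebesgue_integral_def set_lebesgue_integral_def einterval_def inverse_eq_divide)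
    have w': "integrable lborel (\<lambda>y. ?w (x - y))"
      using lborel_integrable_real_affine[OF w, of "-1" x] by simp
    have wpi': "(LINT y|lborel. ?w (x - y)) = pi"
      using lborel_integral_real_affine[of "-1" ?w x] wpi by simp
    have "norm (rconv f g x) \<le> (LINT y|lborel. A * B * (2 / (1 + x^2)) * (?w y + ?w (x - y)))"
      unfolding rconv_def
    proof (rule norm_integral_le)
      show "integrable lborel (\<lambda>y. A * B * (2 / (1 + x^2)) * (?w y + ?w (x - y)))"
        by (intro integrable_mult_right Bochner_Integration.integrable_add w w')
      fix y
      have "f y * g (x - y) \<le> (A / (1 + y^2)) * (B / (1 + (x - y)^2))"
        using A B F(2) G(2) by (intro mult_mono) auto
      also have "\<dots> = A * B * (1 / ((1 + y^2) * (1 + (x - y)^2)))" by simp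
      also have "\<dots> \<le> A * B * (2 / (1 + (y + (x - y))^2) * (?w y + ?w (x - y)))"
        using A B by (intro mult_left_mono quadratic_weight_split) auto
      finally show "norm (f y * g (x - y)) \<le> A * B * (2 / (1 + x^2)) * (?w y + ?w (x - y))"
        using F(2) G(2) by (simp add: mult.assoc)
    qed
    also have "\<dots> = A * B * (2 / (1 + x^2)) * (2 * pi)"
      by (simp only: integral_mult_right_zero Bochner_Integration.integral_add[OF w w'] wpi wpi' mult_2)
    finally show ?thesis by (simp add: mult_ac)
  qed
  ultimately show "tame_density (rconv f g)" unfolding tame_density_def by blast

  have int: "integrable (lborel \<Otimes>\<^sub>M lborel) (\<lambda>(y, x). iexp (t * x) * complex_of_real (f y * g (x - y)))"
  proof (rule lborel_pair.Fubini_integrable)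
    show "(\<lambda>(y, x). iexp (t * x) * complex_of_real (f y * g (x - y))) \<in> borel_measurable (lborel \<Otimes>\<^sub>M lborel)"
      by measurable
    have "(LINT x|lborel. norm (iexp (t * x) * complex_of_real (f y * g (x - y)))) = f y * (LINT x|lborel. g x)" for y
    proof -
      have "(LINT x|lborel. norm (iexp (t * x) * complex_of_real (f y * g (x - y)))) = (LINT x|lborel. f y * g (x - y))"
        using F(2) G(2) by (simp add: norm_mult abs_mult)
      also have "\<dots> = f y * (LINT x|lborel. g x)"
        using lborel_integral_real_affine[of 1 "\<lambda>x. g (x - y)" y] by simp
      finally show ?thesis .
    qed
    then show "integrable lborel (\<lambda>y. LINT x|lborel. norm (case (y, x) of (y, x) \<Rightarrow> iexp (t * x) * complex_of_real (f y * g (x - y))))"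
      using F by simp
    show "AE y in lborel. integrable lborel (\<lambda>x. case (y, x) of (y, x) \<Rightarrow> iexp (t * x) * complex_of_real (f y * g (x - y)))"
    proof (rule AE_I2)
      fix y
      have i: "integrable lborel (\<lambda>x. f y * g (x - y))"
        using lborel_integrable_real_affine[OF G(3), of 1 "-y"] by (simp add: add.commute)
      have "integrable lborel (\<lambda>x. iexp (t * x) * complex_of_real (f y * g (x - y)))"
        by (rule Bochner_Integration.integrable_bound[OF i]) (auto simp: norm_mult)
      then show "integrable lborel (\<lambda>x. case (y, x) of (y, x) \<Rightarrow> iexp (t * x) * complex_of_real (f y * g (x - y)))" by simp
    qed
  qed
  have "ft (\<lambda>x. of_real (rconv f g x)) t = (LINT x|lborel. (LINT y|lborel. iexp (t * x) * complex_of_real (f y * g (x - y))))"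
    unfolding ft_def rconv_def by (simp only: integral_mult_right_zero integral_complex_of_real)
  also have "\<dots> = (LINT y|lborel. (LINT x|lborel. iexp (t * x) * complex_of_real (f y * g (x - y))))"
    by (rule lborel_pair.Fubini_integral[OF int])
  also have "\<dots> = (LINT y|lborel. iexp (t * y) * of_real (f y) * ft (\<lambda>x. of_real (g x)) t)"
  proof (rule Bochner_Integration.integral_cong[OF refl])
    fix y
    have "(LINT x|lborel. iexp (t * x) * complex_of_real (f y * g (x - y))) =
          (LINT x|lborel. iexp (t * (y + x)) * complex_of_real (f y * g x))"
      using lborel_integral_real_affine[of 1 "\<lambda>x. iexp (t * x) * complex_of_real (f y * g (x - y))" y] by simp
    also have "\<dots> = (LINT x|lborel. iexp (t * y) * of_real (f y) * (iexp (t * x) * of_real (g x)))"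
      by (simp add: distrib_left exp_add mult_ac)
    finally show "(LINT x|lborel. iexp (t * x) * complex_of_real (f y * g (x - y))) = iexp (t * y) * of_real (f y) * ft (\<lambda>x. of_real (g x)) t"
      unfolding ft_def by (simp only: integral_mult_right_zero)
  qed
  also have "\<dots> = ft (\<lambda>x. of_real (f x)) t * ft (\<lambda>x. of_real (g x)) t"
    by (simp only: integral_mult_left_zero ft_def)
  finally show "ft (\<lambda>x. of_real (rconv f g x)) t = ft (\<lambda>x. of_real (f x)) t * ft (\<lambda>x. of_real (g x)) t" .
qed

lemma tame_conv_pow:
  assumes "tame_density f"
  shows "tame_density (conv_pow f (Suc n))"
    and "ft (\<lambda>x. of_real (conv_pow f (Suc n) x)) t = ft (\<lambda>x. of_real (f x)) t ^ Suc n"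
proof -
  have "tame_density (conv_pow f (Suc n)) \<and> ft (\<lambda>x. of_real (conv_pow f (Suc n) x)) t = ft (\<lambda>x. of_real (f x)) t ^ Suc n"
  proof (induction n)
    case 0
    then show ?case using assms by simp
  next
    case (Suc n)
    then show ?case
      using tame_rconv(1)[of "conv_pow f (Suc n)" f] tame_rconv(2)[of "conv_pow f (Suc n)" f t] assms
      by (simp add: mult.commute)
  qed
  then show "tame_density (conv_pow f (Suc n))"
    and "ft (\<lambda>x. of_real (conv_pow f (Suc n) x)) t = ft (\<lambda>x. of_real (f x)) t ^ Suc n" by auto
qed

text \<open>Integration by parts: the derivative of e^(itx) f(x) is integrable and the function
  vanishes at both ends, so its total integral is 0.\<close>

lemma ft_deriv:
  fixes f f' :: "real \<Rightarrow> real"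
  assumes d: "\<And>x. (f has_real_derivative f' x) (at x)" and c: "continuous_on UNIV f'"
    and b: "\<And>x. \<bar>f x\<bar> \<le> C / (1 + x^2)" "\<And>x. \<bar>f' x\<bar> \<le> C' / (1 + x^2)"
  shows "ft (\<lambda>x. of_real (f' x)) t = - \<i> * t * ft (\<lambda>x. of_real (f x)) t"
proof -
  have cf: "continuous_on UNIV f" using d by (meson DERIV_isCont continuous_at_imp_continuous_on)
  have [measurable]: "f \<in> borel_measurable borel" "f' \<in> borel_measurable borel"
    using c cf by (auto intro: borel_measurable_continuous_onI)
  let ?G = "\<lambda>x. iexp (t * x) * complex_of_real (f x)"
  let ?g = "\<lambda>x. \<i> * t * ?G x + iexp (t * x) * complex_of_real (f' x)"
  have i1: "integrable lborel ?G" by (rule integrable_quadratic_bound[of _ C]) (use b in \<open>auto simp: norm_mult\<close>)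
  have i2: "integrable lborel (\<lambda>x. iexp (t * x) * complex_of_real (f' x))"
    by (rule integrable_quadratic_bound[of _ C']) (use b in \<open>auto simp: norm_mult\<close>)
  have i3: "integrable lborel ?g" using i1 i2 by simp
  have lim: "(?G \<longlongrightarrow> 0) at_top" "(?G \<longlongrightarrow> 0) at_bot"
  proof -
    have *: "norm (?G x) \<le> C / (1 + x^2)" for x using b(1)[of x] by (simp add: norm_mult)
    have l1: "((\<lambda>x. C / (1 + x^2)) \<longlongrightarrow> 0) at_top" and l2: "((\<lambda>x. C / (1 + x^2)) \<longlongrightarrow> 0) at_bot" by real_asymp+
    show "(?G \<longlongrightarrow> 0) at_top" by (rule Lim_null_comparison[OF _ l1]) (intro always_eventually allI *)
    show "(?G \<longlongrightarrow> 0) at_bot" by (rule Lim_null_comparison[OF _ l2]) (intro always_eventually allI *)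
  qed
  have cg: "continuous_on UNIV ?g"
    by (intro continuous_intros cf c)
  have "(LBINT x=-\<infinity>..\<infinity>. ?g x) = 0 - 0"
  proof (rule interval_integral_FTC_integrable[where F="?G"])
    fix x :: real
    have fd: "((\<lambda>x. complex_of_real (f x)) has_vector_derivative complex_of_real (f' x)) (at x)"
      using d[of x] by (intro has_vector_derivative_of_real) (simp add: has_real_derivative_iff_has_vector_derivative)
    have "((\<lambda>z. exp (\<i> * (t * z))) has_field_derivative \<i> * t * iexp (t * x)) (at (of_real x))"
      by (auto intro!: derivative_eq_intros)
    from has_vector_derivative_real_field[OF this]
    have ed: "((\<lambda>x. iexp (t * x)) has_vector_derivative \<i> * t * iexp (t * x)) (at x)" by simp
    show "(?G has_vector_derivative ?g x) (at x)"
      using has_vector_derivative_mult[OF ed fd] by (simp add: mult_ac add.commute)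
    show "isCont ?g x" using cg by (simp add: continuous_on_eq_continuous_at)
  next
    show "set_integrable lborel (einterval (-\<infinity>) \<infinity>) ?g" using i3 by (simp add: set_integrable_def einterval_def)
  qed (use lim in \<open>auto simp: ereal_tendsto_simps\<close>)
  then have "(LINT x|lborel. ?g x) = 0"
    by (simp add: interval_lebesgue_integral_def set_lebesgue_integral_def einterval_def)
  then have "\<i> * t * (LINT x|lborel. ?G x) + (LINT x|lborel. iexp (t * x) * complex_of_real (f' x)) = 0"
    using i1 i2 by simp
  then show ?thesis unfolding ft_def by (simp add: eq_neg_iff_add_eq_0 add.commute)
qed

section \<open>The characteristic function of a centred Schwartz density\<close>

lemma quadratic_weight_scale:
  fixes c s :: real
  assumes c: "c > 0"
  shows "1 / (1 + c * s^2) \<le> max 1 (1/c) * (1 / (1 + s^2))"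
proof -
  have "1 + s^2 \<le> max 1 (1/c) * 1 + max 1 (1/c) * (c * s^2)"
  proof (rule add_mono)
    have "s^2 = (1/c) * (c * s^2)" using c by simp
    also have "\<dots> \<le> max 1 (1/c) * (c * s^2)" using c by (intro mult_right_mono) auto
    finally show "s^2 \<le> max 1 (1/c) * (c * s^2)" .
  qed simp
  then have "1 + s^2 \<le> max 1 (1/c) * (1 + c * s^2)" by (simp only: distrib_left)
  moreover have "1 + c * s^2 > 0" "1 + s^2 > 0" using c by (auto intro!: add_pos_nonneg)
  ultimately show ?thesis by (simp add: field_simps)
qed

locale centered_schwartz_density =
  fixes \<phi> :: "real \<Rightarrow> real"
  assumes schwartz: "schwartz \<phi>" and density: "is_density \<phi>" and mean: "mean_of \<phi> = 0"
begin

abbreviation cf :: "real \<Rightarrow> complex" where "cf \<equiv> ft (\<lambda>x. of_real (\<phi> x))"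

abbreviation v :: real where "v \<equiv> var_of \<phi>"

lemma decay: "\<exists>C. \<forall>x. \<bar>x\<bar> ^ m * \<bar>(deriv ^^ n) \<phi> x\<bar> \<le> C / (1 + x^2)"
proof -
  from schwartz obtain A B where A: "\<And>x. \<bar>x\<bar> ^ m * \<bar>(deriv ^^ n) \<phi> x\<bar> \<le> A"
    and B: "\<And>x. \<bar>x\<bar> ^ (m + 2) * \<bar>(deriv ^^ n) \<phi> x\<bar> \<le> B"
    unfolding schwartz_def by meson
  have "\<bar>x\<bar> ^ m * \<bar>(deriv ^^ n) \<phi> x\<bar> \<le> (A + B) / (1 + x^2)" for x
  proof -
    have "\<bar>x\<bar> ^ m * \<bar>(deriv ^^ n) \<phi> x\<bar> * (1 + x^2) = \<bar>x\<bar> ^ m * \<bar>(deriv ^^ n) \<phi> x\<bar> + \<bar>x\<bar> ^ (m + 2) * \<bar>(deriv ^^ n) \<phi> x\<bar>"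
      by (simp add: power_add power2_eq_square algebra_simps)
    also have "\<dots> \<le> A + B" using A[of x] B[of x] by (rule add_mono)
    finally show ?thesis by (simp add: pos_le_divide_eq add_pos_nonneg)
  qed
  then show ?thesis by blast
qed

lemma has_deriv: "((deriv ^^ n) \<phi> has_real_derivative (deriv ^^ Suc n) \<phi> x) (at x)"
  using schwartz unfolding schwartz_def by (simp add: DERIV_deriv_iff_real_differentiable)

lemma cont_deriv: "continuous_on UNIV ((deriv ^^ n) \<phi>)"
  using has_deriv by (meson DERIV_isCont continuous_at_imp_continuous_on)

lemma nonneg: "0 \<le> \<phi> x" and int_\<phi>: "integrable lborel \<phi>" and mass: "(LINT x|lborel. \<phi> x) = 1"
  using density by (auto simp: is_density_def)

lemma tame: "tame_density \<phi>"
proof -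
  obtain C where C: "\<And>x. \<bar>x\<bar> ^ 0 * \<bar>(deriv ^^ 0) \<phi> x\<bar> \<le> C / (1 + x^2)" using decay by meson
  have "\<phi> x \<le> C / (1 + x^2)" for x
    by (rule order_trans[OF abs_ge_self]) (use C[of x] in simp)
  then show ?thesis using cont_deriv[of 0] nonneg unfolding tame_density_def by auto
qed

lemma meas_\<phi> [measurable]: "\<phi> \<in> borel_measurable borel"
  using tame_densityD(4)[OF tame] by simp

lemma moment_integrable: "integrable lborel (\<lambda>x. \<bar>x\<bar> ^ m * \<phi> x)" "integrable lborel (\<lambda>x. x ^ m * \<phi> x)"
proof -
  obtain C where C: "\<And>x. \<bar>x\<bar> ^ m * \<bar>(deriv ^^ 0) \<phi> x\<bar> \<le> C / (1 + x^2)" using decay by meson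
  show "integrable lborel (\<lambda>x. \<bar>x\<bar> ^ m * \<phi> x)" 
    by (rule integrable_quadratic_bound[of _ C]) (use C in \<open>auto simp: abs_mult power_abs\<close>)
  show "integrable lborel (\<lambda>x. x ^ m * \<phi> x)"
    by (rule integrable_quadratic_bound[of _ C]) (use C in \<open>auto simp: abs_mult power_abs\<close>)
qed

lemma first_moment: "(LINT x|lborel. x * \<phi> x) = 0"
  using mean by (simp add: mean_of_def)

lemma v_eq: "v = (LINT x|lborel. x^2 * \<phi> x)"
  unfolding var_of_def mean by simp

lemma not_null: "\<not> (AE x in lborel. \<phi> x = 0)"
proof
  assume "AE x in lborel. \<phi> x = 0"
  then have "(LINT x|lborel. \<phi> x) = (LINT x::real|lborel. 0)" by (intro integral_cong_AE) auto
  then show False using mass by simp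
qed

lemma v_pos: "v > 0"
proof (rule ccontr)
  assume "\<not> v > 0"
  moreover have "v \<ge> 0" unfolding v_eq using nonneg by (intro Bochner_Integration.integral_nonneg) auto
  ultimately have "(LINT x|lborel. x^2 * \<phi> x) = 0" by (simp add: v_eq)
  then have "AE x in lborel. x^2 * \<phi> x = 0"
    using moment_integrable(2)[of 2] nonneg by (subst (asm) integral_nonneg_eq_0_iff_AE) auto
  then have "AE x in lborel. \<phi> x = 0"
    using AE_lborel_singleton[of 0] by eventually_elim auto
  then show False using not_null by simp
qed

definition M :: "real measure" where "M = density lborel \<phi>"

lemma M_distribution: "real_distribution M"
proof -
  have "prob_space M"
  proof
    have "emeasure M (space M) = (\<integral>\<^sup>+x. ennreal (\<phi> x) \<partial>lborel)" by (simp add: M_def emeasure_density)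
    also have "\<dots> = 1" using nn_integral_eq_integral[OF int_\<phi>] nonneg mass by simp
    finally show "emeasure M (space M) = 1" .
  qed
  then show ?thesis by (simp add: real_distribution_def real_distribution_axioms_def M_def)
qed

lemma integral_M:
  fixes f :: "real \<Rightarrow> 'a::{banach,second_countable_topology}"
  assumes [measurable]: "f \<in> borel_measurable borel"
  shows "(LINT x|M. f x) = (LINT x|lborel. \<phi> x *\<^sub>R f x)" "integrable M f \<longleftrightarrow> integrable lborel (\<lambda>x. \<phi> x *\<^sub>R f x)"
  unfolding M_def using nonneg by (auto simp: integral_density integrable_density)

lemma cf_eq_char: "cf t = char M t"
  unfolding char_def ft_def by (subst integral_M(1)) (auto simp: scaleR_conv_of_real mult.commute)

lemma cf_cont: "continuous_on UNIV cf"
  using real_distribution.isCont_char[OF M_distribution] unfolding cf_eq_char[abs_def]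
  by (intro continuous_at_imp_continuous_on) auto

lemma cf_le_1: "norm (cf t) \<le> 1"
  using real_distribution.cmod_char_le_1[OF M_distribution] by (simp add: cf_eq_char)

lemma cf_0: "cf 0 = 1"
  using mass by (simp add: ft_def)

text \<open>Two integrations by parts bound t^2 \<open>cf t\<close>; adding |\<open>cf t\<close>| <=
  1 gives a bound without singularity at 0.\<close>

lemma cf_decay: "\<exists>K\<ge>1. \<forall>t. norm (cf t) \<le> K / (1 + t^2)"
proof -
  obtain C where C: "\<And>n x. n \<in> {0,1,2} \<Longrightarrow> \<bar>(deriv ^^ n) \<phi> x\<bar> \<le> C / (1 + x^2)"
  proof -
    have "\<forall>n. \<exists>C. \<forall>x. \<bar>(deriv ^^ n) \<phi> x\<bar> \<le> C / (1 + x^2)" using decay[of 0] by simp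
    then obtain C where C: "\<And>n x. \<bar>(deriv ^^ n) \<phi> x\<bar> \<le> C n / (1 + x^2)" by metis
    have "\<bar>(deriv ^^ n) \<phi> x\<bar> \<le> (max (C 0) (max (C 1) (C 2))) / (1 + x^2)" if "n \<in> {0,1,2}" for n x
    proof -
      have "C n \<le> max (C 0) (max (C 1) (C 2))" using that by auto
      then show ?thesis by (intro order_trans[OF C] divide_right_mono) auto
    qed
    then show ?thesis using that by blast
  qed
  define I where "I = (LINT x|lborel. norm (complex_of_real ((deriv ^^ 2) \<phi> x)))"
  have 1: "ft (\<lambda>x. of_real ((deriv ^^ Suc n) \<phi> x)) t = - \<i> * t * ft (\<lambda>x. of_real ((deriv ^^ n) \<phi> x)) t" if "n \<in> {0,1}" for n t
    by (rule ft_deriv[OF has_deriv cont_deriv C C]) (use that in auto)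
  have 2: "ft (\<lambda>x. of_real ((deriv ^^ 2) \<phi> x)) t = - (t^2) * cf t" for t
  proof -
    have "ft (\<lambda>x. of_real ((deriv ^^ 2) \<phi> x)) t = (\<i> * t)^2 * cf t"
      using 1[of 0 t] 1[of 1 t] by (simp add: numeral_2_eq_2)
    then show ?thesis by (simp add: power_mult_distrib)
  qed
  have i2: "integrable lborel (\<lambda>x. complex_of_real ((deriv ^^ 2) \<phi> x))"
    by (rule integrable_quadratic_bound[of _ C]) (use cont_deriv[of 2] C[of 2] in \<open>auto intro!: borel_measurable_of_real borel_measurable_continuous_onI simp del: funpow.simps\<close>)
  have "norm (cf t) \<le> (1 + I) / (1 + t^2)" for t
  proof -
    have "norm (ft (\<lambda>x. of_real ((deriv ^^ 2) \<phi> x)) t) \<le> I" unfolding I_def by (rule norm_ft_le[OF i2])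
    then have "t^2 * norm (cf t) \<le> I" unfolding 2 by (simp add: norm_mult norm_power)
    then have "norm (cf t) * (1 + t^2) \<le> 1 + I" using cf_le_1[of t] by (simp add: algebra_simps)
    then show ?thesis by (simp add: pos_le_divide_eq add_pos_nonneg)
  qed
  moreover have "I \<ge> 0" unfolding I_def by simp
  ultimately show ?thesis by (intro exI[of _ "1 + I"]) auto
qed

text \<open>Centering removes the linear term, and the finite third absolute moment controls the
  remainder.\<close>

lemma cf_near_0: "\<exists>K\<ge>0. \<forall>t. norm (cf t - (1 - t^2 * v / 2)) \<le> K * \<bar>t\<bar>^3"
proof -
  interpret M: real_distribution M by (rule M_distribution)
  define A where "A = (LINT x|lborel. \<bar>x\<bar>^3 * \<phi> x)"
  have A0: "A \<ge> 0" unfolding A_def using nonneg by (intro Bochner_Integration.integral_nonneg) auto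
  have e1: "(LINT x|M. x) = 0" using first_moment by (subst integral_M) (auto simp: mult.commute)
  have e2: "(LINT x|M. x^2) = v" unfolding v_eq by (subst integral_M) (auto simp: mult.commute)
  have e3: "integrable M (\<lambda>x. \<bar>x\<bar>^3)" "(LINT x|M. \<bar>x\<bar>^3) = A"
    using moment_integrable(1)[of 3] by (simp_all add: integral_M A_def mult.commute)
  have "norm (cf t - (1 - t^2 * v / 2)) \<le> A / 6 * \<bar>t\<bar>^3" for t
  proof -
    have "norm (char M t - (1 - t^2 * v / 2)) \<le> (t^2 / 6) * (LINT x|M. min (6 * x^2) (\<bar>t\<bar> * \<bar>x\<bar>^3))"
    proof (rule M.char_approx3)
      show "integrable M (\<lambda>x. x)" using moment_integrable(2)[of 1] by (subst integral_M) (auto simp: mult.commute)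
      show "integrable M (\<lambda>x. x^2)" using moment_integrable(2)[of 2] by (subst integral_M) (auto simp: mult.commute)
    qed (use e1 e2 in auto)
    also have "\<dots> \<le> (t^2 / 6) * (LINT x|M. \<bar>t\<bar> * \<bar>x\<bar>^3)"
    proof (rule mult_left_mono)
      have "norm (LINT x|M. min (6 * x^2) (\<bar>t\<bar> * \<bar>x\<bar>^3)) \<le> (LINT x|M. \<bar>t\<bar> * \<bar>x\<bar>^3)"
        by (rule norm_integral_le) (use e3 in auto)
      then show "(LINT x|M. min (6 * x^2) (\<bar>t\<bar> * \<bar>x\<bar>^3)) \<le> (LINT x|M. \<bar>t\<bar> * \<bar>x\<bar>^3)" by simp
    qed simp
    also have "\<dots> = A / 6 * (t^2 * \<bar>t\<bar>)" by (simp add: e3)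
    also have "t^2 * \<bar>t\<bar> = \<bar>t\<bar>^3" by (simp add: power3_eq_cube power2_eq_square)
    finally show ?thesis by (simp add: cf_eq_char)
  qed
  then show ?thesis using A0 by (intro exI[of _ "A / 6"]) auto
qed

text \<open>The equality case of the triangle inequality: modulus one would force t x - a into 2 pi
  times the integers for almost every x charged by the density, but that set of x is countable and
  hence null.\<close>

lemma cf_less_1:
  assumes t: "t \<noteq> 0"
  shows "norm (cf t) < 1"
proof (rule ccontr)
  assume "\<not> norm (cf t) < 1"
  then have n1: "norm (cf t) = 1" using cf_le_1[of t] by simp
  define a where "a = Arg (cf t)"
  have "cf t \<noteq> 0" using n1 by auto
  then have cfa: "cf t = cis a" using n1 cis_Arg[of "cf t"] by (simp add: a_def sgn_eq)
  have m: "(LINT x|lborel. iexp (t * x) * of_real (\<phi> x)) = cis a" using cfa by (simp add: ft_def)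
  have i: "integrable lborel (\<lambda>x. cis (-a) * (iexp (t * x) * complex_of_real (\<phi> x)))"
    by (rule Bochner_Integration.integrable_bound[OF int_\<phi>]) (auto simp: norm_mult)
  have "(LINT x|lborel. cis (-a) * (iexp (t * x) * of_real (\<phi> x))) = 1"
    using m by (simp add: cis_mult)
  then have "Re (LINT x|lborel. cis (-a) * (iexp (t * x) * of_real (\<phi> x))) = 1" by simp
  then have "(LINT x|lborel. Re (cis (-a) * (iexp (t * x) * of_real (\<phi> x)))) = 1"
    using integral_Re[OF i] by simp
  moreover have re: "Re (cis (-a) * (iexp (t * x) * of_real (\<phi> x))) = cos (t * x - a) * \<phi> x" for x
    by (simp add: cis_conv_exp exp_add[symmetric] mult.assoc[symmetric] Re_exp)
  ultimately have "(LINT x|lborel. cos (t * x - a) * \<phi> x) = 1" by simp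
  moreover have ic: "integrable lborel (\<lambda>x. cos (t * x - a) * \<phi> x)"
    by (rule Bochner_Integration.integrable_bound[OF int_\<phi>]) (auto simp: abs_mult intro!: mult_left_le_one_le)
  ultimately have "(LINT x|lborel. (1 - cos (t * x - a)) * \<phi> x) = 0"
    using int_\<phi> mass by (simp add: left_diff_distrib)
  moreover have "integrable lborel (\<lambda>x. (1 - cos (t * x - a)) * \<phi> x)"
    using int_\<phi> ic by (simp add: left_diff_distrib)
  ultimately have "AE x in lborel. (1 - cos (t * x - a)) * \<phi> x = 0"
    using nonneg by (subst (asm) integral_nonneg_eq_0_iff_AE) auto
  moreover have "AE x in lborel. x \<notin> range (\<lambda>k::int. (a + 2 * pi * k) / t)"
    by (intro AE_not_in countable_imp_null_set_lborel countable_image) auto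
  ultimately have "AE x in lborel. \<phi> x = 0"
  proof eventually_elim
    case (elim x)
    have "cos (t * x - a) \<noteq> 1"
    proof
      assume "cos (t * x - a) = 1"
      then obtain k :: int where "t * x - a = k * 2 * pi" using cos_one_2pi_int by auto
      then have "x = (a + 2 * pi * k) / t" using t by (simp add: field_simps)
      then show False using elim by blast
    qed
    then show ?case using elim by simp
  qed
  then show False using not_null by simp
qed

text \<open>One bound for all t, glued from the expansion at 0, compactness with
  \<open>cf_less_1\<close>, and the decay at infinity. Its shape behaves well under powers, by
  Bernoulli's inequality, and keeps 1 - z \<open>cf t\<close> quantitatively away from 0 for |z| <
  1.\<close>

lemma cf_bound: "\<exists>c>0. \<forall>t. norm (cf t) \<le> 1 / (1 + c * t^2)"
proof -
  obtain K where K: "K \<ge> 1" "\<And>t. norm (cf t) \<le> K / (1 + t^2)" using cf_decay by blast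
  obtain A where A: "A \<ge> 0" "\<And>t. norm (cf t - (1 - t^2 * v / 2)) \<le> A * \<bar>t\<bar>^3" using cf_near_0 by blast
  \<comment> \<open>The first entry lets the cubic error be absorbed by half of the term v t^2 / 2;
    the second gives v t^2 <= 1, so that 1 - v t^2 / 2 equals its absolute value.\<close>
  define \<eta> where "\<eta> = min (v / (4 * (A + 1))) (1 / (v + 1))"
  \<comment> \<open>Beyond \<open>T\<close> one has t^2 >= 2 K, so half of t^2 outweighs the
    constant of the decay bound.\<close>
  define T where "T = sqrt (2 * K)"
  have \<eta>: "\<eta> > 0" using v_pos A by (auto simp: \<eta>_def)
  have near: "norm (cf t) \<le> 1 / (1 + v / 4 * t^2)" if "\<bar>t\<bar> \<le> \<eta>" for t
  proof -
    have "\<bar>t\<bar> \<le> v / (4 * (A + 1))" "\<bar>t\<bar> \<le> 1 / (v + 1)" using that by (auto simp: \<eta>_def)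
    then have t1: "(A + 1) * \<bar>t\<bar> \<le> v / 4" and t2: "(v + 1) * \<bar>t\<bar> \<le> 1" using A v_pos by (auto simp: field_simps)
    have "A * \<bar>t\<bar> \<le> v / 4" using t1 A abs_ge_zero[of t] by (simp add: algebra_simps)
    then have "A * \<bar>t\<bar> * t^2 \<le> v / 4 * t^2" by (intro mult_right_mono) auto
    then have a: "A * \<bar>t\<bar>^3 \<le> v / 4 * t^2" by (simp add: power3_eq_cube power2_eq_square mult_ac)
    have "0 \<le> v * \<bar>t\<bar>" using v_pos by simp
    then have "v * \<bar>t\<bar> \<le> 1" "\<bar>t\<bar> \<le> 1" using t2 abs_ge_zero[of t] unfolding distrib_right by linarith+
    then have "(v * \<bar>t\<bar>) * \<bar>t\<bar> \<le> 1 * 1" by (intro mult_mono) auto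
    then have b: "t^2 * v \<le> 1" by (simp add: power2_eq_square mult_ac)
    have "norm (cf t) \<le> norm (cf t - (1 - t^2 * v / 2)) + norm (1 - complex_of_real t^2 * complex_of_real v / 2)"
      using norm_triangle_ineq[of "cf t - (1 - t^2 * v / 2)" "1 - complex_of_real t^2 * complex_of_real v / 2"] by simp
    also have "1 - complex_of_real t^2 * complex_of_real v / 2 = of_real (1 - t^2 * v / 2)" by simp
    also have "norm (of_real (1 - t^2 * v / 2) :: complex) = 1 - t^2 * v / 2" using b by (simp only: norm_of_real)
    finally have "norm (cf t) \<le> 1 - v / 4 * t^2" using A(2)[of t] a by (simp add: mult.commute)
    moreover have "(1 - v / 4 * t^2) * (1 + v / 4 * t^2) \<le> 1"
      using zero_le_power2[of "v / 4 * t^2"] by (simp add: power2_eq_square algebra_simps)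
    moreover have "0 \<le> 1 + v / 4 * t^2" using v_pos by simp
    ultimately have "norm (cf t) * (1 + v / 4 * t^2) \<le> 1"
      using mult_right_mono order_trans by blast
    then show ?thesis using v_pos by (simp add: pos_le_divide_eq add_pos_nonneg)
  qed
  let ?S = "{t. \<eta> \<le> \<bar>t\<bar> \<and> \<bar>t\<bar> \<le> T}"
  have "\<exists>q<1. 0 < q \<and> (\<forall>t\<in>?S. norm (cf t) \<le> q)"
  proof (cases "?S = {}")
    case True
    then show ?thesis by (intro exI[of _ "1/2"]) auto
  next
    case False
    have "?S = {-T..T} \<inter> {t. \<eta> \<le> \<bar>t\<bar>}" by auto
    moreover have "closed {t::real. \<eta> \<le> \<bar>t\<bar>}" by (intro closed_Collect_le continuous_intros)
    ultimately have "compact ?S" using compact_Int_closed[of "{-T..T}" "{t. \<eta> \<le> \<bar>t\<bar>}"] by simp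
    moreover have "continuous_on ?S (\<lambda>t. norm (cf t))"
      by (intro continuous_on_norm continuous_on_subset[OF cf_cont]) auto
    ultimately obtain t0 where t0: "t0 \<in> ?S" "\<And>t. t \<in> ?S \<Longrightarrow> norm (cf t) \<le> norm (cf t0)"
      using continuous_attains_sup[of ?S "\<lambda>t. norm (cf t)"] False by blast
    have "norm (cf t0) < 1" using t0(1) \<eta> by (intro cf_less_1) auto
    then show ?thesis using t0(2) by (intro exI[of _ "max (1/2) (norm (cf t0))"]) fastforce
  qed
  then obtain q where q: "q < 1" "0 < q" "\<And>t. \<eta> \<le> \<bar>t\<bar> \<Longrightarrow> \<bar>t\<bar> \<le> T \<Longrightarrow> norm (cf t) \<le> q" by auto
  \<comment> \<open>One entry per region: v / 4 near 0; (1 - q) / (2 K) gives c t^2 <= 1 - q in the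
    middle, hence q <= 1 / (1 + c t^2); and 1 / (2 K) handles |t| >= T.\<close>
  define c where "c = min (v / 4) (min ((1 - q) / (2 * K)) (1 / (2 * K)))"
  have c: "c > 0" "c \<le> v / 4" "c \<le> (1 - q) / (2 * K)" "c \<le> 1 / (2 * K)" using v_pos q K by (auto simp: c_def)
  have pos: "1 + c * t^2 > 0" for t using c by (simp add: add_pos_nonneg)
  have "norm (cf t) \<le> 1 / (1 + c * t^2)" for t
  proof -
    consider "\<bar>t\<bar> \<le> \<eta>" | "\<eta> \<le> \<bar>t\<bar>" "\<bar>t\<bar> \<le> T" | "T \<le> \<bar>t\<bar>" by linarith
    then show ?thesis
    proof cases
      case 1
      have "c * t^2 \<le> v / 4 * t^2" using c by (intro mult_right_mono) auto
      then have "1 / (1 + v / 4 * t^2) \<le> 1 / (1 + c * t^2)" using pos[of t] by (intro divide_left_mono) (auto intro!: mult_pos_pos)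
      then show ?thesis using near[OF 1] by linarith
    next
      case 2
      have "t^2 \<le> T^2" using power_mono[OF 2(2), of 2] by simp
      also have "T^2 = 2 * K" using K by (simp add: T_def)
      finally have "c * t^2 \<le> (1 - q) / (2 * K) * (2 * K)" using c K by (intro mult_mono) auto
      then have ct: "c * t^2 \<le> 1 - q" using K by simp
      have "q * (1 + c * t^2) \<le> q * (1 + (1 - q))" using ct q by (intro mult_left_mono) auto
      also have "\<dots> \<le> 1" using zero_le_power2[of "1 - q"] by (simp add: power2_eq_square algebra_simps)
      finally have "q \<le> 1 / (1 + c * t^2)" using pos[of t] by (simp add: pos_le_divide_eq)
      then show ?thesis using q(3)[OF 2] by linarith
    next
      case 3
      have "T \<ge> 0" using K by (simp add: T_def)
      then have "T^2 \<le> t^2" using power_mono[OF 3, of 2] by simp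
      moreover have "T^2 = 2 * K" using K by (simp add: T_def)
      ultimately have "2 * K \<le> t^2" by simp
      moreover have "K * (c * t^2) \<le> K * (1 / (2 * K) * t^2)" using c K by (intro mult_left_mono mult_right_mono) auto
      ultimately have "K * (1 + c * t^2) \<le> 1 + t^2" using K by (simp add: algebra_simps)
      then have "K / (1 + t^2) \<le> 1 / (1 + c * t^2)"
        using pos[of t] by (simp add: divide_le_eq le_divide_eq add_pos_nonneg field_simps)
      then show ?thesis using K(2)[of t] by linarith
    qed
  qed
  then show ?thesis using c by blast
qed


section \<open>Central and local limit theorem at the origin\<close>

lemma cf_power_tendsto:
  "(\<lambda>j. cf (s / sqrt (real j)) ^ j) \<longlonglongrightarrow> of_real (exp (- (v * s^2 / 2)))"
proof -
  obtain A where A: "A \<ge> 0" "\<And>t. norm (cf t - (1 - t^2 * v / 2)) \<le> A * \<bar>t\<bar>^3" using cf_near_0 by blast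
  define a where "a = v * s^2 / 2"
  have a0: "a \<ge> 0" using v_pos by (simp add: a_def)
  have bound: "norm (cf (s / sqrt (real j)) ^ j - of_real (exp (- a))) \<le> real j * (A * (\<bar>s\<bar> / sqrt (real j))^3 + (a / real j)^2)"
    if j: "j > 0" for j
  proof -
    let ?t = "s / sqrt (real j)"
    let ?w = "complex_of_real (exp (- (a / real j)))"
    have tt: "?t^2 * v / 2 = a / real j" using j by (simp add: a_def power_divide mult.commute)
    have wj: "?w ^ j = of_real (exp (- a))" using j by (simp flip: of_real_power exp_of_nat_mult)
    have ge: "1 - a / real j \<le> exp (- (a / real j))" using exp_ge_add_one_self[of "- (a / real j)"] by simp
    \<comment> \<open>Both bases lie in the closed unit disc, so the difference of j-th powers costs
      only a factor j, against a difference of order j^(-3/2).\<close>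
    have "norm (cf ?t ^ j - ?w ^ j) \<le> real j * norm (cf ?t - ?w)"
    proof (rule norm_power_diff)
      show "norm ?w \<le> 1" using a0 by (simp only: norm_of_real) simp
    qed (rule cf_le_1)
    also have "norm (cf ?t - ?w) \<le> norm (cf ?t - of_real (1 - a / real j)) + norm (of_real (1 - a / real j) - ?w)"
      using norm_triangle_ineq[of "cf ?t - of_real (1 - a / real j)" "of_real (1 - a / real j) - ?w"] by simp
    also have "norm (cf ?t - of_real (1 - a / real j)) \<le> A * \<bar>?t\<bar>^3"
      using A(2)[of ?t] unfolding tt[symmetric] by simp
    also have "norm (of_real (1 - a / real j) - ?w) = exp (- (a / real j)) - (1 - a / real j)"
      unfolding of_real_diff[symmetric] norm_of_real using ge by simp
    also have "exp (- (a / real j)) - (1 - a / real j) \<le> (a / real j)^2"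
    proof -
      define x where "x = a / real j"
      have x: "x \<ge> 0" using a0 by (simp add: x_def)
      have "exp (- x) \<le> 1 / (1 + x)"
        unfolding exp_minus inverse_eq_divide using x exp_ge_add_one_self[of x] by (intro divide_left_mono) auto
      also have "1 / (1 + x) \<le> 1 - x + x^2"
      proof -
        have "(1 - x + x^2) * (1 + x) = 1 + x^3" by algebra
        then have "1 \<le> (1 - x + x^2) * (1 + x)" using x by simp
        then show ?thesis using x by (simp add: divide_le_eq)
      qed
      finally show ?thesis by (simp add: x_def)
    qed
    finally show ?thesis using j by (simp add: wj abs_divide mult_left_mono)
  qed
  have "(\<lambda>j. real j * (A * (\<bar>s\<bar> / sqrt (real j))^3 + (a / real j)^2)) \<longlonglongrightarrow> 0"
  proof -
    have "(\<lambda>j. real j / (sqrt (real j))^3) \<longlonglongrightarrow> 0" "(\<lambda>j. real j / (real j)^2) \<longlonglongrightarrow> 0" by real_asymp+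
    then have "(\<lambda>j. A * \<bar>s\<bar>^3 * (real j / (sqrt (real j))^3) + a^2 * (real j / (real j)^2)) \<longlonglongrightarrow> A * \<bar>s\<bar>^3 * 0 + a^2 * 0"
      by (intro tendsto_intros)
    then show ?thesis by (simp add: power_divide algebra_simps)
  qed
  then have "(\<lambda>j. cf (s / sqrt (real j)) ^ j - of_real (exp (- a))) \<longlonglongrightarrow> 0"
    by (rule Lim_null_comparison[rotated]) (use bound in \<open>auto intro!: eventually_mono[OF eventually_gt_at_top[of 0]]\<close>)
  then show ?thesis unfolding a_def by (simp add: LIM_zero_iff)
qed

lemma conv_pow_at_0:
  assumes "j > 0"
  shows "of_real (2 * pi * sqrt (real j) * conv_pow \<phi> j 0) = (LINT s|lborel. cf (s / sqrt (real j)) ^ j)"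
proof -
  obtain n where n: "j = Suc n" using assms by (cases j) auto
  let ?f = "\<lambda>x. complex_of_real (conv_pow \<phi> j x)"
  note T = tame_densityD[OF tame_conv_pow(1)[OF tame, of n], folded n]
  have ftf: "ft ?f t = cf t ^ j" for t unfolding n by (rule tame_conv_pow(2)[OF tame])
  obtain K where K: "K \<ge> 1" "\<And>t. norm (cf t) \<le> K / (1 + t^2)" using cf_decay by blast
  obtain C where C: "C \<ge> 0" "\<And>x. conv_pow \<phi> j x \<le> C" using T(6) by auto
  have "(LINT t|lborel. ft ?f t) = 2 * pi * ?f 0"
  proof (rule fourier_inversion_zero)
    show "isCont ?f 0" using T(1) by (simp add: continuous_on_eq_continuous_at)
    show "norm (?f x) \<le> C" for x using C(2)[of x] T(2)[of x] by simp
    show "integrable lborel (ft ?f)"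
    proof (rule integrable_quadratic_bound)
      show "norm (ft ?f t) \<le> K / (1 + t^2)" for t
      proof -
        have "norm (cf t) ^ Suc n \<le> norm (cf t)"
          using cf_le_1[of t] mult_left_le[of "norm (cf t) ^ n" "norm (cf t)"] by (simp add: power_le_one)
        then show ?thesis using K(2)[of t] unfolding ftf unfolding n norm_power by simp
      qed
      have "?f \<in> borel_measurable borel" using T(4) by simp
      then show "ft ?f \<in> borel_measurable lborel" by simp
    qed
  qed (rule T(5))
  moreover have "(LINT s|lborel. cf (s / sqrt (real j)) ^ j) = sqrt (real j) *\<^sub>R (LINT t|lborel. cf t ^ j)"
    using lborel_integral_real_affine[of "sqrt (real j)" "\<lambda>s. cf (s / sqrt (real j)) ^ j" 0] assms by simp
  ultimately show ?thesis by (simp add: ftf scaleR_conv_of_real mult_ac)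
qed

text \<open>The local limit theorem at 0: the rescaled inversion integral converges to a Gaussian
  integral, which is positive. Only this lower bound on the order j^(-1/2) is used for the decay on
  the circle.\<close>

lemma conv_pow_at_0_lower: "\<exists>c>0. \<exists>j0>0. \<forall>j\<ge>j0. conv_pow \<phi> j 0 \<ge> c / sqrt (real j)"
proof -
  obtain c where c: "c > 0" "\<And>t. norm (cf t) \<le> 1 / (1 + c * t^2)" using cf_bound by blast
  have [measurable]: "cf \<in> borel_measurable borel" by measurable
  have L: "(\<lambda>j. LINT s|lborel. cf (s / sqrt (real j)) ^ j) \<longlonglongrightarrow> (LINT s|lborel. complex_of_real (exp (- (v * s^2 / 2))))"
  \<comment> \<open>The shift keeps the exponent positive: a zeroth power would be the constant 1,
    which no integrable function dominates.\<close>
  proof (rule LIMSEQ_offset[of _ 1], rule integral_dominated_convergence[where w="\<lambda>s. max 1 (1/c) * (1 / (1 + s^2))"])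
    show "integrable lborel (\<lambda>s::real. max 1 (1/c) * (1 / (1 + s^2)))"
      by (intro integrable_mult_right integrable_inverse_1_plus_square)
    show "AE s in lborel. (\<lambda>j. cf (s / sqrt (real (j + 1))) ^ (j + 1)) \<longlonglongrightarrow> complex_of_real (exp (- (v * s^2 / 2)))"
      by (intro AE_I2 LIMSEQ_ignore_initial_segment cf_power_tendsto)
    show "AE s in lborel. norm (cf (s / sqrt (real (j + 1))) ^ (j + 1)) \<le> max 1 (1/c) * (1 / (1 + s^2))" for j
    proof (rule AE_I2)
      fix s :: real
      let ?x = "c * (s / sqrt (real (j + 1)))^2"
      have x: "?x = c * s^2 / real (j + 1)" by (simp add: power_divide)
      have "norm (cf (s / sqrt (real (j + 1))) ^ (j + 1)) \<le> (1 / (1 + ?x)) ^ (j + 1)"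
        unfolding norm_power using c(2) by (intro power_mono) auto
      also have "\<dots> = 1 / (1 + ?x) ^ (j + 1)" by (simp add: power_one_over)
      also have "\<dots> \<le> 1 / (1 + c * s^2)"
      proof (rule divide_left_mono)
        \<comment> \<open>Bernoulli turns (1 + c s^2 / k)^k into at least 1 + c s^2, a majorant
          independent of the exponent.\<close>
        have "1 + real (j + 1) * ?x \<le> (1 + ?x) ^ (j + 1)"
          using c by (intro Bernoulli_inequality) (auto intro: order_trans[of _ 0])
        moreover have "real (j + 1) * ?x = c * s^2" unfolding x by simp
        ultimately show "1 + c * s^2 \<le> (1 + ?x) ^ (j + 1)" by (simp only:)
        show "0 < (1 + ?x) ^ (j + 1) * (1 + c * s^2)" using c by (intro mult_pos_pos zero_less_power add_pos_nonneg) auto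
      qed simp
      also have "\<dots> \<le> max 1 (1/c) * (1 / (1 + s^2))" using c by (intro quadratic_weight_scale)
      finally show "norm (cf (s / sqrt (real (j + 1))) ^ (j + 1)) \<le> max 1 (1/c) * (1 / (1 + s^2))" .
    qed
  qed measurable
  define I where "I = (LINT s|lborel. exp (- (v * s^2 / 2)))"
  have I: "I > 0"
  proof -
    have "(LINT y|lborel. std_normal_density y) = sqrt v *\<^sub>R (LINT s|lborel. std_normal_density (sqrt v * s))"
      using lborel_integral_real_affine[of "sqrt v" std_normal_density 0] v_pos by simp
    also have "(\<lambda>s. std_normal_density (sqrt v * s)) = (\<lambda>s. 1 / sqrt (2 * pi) * exp (- (v * s^2 / 2)))"
      using v_pos by (auto simp: std_normal_density_def power_mult_distrib)
    finally have "(LINT y|lborel. std_normal_density y) = sqrt v * (1 / sqrt (2 * pi) * I)"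
      unfolding integral_mult_right_zero I_def real_scaleR_def .
    moreover have "(LINT y|lborel. std_normal_density y) = 1" by simp
    ultimately have "1 = sqrt v * (1 / sqrt (2 * pi) * I)" by (simp only:)
    then have "I \<noteq> 0" by (metis mult_zero_right zero_neq_one)
    moreover have "I \<ge> 0" unfolding I_def by (intro Bochner_Integration.integral_nonneg) auto
    ultimately show ?thesis by simp
  qed
  have "(\<lambda>j. complex_of_real (2 * pi * sqrt (real j) * conv_pow \<phi> j 0)) \<longlonglongrightarrow> of_real I"
  proof (rule Lim_transform_eventually[OF L[unfolded integral_complex_of_real, folded I_def]])
    show "\<forall>\<^sub>F j in sequentially. (LINT s|lborel. cf (s / sqrt (real j)) ^ j) = complex_of_real (2 * pi * sqrt (real j) * conv_pow \<phi> j 0)"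
      by (rule eventually_mono[OF eventually_gt_at_top[of 0]]) (simp only: conv_pow_at_0)
  qed
  then have "(\<lambda>j. 2 * pi * sqrt (real j) * conv_pow \<phi> j 0) \<longlonglongrightarrow> I" by (simp only: tendsto_of_real_iff)
  then have "\<forall>\<^sub>F j in sequentially. 2 * pi * sqrt (real j) * conv_pow \<phi> j 0 > I / 2"
    using I by (intro order_tendstoD) auto
  then obtain j0 where j0: "\<And>j. j \<ge> j0 \<Longrightarrow> 2 * pi * sqrt (real j) * conv_pow \<phi> j 0 > I / 2"
    by (auto simp: eventually_sequentially)
  \<comment> \<open>The constant is half of the limit divided by 2 pi; passing to
    \<open>Suc j0\<close> makes the threshold positive.\<close>
  have "conv_pow \<phi> j 0 \<ge> (I / (4 * pi)) / sqrt (real j)" if "j \<ge> Suc j0" for j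
    using j0[of j] that by (simp add: field_simps)
  then show ?thesis using I by (intro exI[of _ "I / (4 * pi)"] conjI exI[of _ "Suc j0"]) auto
qed

end

section \<open>The weights and their generating function\<close>

locale weighted_schwartz_density = centered_schwartz_density +
  fixes \<theta> :: real
  assumes \<theta>_pos: "\<theta> > 0"
begin

abbreviation Z :: "int measure" where "Z \<equiv> count_space UNIV"

abbreviation cf_at :: "real \<Rightarrow> int \<Rightarrow> complex" where "cf_at L m \<equiv> cf (2 * pi * m / L)"

lemma cf_at_integrable:
  assumes "L > 0"
  shows "integrable Z (\<lambda>m. norm (cf_at L m))" "j > 0 \<Longrightarrow> integrable Z (\<lambda>m. cf_at L m ^ j)"
proof -
  obtain c where c: "c > 0" "\<And>t. norm (cf t) \<le> 1 / (1 + c * t^2)" using cf_bound by blast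
  have b: "norm (cf_at L m) \<le> 1 / (1 + c * (2 * pi / L)^2 * (of_int m)^2)" for m
    using c(2)[of "2 * pi * m / L"] by (simp add: power_divide power_mult_distrib mult.assoc)
  have i: "integrable Z (\<lambda>m. 1 / (1 + c * (2 * pi / L)^2 * (of_int m)^2))"
    by (rule integrable_int_quadratic) (use assms c in simp)
  show "integrable Z (\<lambda>m. norm (cf_at L m))"
    by (rule integrable_bound_le[OF i]) (simp, use b in simp)
  then have i': "integrable Z (\<lambda>m. cf_at L m)" by (simp add: integrable_norm_iff)
  show "integrable Z (\<lambda>m. cf_at L m ^ j)" if jpos: "j > 0"
  proof (rule Bochner_Integration.integrable_bound[OF i'])
    obtain n where n: "j = Suc n" using jpos by (cases j) auto
    show "AE m in Z. norm (cf_at L m ^ j) \<le> norm (cf_at L m)"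
    proof (rule AE_I2)
      fix m show "norm (cf_at L m ^ j) \<le> norm (cf_at L m)"
        using cf_le_1[of "2 * pi * m / L"] mult_left_le[of "norm (cf_at L m) ^ n" "norm (cf_at L m)"]
        unfolding n norm_power by (simp add: power_le_one)
    qed
  qed simp
qed

text \<open>Poisson summation applied to the dilated power L f(L x), with f the j-fold convolution;
  its transform at 2 pi m is the j-th power of \<open>cf_at L m\<close>. The last part replaces the
  unordered sum in \<open>W\<close> by an integral over counting measure.\<close>

lemma conv_pow_lattice:
  assumes L: "L > 0" and j: "j > 0"
  shows "integrable Z (\<lambda>k. conv_pow \<phi> j (L * of_int k))"
    and "complex_of_real (L * (LINT k|Z. conv_pow \<phi> j (L * of_int k))) = (LINT m|Z. cf_at L m ^ j)"
    and "W \<theta> \<phi> L j = \<theta> * L * (LINT k|Z. conv_pow \<phi> j (L * of_int k))"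
proof -
  obtain n where n: "j = Suc n" using j by (cases j) auto
  note T = tame_densityD[OF tame_conv_pow(1)[OF tame, of n], folded n]
  obtain C where C: "C \<ge> 0" "\<And>x. conv_pow \<phi> j x \<le> C / (1 + x^2)" using T(6) by auto
  define f where "f x = complex_of_real (L * conv_pow \<phi> j (L * x))" for x
  let ?D = "L * C * max 1 (1 / L^2)"
  have fb: "norm (f x) \<le> ?D / (1 + x^2)" for x
  proof -
    have "norm (f x) = L * conv_pow \<phi> j (L * x)" using L T(2) by (simp add: f_def norm_mult)
    also have "\<dots> \<le> L * (C / (1 + (L * x)^2))" using L C by (intro mult_left_mono) auto
    also have "\<dots> = L * C * (1 / (1 + L^2 * x^2))" by (simp add: power_mult_distrib)
    also have "\<dots> \<le> L * C * (max 1 (1 / L^2) * (1 / (1 + x^2)))"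
      using L C by (intro mult_left_mono quadratic_weight_scale) auto
    finally show ?thesis by simp
  qed
  have fc: "continuous_on UNIV f"
    unfolding f_def by (intro continuous_intros continuous_on_compose2[OF T(1)]) auto
  have ftf: "ft f t = cf (t / L) ^ j" for t
  proof -
    have "cf (t / L) ^ j = (LINT x|lborel. iexp (t / L * x) * complex_of_real (conv_pow \<phi> j x))"
      unfolding n tame_conv_pow(2)[OF tame, symmetric] by (simp only: ft_def)
    also have "\<dots> = L *\<^sub>R (LINT x|lborel. iexp (t * x) * complex_of_real (conv_pow \<phi> j (L * x)))"
      using L lborel_integral_real_affine[of L "\<lambda>x. iexp (t / L * x) * complex_of_real (conv_pow \<phi> j x)" 0] by simp
    also have "\<dots> = ft f t"
      unfolding ft_def f_def by (simp add: scaleR_conv_of_real mult.left_commute flip: integral_mult_right_zero)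
    finally show ?thesis by simp
  qed
  have ps: "(LINT k|Z. f k) = (LINT m|Z. cf_at L m ^ j)"
    using poisson_summation[OF fc fb] cf_at_integrable(2)[OF L j] by (simp add: ftf)
  have "integrable Z (\<lambda>k. ?D * (1 / (1 + 1 * (of_int k)^2)))"
    by (intro integrable_mult_right integrable_int_quadratic) simp
  then have "integrable Z (\<lambda>k. f (of_int k))"
    by (rule integrable_bound_le) (use fb in \<open>simp_all\<close>)
  then have "integrable Z (\<lambda>k. L * conv_pow \<phi> j (L * of_int k))"
    unfolding f_def by (simp only: complex_of_real_integrable_eq)
  then show i: "integrable Z (\<lambda>k. conv_pow \<phi> j (L * of_int k))" using L by simp
  show "complex_of_real (L * (LINT k|Z. conv_pow \<phi> j (L * of_int k))) = (LINT m|Z. cf_at L m ^ j)"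
    unfolding ps[symmetric] f_def integral_complex_of_real integral_mult_right_zero ..
  have "(\<Sum>\<^sub>\<infinity>k::int. conv_pow \<phi> j (L * of_int k)) = infsetsum (\<lambda>k::int. conv_pow \<phi> j (L * of_int k)) UNIV"
    by (rule infsetsum_infsum[symmetric]) (use i in \<open>simp add: Infinite_Set_Sum.abs_summable_on_def\<close>)
  then show "W \<theta> \<phi> L j = \<theta> * L * (LINT k|Z. conv_pow \<phi> j (L * of_int k))"
    by (simp add: W_def infsetsum_def)
qed

lemma W_poisson:
  assumes "L > 0" "j > 0"
  shows "complex_of_real (W \<theta> \<phi> L j) = \<theta> * (LINT m|Z. cf_at L m ^ j)"
  unfolding conv_pow_lattice(3)[OF assms] conv_pow_lattice(2)[OF assms, symmetric] by simp

text \<open>All terms of the lattice sum are nonnegative, so it dominates the one at k = 0.\<close>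

lemma W_lower:
  assumes L: "L > 0" and j: "j > 0"
  shows "\<theta> * L * conv_pow \<phi> j 0 \<le> W \<theta> \<phi> L j" "0 \<le> W \<theta> \<phi> L j"
proof -
  obtain n where n: "j = Suc n" using j by (cases j) auto
  note T = tame_densityD[OF tame_conv_pow(1)[OF tame, of n], folded n]
  have "(LINT k|Z. indicator {0} k *\<^sub>R conv_pow \<phi> j 0) \<le> (LINT k|Z. conv_pow \<phi> j (L * of_int k))"
  proof (rule integral_mono)
    show "integrable Z (\<lambda>k. indicator {0} k *\<^sub>R conv_pow \<phi> j 0)" by simp
    show "integrable Z (\<lambda>k. conv_pow \<phi> j (L * of_int k))" by (rule conv_pow_lattice(1)[OF L j])
    show "indicator {0} k *\<^sub>R conv_pow \<phi> j 0 \<le> conv_pow \<phi> j (L * of_int k)" for k :: int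
      using T(2) by (auto simp: indicator_def)
  qed
  then have "conv_pow \<phi> j 0 \<le> (LINT k|Z. conv_pow \<phi> j (L * of_int k))" by simp
  then show "\<theta> * L * conv_pow \<phi> j 0 \<le> W \<theta> \<phi> L j"
    unfolding conv_pow_lattice(3)[OF L j] using L \<theta>_pos by (intro mult_left_mono) auto
  moreover have "0 \<le> \<theta> * L * conv_pow \<phi> j 0" using L \<theta>_pos T(2) by simp
  ultimately show "0 \<le> W \<theta> \<phi> L j" by linarith
qed

text \<open>A bound on all weights at once, because powers only shrink |\<open>cf\<close>| <= 1; it
  puts the radius of convergence of the generating function at 1 or more.\<close>

definition W_bound :: "real \<Rightarrow> real" where "W_bound L = \<theta> * (LINT m|Z. norm (cf_at L m))"

lemma W_upper:
  assumes L: "L > 0" and j: "j > 0"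
  shows "W \<theta> \<phi> L j \<le> W_bound L"
proof -
  obtain n where n: "j = Suc n" using j by (cases j) auto
  have "norm (LINT m|Z. cf_at L m ^ j) \<le> (LINT m|Z. norm (cf_at L m))"
  proof (rule norm_integral_le[OF cf_at_integrable(1)[OF L]])
    fix m show "norm (cf_at L m ^ j) \<le> norm (cf_at L m)"
      using cf_le_1[of "2 * pi * m / L"] mult_left_le[of "norm (cf_at L m) ^ n" "norm (cf_at L m)"]
      unfolding n norm_power by (simp add: power_le_one)
  qed
  then have "norm (complex_of_real (W \<theta> \<phi> L j)) \<le> W_bound L"
    unfolding W_poisson[OF L j] W_bound_def norm_mult using \<theta>_pos by (simp add: mult_left_mono)
  then show ?thesis by simp
qed

section \<open>The generating function on the open unit disc\<close>

definition G_coeff :: "real \<Rightarrow> nat \<Rightarrow> complex" where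
  "G_coeff L n = of_real (if n = 0 then 0 else W \<theta> \<phi> L n / real n)"

definition G_complex :: "real \<Rightarrow> complex \<Rightarrow> complex" where
  "G_complex L z = (\<Sum>n. G_coeff L n * z ^ n)"

lemma W_bound_nonneg: "W_bound L \<ge> 0"
  unfolding W_bound_def using \<theta>_pos by simp

lemma G_coeff_summable:
  assumes L: "L > 0" and z: "norm z < 1"
  shows "summable (\<lambda>n. norm (G_coeff L n * z ^ n))"
proof (rule summable_comparison_test')
  show "summable (\<lambda>n. W_bound L * norm z ^ n)" using z by (intro summable_mult summable_geometric) auto
  fix n :: nat
  have "norm (G_coeff L n) \<le> W_bound L"
  proof (cases "n = 0")
    case False
    then have "W \<theta> \<phi> L n / real n \<le> W \<theta> \<phi> L n / 1"
      using W_lower(2)[OF L, of n] by (intro divide_left_mono) auto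
    then show ?thesis using False W_lower(2)[OF L, of n] W_upper[OF L, of n]
      unfolding G_coeff_def norm_of_real by simp
  qed (simp add: G_coeff_def W_bound_nonneg)
  then show "norm (norm (G_coeff L n * z ^ n)) \<le> W_bound L * norm z ^ n"
    by (simp add: norm_mult norm_power mult_right_mono)
qed

lemma G_val_eq:
  assumes L: "L > 0" and x: "\<bar>x\<bar> < 1"
  shows "of_real (G_val \<theta> \<phi> L x) = G_complex L (of_real x)"
proof -
  have s: "summable (\<lambda>n. G_coeff L n * of_real x ^ n)"
    using G_coeff_summable[OF L, of "of_real x"] x by (auto dest: summable_norm_cancel)
  have ge: "G_coeff L (Suc n) * of_real x ^ Suc n = of_real (W \<theta> \<phi> L (Suc n) * x ^ Suc n / real (Suc n))" for n
    unfolding G_coeff_def by (simp only: nat.distinct if_False of_real_mult of_real_divide of_real_power times_divide_eq_left)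
  have "G_complex L (of_real x) = (\<Sum>n. G_coeff L (Suc n) * of_real x ^ Suc n) + G_coeff L 0 * of_real x ^ 0"
    unfolding G_complex_def using suminf_split_head[OF s] by simp
  also have "\<dots> = (\<Sum>n. of_real (W \<theta> \<phi> L (Suc n) * x ^ Suc n / real (Suc n)))"
    unfolding ge by (simp add: G_coeff_def)
  also have "\<dots> = of_real (G_val \<theta> \<phi> L x)"
    unfolding G_val_def
  proof (rule suminf_of_real[symmetric])
    have "summable (\<lambda>n. G_coeff L (Suc n) * of_real x ^ Suc n)" using s by (subst summable_Suc_iff)
    then show "summable (\<lambda>n. W \<theta> \<phi> L (Suc n) * x ^ Suc n / real (Suc n))"
      unfolding ge by (simp only: summable_complex_of_real)
  qed
  finally show ?thesis by simp
qed

lemma cf_at_z_less_1: "norm z < 1 \<Longrightarrow> norm (z * cf_at L m) < 1"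
  using cf_le_1[of "2 * pi * m / L"] mult_left_le[of "norm (cf_at L m)" "norm z"] by (simp add: norm_mult)

text \<open>Differentiation removes the factor 1/n, so that for each m the sum over n is geometric
  in z \<open>cf_at L m\<close>. Absolute summability in (m, n) comes from the integrable
  |\<open>cf_at L m\<close>| times |z|^n.\<close>

lemma G_complex_deriv:
  assumes L: "L > 0" and z: "norm z < 1"
  shows "(G_complex L has_field_derivative (\<theta> * (LINT m|Z. cf_at L m / (1 - z * cf_at L m)))) (at z)"
proof -
  obtain r where r: "norm z < r" "r < 1" using z dense by blast
  have "summable (\<lambda>n. G_coeff L n * of_real r ^ n)"
    using G_coeff_summable[OF L, of "of_real r"] r norm_ge_zero[of z] by (auto dest: summable_norm_cancel)
  then have d: "(G_complex L has_field_derivative (\<Sum>n. diffs (G_coeff L) n * z ^ n)) (at z)"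
    unfolding G_complex_def[abs_def] using r by (intro termdiffs_strong[where K="of_real r"]) auto
  have s1: "summable (\<lambda>n. norm z ^ n)" using z by (intro summable_geometric) auto
  have "(\<Sum>n. diffs (G_coeff L) n * z ^ n) = (\<Sum>n. (LINT m|Z. \<theta> * (cf_at L m * (z * cf_at L m) ^ n)))"
  proof (rule suminf_cong)
    fix n
    have "diffs (G_coeff L) n * z ^ n = \<theta> * (LINT m|Z. cf_at L m ^ Suc n) * z ^ n"
      unfolding W_poisson[OF L zero_less_Suc, symmetric] by (simp add: diffs_def G_coeff_def del: of_nat_Suc)
    also have "\<dots> = (LINT m|Z. \<theta> * (cf_at L m * (z * cf_at L m) ^ n))"
      by (simp add: power_mult_distrib mult_ac flip: integral_mult_right_zero)
    finally show "diffs (G_coeff L) n * z ^ n = (LINT m|Z. \<theta> * (cf_at L m * (z * cf_at L m) ^ n))" .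
  qed
  also have "\<dots> = (LINT m|Z. (\<Sum>n. \<theta> * (cf_at L m * (z * cf_at L m) ^ n)))"
  proof (rule integral_suminf[symmetric])
    have le: "norm (\<theta> * (cf_at L m * (z * cf_at L m) ^ n)) \<le> norm (\<theta> * norm (cf_at L m) * norm z ^ n)" for m n
    proof -
      have "norm (z * cf_at L m) ^ n \<le> norm z ^ n"
        using cf_le_1[of "2 * pi * m / L"] mult_left_le[of "norm (cf_at L m)" "norm z"]
        by (intro power_mono) (auto simp: norm_mult)
      then show ?thesis using \<theta>_pos by (simp add: norm_mult norm_power mult_left_mono abs_mult)
    qed
    have i: "integrable Z (\<lambda>m. \<theta> * norm (cf_at L m) * norm z ^ n)" for n
      using cf_at_integrable(1)[OF L] by simp
    show int: "integrable Z (\<lambda>m. complex_of_real \<theta> * (cf_at L m * (z * cf_at L m) ^ n))" for n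
      by (rule Bochner_Integration.integrable_bound[OF i[of n]]) (use le in auto)
    show "AE m in Z. summable (\<lambda>n. norm (complex_of_real \<theta> * (cf_at L m * (z * cf_at L m) ^ n)))"
    proof (rule AE_I2)
      fix m
      have "summable (\<lambda>n. norm (z * cf_at L m) ^ n)" using cf_at_z_less_1[OF z] by (intro summable_geometric) auto
      then have "summable (\<lambda>n. \<theta> * (norm (cf_at L m) * norm (z * cf_at L m) ^ n))" by (intro summable_mult)
      then show "summable (\<lambda>n. norm (complex_of_real \<theta> * (cf_at L m * (z * cf_at L m) ^ n)))"
        using \<theta>_pos by (simp add: norm_mult norm_power)
    qed
    show "summable (\<lambda>n. LINT m|Z. norm (complex_of_real \<theta> * (cf_at L m * (z * cf_at L m) ^ n)))"
    proof (rule summable_comparison_test')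
      show "summable (\<lambda>n. W_bound L * norm z ^ n)" using s1 by (rule summable_mult)
      fix n
      have "norm (LINT m|Z. norm (complex_of_real \<theta> * (cf_at L m * (z * cf_at L m) ^ n))) \<le> (LINT m|Z. \<theta> * norm (cf_at L m) * norm z ^ n)"
        by (rule norm_integral_le[OF i]) (use le \<theta>_pos in \<open>auto simp: abs_mult\<close>)
      also have "\<dots> = W_bound L * norm z ^ n" by (simp add: W_bound_def)
      finally show "norm (LINT m|Z. norm (complex_of_real \<theta> * (cf_at L m * (z * cf_at L m) ^ n))) \<le> W_bound L * norm z ^ n" .
    qed
  qed
  also have "\<dots> = (LINT m|Z. \<theta> * (cf_at L m / (1 - z * cf_at L m)))"
  proof (rule Bochner_Integration.integral_cong[OF refl])
    fix m
    have "(\<lambda>n. \<theta> * (cf_at L m * (z * cf_at L m) ^ n)) sums (\<theta> * (cf_at L m * (1 / (1 - z * cf_at L m))))"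
      by (intro sums_mult geometric_sums cf_at_z_less_1 z)
    then show "(\<Sum>n. \<theta> * (cf_at L m * (z * cf_at L m) ^ n)) = \<theta> * (cf_at L m / (1 - z * cf_at L m))"
      by (simp add: sums_iff)
  qed
  also have "\<dots> = \<theta> * (LINT m|Z. cf_at L m / (1 - z * cf_at L m))" by (rule integral_mult_right_zero)
  finally show ?thesis using d by simp
qed

lemma G_complex_holomorphic: "L > 0 \<Longrightarrow> G_complex L holomorphic_on ball 0 1"
  by (subst holomorphic_on_open) (auto intro!: exI G_complex_deriv)

end

section \<open>Partial fractions of the hyperbolic cotangent\<close>

lemma exp_abs_bound:
  fixes a x :: real
  assumes a: "a > 0"
  shows "exp (- (a * \<bar>x\<bar>)) \<le> (1 + 2 / a^2) / (1 + x^2)"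
proof -
  have "1 + a * \<bar>x\<bar> + (a * \<bar>x\<bar>)^2 / 2 \<le> exp (a * \<bar>x\<bar>)"
    using a by (intro exp_lower_Taylor_quadratic) auto
  moreover have "0 \<le> a * \<bar>x\<bar>" using a by simp
  ultimately have e: "1 \<le> exp (a * \<bar>x\<bar>)" "a^2 * x^2 / 2 \<le> exp (a * \<bar>x\<bar>)"
    using zero_le_power2[of "a * \<bar>x\<bar>"] by (simp_all add: power_mult_distrib)
  have "x^2 = 2 / a^2 * (a^2 * x^2 / 2)" using a by simp
  also have "\<dots> \<le> 2 / a^2 * exp (a * \<bar>x\<bar>)" using e by (intro mult_left_mono) auto
  finally have "1 + x^2 \<le> (1 + 2 / a^2) * exp (a * \<bar>x\<bar>)" using e(1) unfolding distrib_right mult_1_left by linarith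
  then have "(1 + x^2) * exp (- (a * \<bar>x\<bar>)) \<le> (1 + 2 / a^2) * exp (a * \<bar>x\<bar>) * exp (- (a * \<bar>x\<bar>))"
    by (rule mult_right_mono) simp
  also have "\<dots> = 1 + 2 / a^2" by (simp add: mult.assoc flip: exp_add)
  finally show ?thesis by (simp add: pos_le_divide_eq add_pos_nonneg mult.commute)
qed

lemma integral_exp_half_line:
  fixes c :: complex
  assumes c: "Re c > 0"
  shows "integrable lborel (\<lambda>x. indicator {0<..} x *\<^sub>R exp (- c * of_real x))"
    and "(LINT x|lborel. indicator {0<..} x *\<^sub>R exp (- c * of_real x)) = 1 / c"
proof -
  have c0: "c \<noteq> 0" using c by auto
  show i: "integrable lborel (\<lambda>x. indicator {0<..} x *\<^sub>R exp (- c * of_real x))"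
  proof (rule integrable_quadratic_bound)
    show "norm (indicator {0<..} x *\<^sub>R exp (- c * of_real x)) \<le> (1 + 2 / (Re c)^2) / (1 + x^2)" for x
    proof (cases "x > 0")
      case True
      then have "norm (exp (- c * of_real x)) = exp (- (Re c * \<bar>x\<bar>))" by simp
      then show ?thesis using exp_abs_bound[OF c, of x] True by simp
    next
      case False
      then show ?thesis by (auto intro!: divide_nonneg_nonneg add_nonneg_nonneg)
    qed
  qed measurable
  let ?F = "\<lambda>x. - exp (- c * complex_of_real x) / c"
  have "(LBINT x=0..\<infinity>. exp (- c * of_real x)) = 0 - ?F 0"
  proof (rule interval_integral_FTC_integrable[where F="?F"])
    fix x :: real
    have "((\<lambda>z. - exp (- c * z) / c) has_field_derivative exp (- c * of_real x)) (at (of_real x))"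
      using c0 by (auto intro!: derivative_eq_intros)
    from has_vector_derivative_real_field[OF this]
    show "(?F has_vector_derivative exp (- c * of_real x)) (at x)" by simp
    show "isCont (\<lambda>x. exp (- c * complex_of_real x)) x" by (intro continuous_intros)
  next
    have "einterval 0 \<infinity> = {0<..}" by (auto simp: einterval_def zero_ereal_def)
    then show "set_integrable lborel (einterval 0 \<infinity>) (\<lambda>x. exp (- c * complex_of_real x))"
      using i by (simp add: set_integrable_def)
    have "isCont ?F 0" by (intro continuous_intros c0)
    then have "(?F \<longlongrightarrow> ?F 0) (at_right 0)" by (simp add: isCont_def filterlim_at_split)
    then show "((?F \<circ> real_of_ereal) \<longlongrightarrow> ?F 0) (at_right 0)"
      unfolding zero_ereal_def by (simp only: ereal_tendsto_simps)
    have "((\<lambda>x. exp (- (a * x))) \<longlongrightarrow> 0) at_top" if "a > 0" for a :: real using that by real_asymp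
    from tendsto_divide_zero[OF this[OF c]]
    have "((\<lambda>x. exp (- (Re c * x)) / norm c) \<longlongrightarrow> 0) at_top" .
    then have "(?F \<longlongrightarrow> 0) at_top"
      by (rule Lim_null_comparison[rotated]) (simp add: norm_divide)
    then show "((?F \<circ> real_of_ereal) \<longlongrightarrow> 0) (at_left \<infinity>)" by (simp only: ereal_tendsto_simps)
  qed simp
  moreover have "einterval 0 \<infinity> = {0<..}" by (auto simp: einterval_def zero_ereal_def)
  ultimately show "(LINT x|lborel. indicator {0<..} x *\<^sub>R exp (- c * of_real x)) = 1 / c"
    by (simp add: interval_lebesgue_integral_def set_lebesgue_integral_def)
qed

lemma ft_exp_abs:
  fixes c :: complex
  assumes c: "Re c > 0"
  shows "ft (\<lambda>x. exp (- c * of_real \<bar>x\<bar>)) t = 2 * c / (c^2 + of_real (t^2))"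
proof -
  let ?I = "\<lambda>x::real. indicator {0<..} x :: real"
  have r: "Re (c - \<i> * t) > 0" "Re (c + \<i> * t) > 0" using c by auto
  note i1 = integral_exp_half_line[OF r(1)] and i2 = integral_exp_half_line[OF r(2)]
  have i2': "integrable lborel (\<lambda>x. ?I (- x) *\<^sub>R exp (- (c + \<i> * t) * of_real (- x)))"
    using lborel_integrable_real_affine[OF i2(1), of "-1" 0] by simp
  have e2': "(LINT x|lborel. ?I (- x) *\<^sub>R exp (- (c + \<i> * t) * of_real (- x))) = 1 / (c + \<i> * t)"
    using lborel_integral_real_affine[of "-1" "\<lambda>x. ?I x *\<^sub>R exp (- (c + \<i> * t) * of_real x)" 0] i2(2) by simp
  have "ft (\<lambda>x. exp (- c * of_real \<bar>x\<bar>)) t =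
     (LINT x|lborel. ?I x *\<^sub>R exp (- (c - \<i> * t) * of_real x) + ?I (- x) *\<^sub>R exp (- (c + \<i> * t) * of_real (- x)))"
    unfolding ft_def
  proof (rule integral_cong_AE)
    show "AE x in lborel. iexp (t * x) * exp (- c * of_real \<bar>x\<bar>) =
       ?I x *\<^sub>R exp (- (c - \<i> * t) * of_real x) + ?I (- x) *\<^sub>R exp (- (c + \<i> * t) * of_real (- x))"
      using AE_lborel_singleton[of 0]
    proof eventually_elim
      case (elim x)
      then consider "x > 0" | "x < 0" by linarith
      then show ?case by cases (auto simp: algebra_simps simp flip: exp_add)
    qed
  qed measurable
  also have "\<dots> = 1 / (c - \<i> * t) + 1 / (c + \<i> * t)"
    by (simp only: Bochner_Integration.integral_add[OF i1(1) i2'] i1(2) e2')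
  also have "\<dots> = 2 * c / (c^2 + of_real (t^2))"
  proof -
    have "c - \<i> * t \<noteq> 0" "c + \<i> * t \<noteq> 0" using r by (metis less_irrefl zero_complex.sel(1))+
    then have "1 / (c - \<i> * t) + 1 / (c + \<i> * t) = 2 * c / ((c - \<i> * t) * (c + \<i> * t))"
      by (simp add: field_simps)
    also have "(c - \<i> * t) * (c + \<i> * t) = c^2 + of_real (t^2)"
      by (simp add: algebra_simps power2_eq_square)
    finally show ?thesis .
  qed
  finally show ?thesis .
qed

lemma norm_quadratic_lower:
  fixes a x :: real and z :: complex
  assumes a: "a > 0" and z: "Re z \<ge> a" and "x \<ge> 0"
  shows "norm (1 / (z + of_real x)) \<le> max 1 (1/a) * (1 / (1 + x))"
proof -
  have "a + x \<le> Re (z + of_real x)" using z by simp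
  also have "\<dots> \<le> norm (z + of_real x)" by (rule complex_Re_le_cmod)
  finally have n: "a + x \<le> norm (z + of_real x)" .
  have "1 / norm (z + of_real x) \<le> 1 / (a + x)" using n a assms(3) by (intro divide_left_mono) (auto intro!: mult_pos_pos intro: less_le_trans[OF _ n])
  also have "\<dots> \<le> max 1 (1/a) * (1 / (1 + x))"
  proof -
    have "1 + x \<le> max 1 (1/a) * (a + x)"
    proof -
      have "1 \<le> max 1 (1/a) * a" using a by (cases "a \<le> 1") (auto simp: max_def field_simps)
      moreover have "x \<le> max 1 (1/a) * x" using assms(3) by (simp add: mult_le_cancel_right1)
      ultimately show ?thesis by (simp add: distrib_left)
    qed
    then show ?thesis using a assms(3) by (simp add: field_simps)
  qed
  finally show ?thesis by (simp add: norm_divide)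
qed

text \<open>The right-hand side is coth(c/2). Its geometric series is the sum of exp(-c |k|) over
  the integers, and the partial fractions are the transform of exp(-c |x|); positivity of Re (c^2)
  supplies a summable majorant for them.\<close>

lemma coth_partial_fractions:
  fixes c :: complex
  assumes c: "Re c > 0" and c2: "Re (c^2) > 0"
  shows "integrable (count_space (UNIV::int set)) (\<lambda>m. 1 / (c^2 + of_real (4 * pi^2 * (of_int m)^2)))"
    and "2 * c * (LINT m|count_space (UNIV::int set). 1 / (c^2 + of_real (4 * pi^2 * (of_int m)^2))) = (1 + exp (- c)) / (1 - exp (- c))"
proof -
  let ?f = "\<lambda>x. exp (- c * complex_of_real \<bar>x\<bar>)"
  have b: "norm (?f x) \<le> (1 + 2 / (Re c)^2) / (1 + x^2)" for x
    using exp_abs_bound[OF c, of x] by simp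
  have cont: "continuous_on UNIV ?f" by (intro continuous_intros)
  have ftf: "ft ?f (2 * pi * of_int m) = 2 * c * (1 / (c^2 + of_real (4 * pi^2 * (of_int m)^2)))" for m :: int
    unfolding ft_exp_abs[OF c] by (simp add: power_mult_distrib)
  have i0: "integrable (count_space (UNIV::int set)) (\<lambda>m. max 1 (1 / Re (c^2)) * (1 / (1 + 4 * pi^2 * (of_int m)^2)))"
    by (intro integrable_mult_right integrable_int_quadratic) simp
  show i: "integrable (count_space (UNIV::int set)) (\<lambda>m. 1 / (c^2 + of_real (4 * pi^2 * (of_int m)^2)))"
  proof (rule Bochner_Integration.integrable_bound[OF i0])
    show "AE m in count_space (UNIV::int set). norm (1 / (c^2 + of_real (4 * pi^2 * (of_int m)^2))) \<le>
        norm (max 1 (1 / Re (c^2)) * (1 / (1 + 4 * pi^2 * (real_of_int m)^2)))"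
      by (intro AE_I2 order_trans[OF norm_quadratic_lower[OF c2] abs_ge_self[THEN order_trans]]) auto
  qed simp
  have "(LINT k|count_space (UNIV::int set). ?f (of_int k)) = (LINT m|count_space (UNIV::int set). ft ?f (2 * pi * m))"
    by (rule poisson_summation[OF cont b]) (unfold ftf, rule integrable_mult_right[OF i])
  also have "\<dots> = 2 * c * (LINT m|count_space (UNIV::int set). 1 / (c^2 + of_real (4 * pi^2 * (of_int m)^2)))"
    unfolding ftf by (rule integral_mult_right_zero)
  also have "(LINT k|count_space (UNIV::int set). ?f (of_int k)) = (1 + exp (- c)) / (1 - exp (- c))"
  proof -
    define q where "q = exp (- c)"
    have q: "norm q < 1" using c by (simp add: q_def)
    then have q1: "q \<noteq> 1" by auto
    have p: "?f (of_int (int n)) = q ^ n" for n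
      by (simp add: q_def mult.commute flip: exp_of_nat_mult)
    have m: "?f (of_int (- int (Suc n))) = q * q ^ n" for n
    proof -
      have "\<bar>real_of_int (- int (Suc n))\<bar> = real (Suc n)" by simp
      then have "?f (of_int (- int (Suc n))) = exp (of_nat (Suc n) * (- c))" by (simp only: of_real_of_nat_eq mult.commute)
      then show ?thesis unfolding exp_of_nat_mult q_def by simp
    qed
    have s: "summable (\<lambda>n. norm q ^ n)" using q by (intro summable_geometric) auto
    have "(LINT k|count_space (UNIV::int set). ?f (of_int k)) = (\<Sum>n. ?f (of_int (int n))) + (\<Sum>n. ?f (of_int (- int (Suc n))))"
      by (rule integral_count_space_int(2)) (unfold p m norm_mult norm_power, use s in \<open>auto intro: summable_mult\<close>)
    also have "\<dots> = 1 / (1 - q) + q * (1 / (1 - q))"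
      unfolding p m using q by (simp add: suminf_mult suminf_geometric summable_geometric)
    also have "\<dots> = (1 + q) / (1 - q)" by (simp add: add_divide_distrib)
    finally show ?thesis by (simp add: q_def)
  qed
  finally show "2 * c * (LINT m|count_space (UNIV::int set). 1 / (c^2 + of_real (4 * pi^2 * (of_int m)^2))) = (1 + exp (- c)) / (1 - exp (- c))"
    by simp
qed

section \<open>Convergence of the logarithmic derivative\<close>

context weighted_schwartz_density
begin

definition circle_pt :: "real \<Rightarrow> real \<Rightarrow> complex" where
  "circle_pt L u = of_real (1 - 1 / L^2) * iexp (u / L^2)"

definition log_ratio :: "real \<Rightarrow> real \<Rightarrow> complex" where
  "log_ratio L u = G_complex L (circle_pt L u) - G_complex L (circle_pt L 0)"

text \<open>The derivative of \<open>log_ratio\<close> in \<open>u\<close>, stripped of the factor i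
  theta. The L^2 from the chain rule sits inside the sum because there each summand has a limit as L
  grows.\<close>

definition slope :: "real \<Rightarrow> real \<Rightarrow> complex" where
  "slope L u = (LINT m|Z. circle_pt L u * cf_at L m / (of_real (L^2) * (1 - circle_pt L u * cf_at L m)))"

lemma norm_circle_pt: "L > 1 \<Longrightarrow> norm (circle_pt L u) = 1 - 1 / L^2"
proof -
  assume "L > 1"
  then have "1 / L^2 \<le> 1" by (simp add: divide_le_eq power2_eq_square less_1_mult order.strict_implies_order)
  then show ?thesis by (simp only: circle_pt_def norm_mult norm_of_real norm_exp_i_times) simp
qed

lemma norm_circle_pt_less: "L > 1 \<Longrightarrow> norm (circle_pt L u) < 1"
  using norm_circle_pt[of L u] by simp

lemma slope_eq:
  "slope L u = circle_pt L u / of_real (L^2) * (LINT m|Z. cf_at L m / (1 - circle_pt L u * cf_at L m))"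
  unfolding slope_def by (subst integral_mult_right_zero[symmetric]) simp

lemma log_ratio_deriv:
  assumes L: "L > 1"
  shows "(log_ratio L has_vector_derivative (\<theta> * \<i> * slope L u)) (at u)"
proof -
  let ?z = "\<lambda>u. of_real (1 - 1 / L^2) * exp (\<i> * (u / of_real (L^2)))"
  have zu: "?z (of_real u) = circle_pt L u" for u by (simp add: circle_pt_def)
  have L2: "complex_of_real (L^2) \<noteq> 0" using L by simp
  have "(?z has_field_derivative (circle_pt L u * (\<i> / of_real (L^2)))) (at (of_real u))"
  proof -
    have "((\<lambda>u. A * exp (\<i> * (u / K))) has_field_derivative (A * exp (\<i> * (w / K)) * (\<i> / K))) (at w)" if "K \<noteq> 0" for A K w :: complex
      using that by (auto intro!: derivative_eq_intros simp: power2_eq_square field_simps)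
    from this[OF L2] show ?thesis unfolding zu[symmetric] .
  qed
  from DERIV_chain2[OF G_complex_deriv[of L "?z (of_real u)"] this]
  have "((\<lambda>u. G_complex L (?z u) - G_complex L (circle_pt L 0)) has_field_derivative (\<theta> * \<i> * slope L u)) (at (of_real u))"
    using L norm_circle_pt_less[OF L, of u] unfolding zu slope_eq
    by (intro derivative_eq_intros) (auto simp: mult_ac)
  from has_vector_derivative_real_field[OF this]
  show ?thesis unfolding zu log_ratio_def[abs_def] .
qed

lemma slope_cont:
  assumes L: "L > 1"
  shows "continuous_on UNIV (slope L)"
proof -
  have "continuous_on (ball 0 1) (deriv (G_complex L))"
    using L by (intro holomorphic_on_imp_continuous_on holomorphic_deriv G_complex_holomorphic) auto
  moreover have "continuous_on UNIV (circle_pt L)" unfolding circle_pt_def using L by (intro continuous_intros) auto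
  ultimately have "continuous_on UNIV (\<lambda>u. deriv (G_complex L) (circle_pt L u))"
    by (rule continuous_on_compose2) (use norm_circle_pt_less[OF L] in auto)
  then have "continuous_on UNIV (\<lambda>u. circle_pt L u / of_real (L^2) * (deriv (G_complex L) (circle_pt L u) / \<theta>))"
    using \<open>continuous_on UNIV (circle_pt L)\<close> L \<theta>_pos by (intro continuous_intros) auto
  also have "(\<lambda>u. circle_pt L u / of_real (L^2) * (deriv (G_complex L) (circle_pt L u) / \<theta>)) = slope L"
  proof (rule ext)
    fix u
    have "deriv (G_complex L) (circle_pt L u) = \<theta> * (LINT m|Z. cf_at L m / (1 - circle_pt L u * cf_at L m))"
      using L norm_circle_pt_less[OF L] by (intro DERIV_imp_deriv G_complex_deriv) auto
    then show "circle_pt L u / of_real (L^2) * (deriv (G_complex L) (circle_pt L u) / \<theta>) = slope L u"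
      unfolding slope_eq using \<theta>_pos by simp
  qed
  finally show ?thesis .
qed

text \<open>Write p for |\<open>cf_at L m\<close>|, a for the radius and y for c (2 pi m / L)^2. The
  bound p (1 + y) <= 1 rearranges to 1 - a p >= p (1/L^2 + y), and multiplying by L^2 cancels every
  power of L on the right.\<close>

lemma slope_summand_bound:
  "\<exists>c>0. \<forall>L>1. \<forall>u m. norm (circle_pt L u * cf_at L m / (of_real (L^2) * (1 - circle_pt L u * cf_at L m))) \<le> 1 / (1 + c * (of_int m)^2)"
proof -
  obtain c where c: "c > 0" "\<And>t. norm (cf t) \<le> 1 / (1 + c * t^2)" using cf_bound by blast
  have "norm (circle_pt L u * cf_at L m / (of_real (L^2) * (1 - circle_pt L u * cf_at L m))) \<le> 1 / (1 + c * (2 * pi)^2 * (of_int m)^2)"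
    if L: "L > 1" for L u m
  proof -
    define y where "y = c * (2 * pi * m / L)^2"
    define p where "p = norm (cf_at L m)"
    define a where "a = 1 - 1 / L^2"
    have L2: "L^2 > 1" using L by (simp add: power2_eq_square less_1_mult)
    have "1 / L^2 < 1" using L2 by (subst divide_less_eq_1_pos) linarith+
    then have a: "0 < a" "a < 1" using L by (auto simp: a_def)
    have y: "y \<ge> 0" using c by (simp add: y_def)
    have p: "0 \<le> p" "p \<le> 1 / (1 + y)" using c(2)[of "2 * pi * m / L"] by (auto simp: p_def y_def)
    then have py: "p * (1 + y) \<le> 1" using y by (simp add: pos_le_divide_eq add_pos_nonneg)
    have nz: "norm (circle_pt L u) = a" using norm_circle_pt[OF L] by (simp add: a_def)
    have p1: "p \<le> 1" using py mult_nonneg_nonneg[OF p(1) y] by (simp add: distrib_left) 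
    have "a * p \<le> a * 1" using a p1 by (intro mult_left_mono) auto
    then have ap: "a * p < 1" using a(2) unfolding mult_1_right by linarith
    have d: "1 - a * p \<le> norm (1 - circle_pt L u * cf_at L m)"
      using norm_triangle_ineq2[of 1 "circle_pt L u * cf_at L m"] by (simp add: norm_mult nz p_def)
    have dd: "norm (1 - circle_pt L u * cf_at L m) > 0" using d ap by linarith
    have k: "1 / L^2 = 1 - a" by (simp add: a_def)
    \<comment> \<open>This is p (1 + y) <= 1 with a p moved across; 1 - a is exactly 1 /
      L^2.\<close>
    have key: "p * ((1 - a) + y) \<le> 1 - a * p" using py by (simp add: algebra_simps)
    have pos: "(1 - a) + y > 0" using a y by simp
    have "norm (circle_pt L u * cf_at L m / (of_real (L^2) * (1 - circle_pt L u * cf_at L m))) = (a * p) / (L^2 * norm (1 - circle_pt L u * cf_at L m))"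
      using L2 by (simp add: norm_divide norm_mult nz p_def norm_power)
    also have "\<dots> \<le> (1 * p) / (L^2 * norm (1 - circle_pt L u * cf_at L m))"
      using a p dd L2 by (intro divide_right_mono mult_right_mono) auto
    also have "\<dots> \<le> 1 / (L^2 * ((1 - a) + y))"
    proof -
      have "p * ((1 - a) + y) \<le> norm (1 - circle_pt L u * cf_at L m)" using key d by linarith
      then have "p / norm (1 - circle_pt L u * cf_at L m) \<le> 1 / ((1 - a) + y)"
        using pos dd by (simp add: field_simps)
      then have "p / norm (1 - circle_pt L u * cf_at L m) / L^2 \<le> 1 / ((1 - a) + y) / L^2"
        by (rule divide_right_mono) simp
      then show ?thesis by (simp add: mult.commute)
    qed
    also have "L^2 * ((1 - a) + y) = 1 + c * (2 * pi)^2 * (of_int m)^2"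
      unfolding k[symmetric] y_def using L by (simp add: distrib_left power_divide power_mult_distrib)
    finally show ?thesis .
  qed
  moreover have "c * (2 * pi)^2 > 0" using c by simp
  ultimately show ?thesis by blast
qed

text \<open>The radial defect 1 / L^2 and the angle u / L^2 are of the same order, which is what
  makes the two combine into 1 - iu. The quadratic Taylor remainder of the exponential is of order 1
  / L^4.\<close>

lemma L2_one_minus_circle_pt: "((\<lambda>L. of_real (L^2) * (1 - circle_pt L u)) \<longlongrightarrow> 1 - \<i> * u) at_top"
proof -
  have d0: "((\<lambda>L. (u / L^2)^2 / 2 * L^2) \<longlongrightarrow> 0) at_top" for u :: real
  proof -
    have "((\<lambda>L::real. (1 / L^2)^2 * L^2) \<longlongrightarrow> 0) at_top" by real_asymp
    then have "((\<lambda>L::real. u^2 / 2 * ((1 / L^2)^2 * L^2)) \<longlongrightarrow> u^2 / 2 * 0) at_top" by (intro tendsto_intros)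
    then show ?thesis by (simp add: power_divide ac_simps)
  qed
  have A: "((\<lambda>L. of_real (L^2) * (1 + \<i> * (u / L^2) - iexp (u / L^2))) \<longlongrightarrow> 0) at_top"
  proof (rule Lim_null_comparison[OF _ d0[of u]], rule always_eventually, rule allI)
    fix L :: real
    have "norm (iexp (u / L^2) - (\<Sum>k\<le>1. (\<i> * (u / L^2))^k / fact k)) \<le> \<bar>u / L^2\<bar> ^ Suc 1 / fact (Suc 1)"
      by (rule iexp_approx1)
    also have "(\<Sum>k\<le>1. (\<i> * complex_of_real (u / L^2))^k / fact k) = 1 + \<i> * (u / L^2)" by simp
    also have "\<bar>u / L^2\<bar> ^ Suc 1 / fact (Suc 1) = (u / L^2)^2 / 2" by (simp add: power2_eq_square)
    finally have "norm (1 + \<i> * (u / L^2) - iexp (u / L^2)) \<le> (u / L^2)^2 / 2"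
      by (subst norm_minus_commute)
    then have "norm (1 + \<i> * (u / L^2) - iexp (u / L^2)) * L^2 \<le> (u / L^2)^2 / 2 * L^2"
      by (rule mult_right_mono) simp
    then show "norm (of_real (L^2) * (1 + \<i> * (u / L^2) - iexp (u / L^2))) \<le> (u / L^2)^2 / 2 * L^2"
      by (simp only: norm_mult norm_of_real) (simp add: mult.commute)
  qed
  have B: "((\<lambda>L. iexp (u / L^2)) \<longlongrightarrow> iexp 0) at_top"
  proof -
    have "((\<lambda>L::real. 1 / L^2) \<longlongrightarrow> 0) at_top" by real_asymp
    then have "((\<lambda>L::real. u * (1 / L^2)) \<longlongrightarrow> u * 0) at_top" by (intro tendsto_intros)
    then have "((\<lambda>L::real. u / L^2) \<longlongrightarrow> 0) at_top" by simp
    then show ?thesis by (intro tendsto_intros)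
  qed
  have "((\<lambda>L. of_real (L^2) * (1 + \<i> * (u / L^2) - iexp (u / L^2)) - \<i> * u + iexp (u / L^2)) \<longlongrightarrow> 0 - \<i> * u + iexp 0) at_top"
    by (rule tendsto_add[OF tendsto_diff[OF A tendsto_const] B])
  moreover have "eventually (\<lambda>L. of_real (L^2) * (1 + \<i> * (u / L^2) - iexp (u / L^2)) - \<i> * u + iexp (u / L^2) = of_real (L^2) * (1 - circle_pt L u)) at_top"
    using eventually_gt_at_top[of 0] by eventually_elim (simp add: circle_pt_def field_simps)
  ultimately show ?thesis using Lim_transform_eventually by (fastforce simp: algebra_simps)
qed

lemma L2_one_minus_cfm: "((\<lambda>L. of_real (L^2) * (1 - cf_at L m)) \<longlongrightarrow> of_real (2 * pi^2 * v * (of_int m)^2)) at_top"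
proof -
  obtain A where A: "A \<ge> 0" "\<And>t. norm (cf t - (1 - t^2 * v / 2)) \<le> A * \<bar>t\<bar>^3" using cf_near_0 by blast
  let ?B = "A * \<bar>2 * pi * of_int m\<bar>^3"
  have "((\<lambda>L::real. 1 / L^3 * L^2) \<longlongrightarrow> 0) at_top" by real_asymp
  then have "((\<lambda>L::real. ?B * (1 / L^3 * L^2)) \<longlongrightarrow> ?B * 0) at_top" by (intro tendsto_intros)
  then have d0: "((\<lambda>L::real. ?B * (1 / L^3 * L^2)) \<longlongrightarrow> 0) at_top" by simp
  have "((\<lambda>L. of_real (L^2) * (1 - cf_at L m) - of_real (2 * pi^2 * v * (of_int m)^2)) \<longlongrightarrow> 0) at_top"
  proof (rule Lim_null_comparison[OF _ d0], rule eventually_mono[OF eventually_gt_at_top[of 0]])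
    fix L :: real assume L: "L > 0"
    let ?t = "2 * pi * m / L"
    have e: "of_real (L^2) * (1 - cf_at L m) - of_real (2 * pi^2 * v * (of_int m)^2) = - of_real (L^2) * (cf ?t - of_real (1 - ?t^2 * v / 2))"
      using L by (simp add: field_simps power_divide power_mult_distrib power2_eq_square)
    have "norm (cf ?t - of_real (1 - ?t^2 * v / 2)) * L^2 \<le> (A * \<bar>?t\<bar>^3) * L^2"
      using A(2)[of ?t] by (intro mult_right_mono) auto
    also have "(A * \<bar>?t\<bar>^3) * L^2 = ?B * (1 / L^3 * L^2)" using L by (simp add: abs_divide power_divide abs_mult power_mult_distrib)
    finally show "norm (of_real (L^2) * (1 - cf_at L m) - of_real (2 * pi^2 * v * (of_int m)^2)) \<le> ?B * (1 / L^3 * L^2)"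
      unfolding e norm_mult norm_minus_cancel norm_of_real by (simp add: mult.commute)
  qed
  then show ?thesis by (rule Lim_null[THEN iffD2])
qed

definition slope_lim :: "real \<Rightarrow> complex" where
  "slope_lim u = (LINT m|Z. 1 / (1 - \<i> * u + of_real (2 * pi^2 * v * (of_int m)^2)))"

lemma circle_pt_tendsto: "((\<lambda>L. circle_pt L u) \<longlongrightarrow> 1) at_top"
proof -
  have "((\<lambda>L::real. 1 / L^2) \<longlongrightarrow> 0) at_top" by real_asymp
  then have "((\<lambda>L. of_real (1 / L^2) * (of_real (L^2) * (1 - circle_pt L u))) \<longlongrightarrow> of_real 0 * (1 - \<i> * u)) at_top"
    by (intro tendsto_mult tendsto_of_real L2_one_minus_circle_pt)
  then have "((\<lambda>L. 1 - of_real (1 / L^2) * (of_real (L^2) * (1 - circle_pt L u))) \<longlongrightarrow> 1 - of_real 0 * (1 - \<i> * u)) at_top"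
    by (rule tendsto_diff[OF tendsto_const])
  moreover have "eventually (\<lambda>L. 1 - of_real (1 / L^2) * (of_real (L^2) * (1 - circle_pt L u)) = circle_pt L u) at_top"
    using eventually_gt_at_top[of 0] by eventually_elim (simp flip: of_real_power mult.assoc)
  ultimately show ?thesis using Lim_transform_eventually by fastforce
qed

lemma cf_at_tendsto: "((\<lambda>L. cf_at L m) \<longlongrightarrow> 1) at_top"
proof -
  have "((\<lambda>L::real. 1 / L) \<longlongrightarrow> 0) at_top" by real_asymp
  then have "((\<lambda>L::real. 2 * pi * m * (1 / L)) \<longlongrightarrow> 2 * pi * m * 0) at_top" by (intro tendsto_intros)
  then have "((\<lambda>L::real. 2 * pi * m / L) \<longlongrightarrow> 0) at_top" by simp
  moreover have "isCont cf 0" using cf_cont by (simp add: continuous_on_eq_continuous_at)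
  ultimately have "((\<lambda>L. cf_at L m) \<longlongrightarrow> cf 0) at_top" by (rule isCont_tendsto_compose[rotated])
  then show ?thesis by (simp add: cf_0)
qed

lemma slope_tendsto: "((\<lambda>L. slope L u) \<longlongrightarrow> slope_lim u) at_top"
proof -
  obtain c where c: "c > 0" "\<And>L u m. L > 1 \<Longrightarrow> norm (circle_pt L u * cf_at L m / (of_real (L^2) * (1 - circle_pt L u * cf_at L m))) \<le> 1 / (1 + c * (of_int m)^2)"
    using slope_summand_bound by blast
  show ?thesis unfolding slope_def slope_lim_def
  proof (rule integral_dominated_convergence_at_top[where w="\<lambda>m. 1 / (1 + c * (of_int m)^2)"])
    show "integrable Z (\<lambda>m. 1 / (1 + c * (of_int m)^2))" by (rule integrable_int_quadratic[OF c(1)])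
    show "\<forall>\<^sub>F L in at_top. AE m in Z. norm (circle_pt L u * cf_at L m / (of_real (L^2) * (1 - circle_pt L u * cf_at L m))) \<le> 1 / (1 + c * (of_int m)^2)"
      by (rule eventually_mono[OF eventually_gt_at_top[of 1]]) (intro AE_I2 c(2))
    show "AE m in Z. ((\<lambda>L. circle_pt L u * cf_at L m / (of_real (L^2) * (1 - circle_pt L u * cf_at L m))) \<longlongrightarrow> 1 / (1 - \<i> * u + of_real (2 * pi^2 * v * (of_int m)^2))) at_top"
    proof (rule AE_I2)
      fix m :: int
      \<comment> \<open>The denominator is split as 1 - z c = (1 - z) + z (1 - c), with one known
        limit for each defect after multiplication by L^2.\<close>
      have "((\<lambda>L. of_real (L^2) * (1 - circle_pt L u) + circle_pt L u * (of_real (L^2) * (1 - cf_at L m))) \<longlongrightarrow> (1 - \<i> * u) + 1 * of_real (2 * pi^2 * v * (of_int m)^2)) at_top"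
        by (intro tendsto_add tendsto_mult L2_one_minus_circle_pt L2_one_minus_cfm circle_pt_tendsto)
      moreover have "of_real (L^2) * (1 - circle_pt L u) + circle_pt L u * (of_real (L^2) * (1 - cf_at L m)) = of_real (L^2) * (1 - circle_pt L u * cf_at L m)" for L
        by (simp add: algebra_simps)
      ultimately have l: "((\<lambda>L. of_real (L^2) * (1 - circle_pt L u * cf_at L m)) \<longlongrightarrow> 1 - \<i> * u + of_real (2 * pi^2 * v * (of_int m)^2)) at_top"
        by simp
      have "Re (1 - \<i> * u + of_real (2 * pi^2 * v * (of_int m)^2)) > 0" using v_pos by (simp add: add_pos_nonneg)
      then have nz: "1 - \<i> * u + of_real (2 * pi^2 * v * (of_int m)^2) \<noteq> 0" by (metis less_irrefl zero_complex.sel(1))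
      have "((\<lambda>L. circle_pt L u * cf_at L m / (of_real (L^2) * (1 - circle_pt L u * cf_at L m))) \<longlongrightarrow> 1 * 1 / (1 - \<i> * u + of_real (2 * pi^2 * v * (of_int m)^2))) at_top"
        by (intro tendsto_divide tendsto_mult circle_pt_tendsto cf_at_tendsto l nz)
      then show "((\<lambda>L. circle_pt L u * cf_at L m / (of_real (L^2) * (1 - circle_pt L u * cf_at L m))) \<longlongrightarrow> 1 / (1 - \<i> * u + of_real (2 * pi^2 * v * (of_int m)^2))) at_top" by simp
    qed
  qed auto
qed

lemma slope_bounded: "\<exists>B. \<forall>L>1. \<forall>u. norm (slope L u) \<le> B"
proof -
  obtain c where c: "c > 0" "\<And>L u m. L > 1 \<Longrightarrow> norm (circle_pt L u * cf_at L m / (of_real (L^2) * (1 - circle_pt L u * cf_at L m))) \<le> 1 / (1 + c * (of_int m)^2)"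
    using slope_summand_bound by blast
  have "norm (slope L u) \<le> (LINT m|Z. 1 / (1 + c * (of_int m)^2))" if "L > 1" for L u
    unfolding slope_def by (rule norm_integral_le[OF integrable_int_quadratic[OF c(1)] c(2)[OF that]])
  then show ?thesis by blast
qed

end

section \<open>The scaling limit\<close>

lemma Re_csqrt_pos: "Re w > 0 \<Longrightarrow> Re (csqrt w) > 0"
  using csqrt_principal[of w] complex_Re_le_cmod[of w]
  by (simp add: add_pos_pos)

lemma Re_csqrt_ge:
  assumes "Re w > 0"
  shows "Re (csqrt w) \<ge> sqrt (Re w)" "Re (csqrt w) \<ge> sqrt (norm w / 2)"
proof -
  have "Re w \<le> norm w" by (rule complex_Re_le_cmod)
  moreover have "Re (csqrt w) = sqrt ((norm w + Re w) / 2)" by simp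
  ultimately show "Re (csqrt w) \<ge> sqrt (Re w)" "Re (csqrt w) \<ge> sqrt (norm w / 2)"
    using assms by (auto simp del: csqrt.sel)
qed

context weighted_schwartz_density
begin

text \<open>Multiplying w + 2 pi^2 v m^2 by 2 / v gives (2 / v) w + 4 pi^2 m^2, the denominator of
  the cotangent expansion at c = \<open>rate\<close> times the square root of w. It is the constant
  sqrt 2 / sigma of the statement.\<close>

definition rate :: real where "rate = sqrt (2 / v)"

lemma rate: "rate > 0" "rate^2 = 2 / v"
  using v_pos by (auto simp: rate_def)

text \<open>The principal logarithm is harmless here because \<open>1 - exp (- rate * csqrt w)\<close> has positive real part.\<close>
definition log_limit_w :: "complex \<Rightarrow> complex" where
  "log_limit_w w = - \<theta> * (rate * (csqrt w - 1) + 2 * (Ln (1 - exp (- rate * csqrt w)) - Ln (1 - exp (- complex_of_real rate))))"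

definition log_limit :: "real \<Rightarrow> complex" where "log_limit u = log_limit_w (1 - \<i> * u)"

lemma Re_one_minus_exp: "Re c > 0 \<Longrightarrow> Re (1 - exp (- c)) > 0"
proof -
  assume "Re c > 0"
  then have "norm (exp (- c)) < 1" by simp
  then show ?thesis using complex_Re_le_cmod[of "exp (- c)"]
    unfolding minus_complex.sel one_complex.sel by linarith
qed

lemma slope_lim_eq:
  fixes u :: real and c :: complex
  defines "c \<equiv> rate * csqrt (1 - \<i> * u)"
  shows "slope_lim u = 1 / (v * c) * ((1 + exp (- c)) / (1 - exp (- c)))"
proof -
  have r: "Re (csqrt (1 - \<i> * u)) > 0" by (rule Re_csqrt_pos) simp
  then have c: "Re c > 0" using rate by (simp add: c_def)
  then have c0: "c \<noteq> 0" by auto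
  have c2: "c^2 = of_real (2 / v) * (1 - \<i> * u)"
    unfolding c_def power_mult_distrib rate(2)[symmetric] by simp
  have rc2: "Re (c^2) > 0" unfolding c2 using v_pos by simp
  have "slope_lim u = (LINT m|Z. of_real (2 / v) * (1 / (c^2 + of_real (4 * pi^2 * (of_int m)^2))))"
    unfolding slope_lim_def
  proof (rule Bochner_Integration.integral_cong[OF refl])
    fix m :: int
    have eq: "c^2 + of_real (4 * pi^2 * (of_int m)^2) = of_real (2 / v) * (1 - \<i> * u + of_real (2 * pi^2 * v * (of_int m)^2))"
      unfolding c2 using v_pos by (simp add: distrib_left)
    have gen: "1 / X = K * (1 / (K * X))" if "K \<noteq> 0" for K X :: complex using that by simp
    have nz: "complex_of_real (2 / v) \<noteq> 0" using v_pos by simp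
    show "1 / (1 - \<i> * u + of_real (2 * pi^2 * v * (of_int m)^2)) = of_real (2 / v) * (1 / (c^2 + of_real (4 * pi^2 * (of_int m)^2)))"
      unfolding eq by (rule gen[OF nz])
  qed
  also have "\<dots> = of_real (2 / v) * (LINT m|Z. 1 / (c^2 + of_real (4 * pi^2 * (of_int m)^2)))"
    by (rule integral_mult_right_zero)
  also have "\<dots> = 1 / (v * c) * (2 * c * (LINT m|Z. 1 / (c^2 + of_real (4 * pi^2 * (of_int m)^2))))"
    using c0 v_pos by simp
  also have "\<dots> = 1 / (v * c) * ((1 + exp (- c)) / (1 - exp (- c)))"
    unfolding coth_partial_fractions(2)[OF c rc2] ..
  finally show ?thesis .
qed

text \<open>With c = \<open>rate\<close> sqrt w, the expression c + 2 log(1 - exp(-c)) is 2 log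
  sinh(c/2) up to an additive constant, and its derivative in c is coth(c/2).\<close>

lemma log_limit_deriv: "(log_limit has_vector_derivative (\<theta> * \<i> * slope_lim u)) (at u)"
proof -
  let ?w = "1 - \<i> * complex_of_real u"
  define s where "s = csqrt ?w"
  define c where "c = rate * s"
  have r: "Re s > 0" unfolding s_def by (rule Re_csqrt_pos) simp
  then have c: "Re c > 0" using rate by (simp add: c_def)
  then have c0: "c \<noteq> 0" and s0: "s \<noteq> 0" using r by auto
  have w: "?w \<notin> \<real>\<^sub>\<le>\<^sub>0" by (auto simp: complex_nonpos_Reals_iff)
  have "Re (1 - exp (- c)) > 0" by (rule Re_one_minus_exp[OF c])
  then have l: "1 - exp (- c) \<notin> \<real>\<^sub>\<le>\<^sub>0" and l0: "1 - exp (- c) \<noteq> 0" by (auto simp: complex_nonpos_Reals_iff)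
  have ds: "(csqrt has_field_derivative (inverse (2 * s))) (at ?w)"
    unfolding s_def using w by (rule has_field_derivative_csqrt)
  have "((\<lambda>w. 1 - exp (- rate * csqrt w)) has_field_derivative (exp (- c) * (rate * inverse (2 * s)))) (at ?w)"
    by (rule derivative_eq_intros ds refl | simp add: c_def s_def)+
  from DERIV_chain2[OF has_field_derivative_Ln this] l
  have dl: "((\<lambda>w. Ln (1 - exp (- rate * csqrt w))) has_field_derivative (inverse (1 - exp (- c)) * (exp (- c) * (rate * inverse (2 * s))))) (at ?w)"
    by (simp add: c_def s_def)
  have dL: "(log_limit_w has_field_derivative (- \<theta> * (rate * inverse (2 * s) + 2 * (inverse (1 - exp (- c)) * (exp (- c) * (rate * inverse (2 * s))))))) (at ?w)"
    unfolding log_limit_w_def[abs_def] by (rule derivative_eq_intros ds dl refl | simp)+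
  have "((\<lambda>u. 1 - \<i> * u) has_field_derivative (- \<i>)) (at (complex_of_real u))"
    by (auto intro!: derivative_eq_intros)
  from DERIV_chain2[OF dL this]
  have "((\<lambda>u. log_limit_w (1 - \<i> * u)) has_field_derivative (- \<theta> * (rate * inverse (2 * s) + 2 * (inverse (1 - exp (- c)) * (exp (- c) * (rate * inverse (2 * s))))) * - \<i>)) (at (complex_of_real u))" .
  also have "- \<theta> * (rate * inverse (2 * s) + 2 * (inverse (1 - exp (- c)) * (exp (- c) * (rate * inverse (2 * s))))) * - \<i> = \<theta> * \<i> * slope_lim u"
  proof -
    have "rate * inverse (2 * s) = 1 / (v * c)"
    proof -
      have "complex_of_real rate * rate = of_real (2 / v)" unfolding rate(2)[symmetric] by (simp add: power2_eq_square)
      then show ?thesis using s0 rate v_pos unfolding c_def by (simp add: field_simps)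
    qed
    moreover have "K + 2 * (inverse (1 - E) * (E * K)) = K * ((1 + E) / (1 - E))" if "1 - E \<noteq> 0" for K E :: complex
      using that by (simp add: field_simps)
    from this[OF l0, of "rate * inverse (2 * s)"]
    have "rate * inverse (2 * s) + 2 * (inverse (1 - exp (- c)) * (exp (- c) * (rate * inverse (2 * s)))) = rate * inverse (2 * s) * ((1 + exp (- c)) / (1 - exp (- c)))" .
    ultimately have "rate * inverse (2 * s) + 2 * (inverse (1 - exp (- c)) * (exp (- c) * (rate * inverse (2 * s)))) = slope_lim u"
      unfolding slope_lim_eq c_def[unfolded s_def, symmetric] by (simp only:)
    then show ?thesis by simp
  qed
  finally have "((\<lambda>u. log_limit_w (1 - \<i> * u)) has_field_derivative \<theta> * \<i> * slope_lim u) (at (complex_of_real u))" .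
  from has_vector_derivative_real_field[OF this] show ?thesis by (simp add: log_limit_def[abs_def])
qed

lemma log_limit_0: "log_limit 0 = 0"
  by (simp add: log_limit_def log_limit_w_def)

lemma slope_lim_cont: "continuous_on UNIV slope_lim"
proof -
  have "isCont slope_lim u" for u
  proof -
    define s where "s = (\<lambda>u. csqrt (1 - \<i> * complex_of_real u))"
    have r: "Re (s u) > 0" for u unfolding s_def by (rule Re_csqrt_pos) simp
    have c: "Re (rate * s u) > 0" for u using rate r by simp
    then have n1: "rate * s u \<noteq> 0" for u by (metis less_irrefl zero_complex.sel(1))
    have n2: "1 - exp (- (rate * s u)) \<noteq> 0" for u
      using Re_one_minus_exp[OF c[of u]] by (metis less_irrefl zero_complex.sel(1))
    have "isCont csqrt (1 - \<i> * complex_of_real u)"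
      by (rule continuous_at_csqrt) (auto simp: complex_nonpos_Reals_iff)
    then have "isCont s u" unfolding s_def
      by (rule isCont_o2[where g=csqrt, rotated]) (intro continuous_intros)
    then have "isCont (\<lambda>u. 1 / (v * (rate * s u)) * ((1 + exp (- (rate * s u))) / (1 - exp (- (rate * s u))))) u"
      using n1 n2 v_pos by (intro continuous_intros) auto
    then show ?thesis by (simp add: slope_lim_eq[abs_def] s_def)
  qed
  then show ?thesis by (simp add: continuous_on_eq_continuous_at)
qed

text \<open>Rescaling the path from 0 to \<open>u\<close> onto [0, 1] treats both signs of
  \<open>u\<close> together.\<close>

lemma FTC_scaled:
  fixes F f :: "real \<Rightarrow> complex"
  assumes "\<And>u. (F has_vector_derivative f u) (at u)" "continuous_on UNIV f"
  shows "F u - F 0 = (LINT s|lborel. indicator {0..1} s *\<^sub>R (u *\<^sub>R f (u * s)))"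
proof -
  have "(LINT s|lborel. indicator {0..1} s *\<^sub>R (u *\<^sub>R f (u * s))) = F (u * 1) - F (u * 0)"
  proof (rule integral_FTC_atLeastAtMost)
    fix s :: real
    have "((\<lambda>s. u * s) has_vector_derivative u) (at s within {0..1})"
      by (auto intro!: derivative_eq_intros simp flip: has_real_derivative_iff_has_vector_derivative)
    from vector_diff_chain_within[OF this has_vector_derivative_at_within[OF assms(1)]]
    show "((\<lambda>s. F (u * s)) has_vector_derivative u *\<^sub>R f (u * s)) (at s within {0..1})" by (simp add: o_def)
    show "continuous_on {0..1} (\<lambda>s. u *\<^sub>R f (u * s))"
      by (intro continuous_intros continuous_on_compose2[OF assms(2)]) auto
  qed simp
  then show ?thesis by simp
qed

lemma log_ratio_tendsto: "((\<lambda>L. log_ratio L u) \<longlongrightarrow> log_limit u) at_top"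
proof -
  obtain B where B: "\<And>L u. L > 1 \<Longrightarrow> norm (slope L u) \<le> B" using slope_bounded by blast
  have log_ratio: "log_ratio L u = (LINT s|lborel. indicator {0..1} s *\<^sub>R (u *\<^sub>R (\<theta> * \<i> * slope L (u * s))))" if "L > 1" for L
  proof -
    have "continuous_on UNIV (\<lambda>u. \<theta> * \<i> * slope L u)" by (intro continuous_intros slope_cont[OF that])
    from FTC_scaled[OF log_ratio_deriv[OF that] this, of u] show ?thesis by (simp add: log_ratio_def)
  qed
  have Lm: "log_limit u = (LINT s|lborel. indicator {0..1} s *\<^sub>R (u *\<^sub>R (\<theta> * \<i> * slope_lim (u * s))))"
  proof -
    have "continuous_on UNIV (\<lambda>u. \<theta> * \<i> * slope_lim u)" by (intro continuous_intros slope_lim_cont)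
    from FTC_scaled[OF log_limit_deriv this, of u] show ?thesis by (simp add: log_limit_0)
  qed
  have hm: "slope_lim \<in> borel_measurable borel" using slope_lim_cont by (rule borel_measurable_continuous_onI)
  have hhm: "slope L \<in> borel_measurable borel" if "L > 1" for L using slope_cont[OF that] by (rule borel_measurable_continuous_onI)
  \<comment> \<open>Replacing L by max L 2 makes the integrand measurable for every L, as dominated
    convergence asks; it changes nothing for large L.\<close>
  have "((\<lambda>L. LINT s|lborel. indicator {0..1} s *\<^sub>R (u *\<^sub>R (\<theta> * \<i> * slope (max L 2) (u * s)))) \<longlongrightarrow>
      (LINT s|lborel. indicator {0..1} s *\<^sub>R (u *\<^sub>R (\<theta> * \<i> * slope_lim (u * s))))) at_top"
  proof (rule integral_dominated_convergence_at_top[where w="\<lambda>s. indicator {0..1} s *\<^sub>R (\<bar>u\<bar> * (\<theta> * B))"])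
    show "(\<lambda>s. indicator {0..1} s *\<^sub>R (u *\<^sub>R (\<theta> * \<i> * slope_lim (u * s)))) \<in> borel_measurable lborel"
      using hm by measurable
    show "(\<lambda>s. indicator {0..1} s *\<^sub>R (u *\<^sub>R (\<theta> * \<i> * slope (max L 2) (u * s)))) \<in> borel_measurable lborel" for L
      using hhm[of "max L 2"] by measurable
    show "integrable lborel (\<lambda>s::real. indicator {0..1} s *\<^sub>R (\<bar>u\<bar> * (\<theta> * B)))" by simp
    show "AE s in lborel. ((\<lambda>L. indicator {0..1} s *\<^sub>R (u *\<^sub>R (\<theta> * \<i> * slope (max L 2) (u * s)))) \<longlongrightarrow> indicator {0..1} s *\<^sub>R (u *\<^sub>R (\<theta> * \<i> * slope_lim (u * s)))) at_top"
    proof (intro AE_I2 tendsto_scaleR tendsto_mult tendsto_const)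
      fix s
      have "eventually (\<lambda>L. slope L (u * s) = slope (max L 2) (u * s)) at_top"
        using eventually_gt_at_top[of 2] by eventually_elim simp
      from Lim_transform_eventually[OF slope_tendsto this]
      show "((\<lambda>L. slope (max L 2) (u * s)) \<longlongrightarrow> slope_lim (u * s)) at_top" .
    qed
    show "\<forall>\<^sub>F L in at_top. AE s in lborel. norm (indicator {0..1} s *\<^sub>R (u *\<^sub>R (\<theta> * \<i> * slope (max L 2) (u * s)))) \<le> indicator {0..1} s *\<^sub>R (\<bar>u\<bar> * (\<theta> * B))"
      using B \<theta>_pos by (intro always_eventually allI AE_I2) (auto simp: norm_mult indicator_def intro!: mult_left_mono)
  qed
  moreover have "eventually (\<lambda>L. (LINT s|lborel. indicator {0..1} s *\<^sub>R (u *\<^sub>R (\<theta> * \<i> * slope (max L 2) (u * s)))) = log_ratio L u) at_top"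
    using eventually_gt_at_top[of 2] by eventually_elim (simp add: log_ratio max_def)
  ultimately show ?thesis unfolding Lm by (rule Lim_transform_eventually)
qed

end

section \<open>Decay along the circle\<close>

text \<open>Multiplication by 2 sin(t/2) telescopes the sum to a difference of two sines, and
  Jordan's inequality bounds sin(t/2) below by t / pi.\<close>

lemma sum_cos_bound:
  assumes t: "0 < t" "t \<le> pi" and MK: "M \<le> K"
  shows "\<bar>\<Sum>n=M..<K. cos (real n * t)\<bar> \<le> pi / t"
proof -
  let ?f = "\<lambda>n. sin ((real n - 1/2) * t)"
  have s: "t / pi \<le> sin (t / 2)" using jordan_sine[of "t / 2"] t by simp
  have s0: "0 < t / pi" using t by simp
  have "2 * sin (t / 2) * (\<Sum>n=M..<K. cos (real n * t)) = (\<Sum>n=M..<K. ?f (Suc n) - ?f n)"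
    unfolding sum_distrib_left
  proof (rule sum.cong[OF refl])
    fix n
    have "?f (Suc n) = sin (real n * t + t / 2)" "?f n = sin (real n * t - t / 2)" by (simp_all add: algebra_simps)
    then show "2 * sin (t / 2) * cos (real n * t) = ?f (Suc n) - ?f n"
      by (simp add: sin_add sin_diff)
  qed
  also have "\<dots> = ?f K - ?f M" by (rule sum_Suc_diff'[OF MK])
  finally have e: "2 * sin (t / 2) * (\<Sum>n=M..<K. cos (real n * t)) = ?f K - ?f M" .
  have "\<bar>?f K - ?f M\<bar> \<le> 2"
    using abs_sin_le_one[of "(real K - 1/2) * t"] abs_sin_le_one[of "(real M - 1/2) * t"] by linarith
  then have "2 * sin (t / 2) * \<bar>\<Sum>n=M..<K. cos (real n * t)\<bar> \<le> 2"
  proof -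
    have "sin (t / 2) > 0" using s s0 by linarith
    then have "2 * sin (t / 2) * \<bar>\<Sum>n=M..<K. cos (real n * t)\<bar> = \<bar>2 * sin (t / 2) * (\<Sum>n=M..<K. cos (real n * t))\<bar>"
      by (simp add: abs_mult)
    then show ?thesis using \<open>\<bar>?f K - ?f M\<bar> \<le> 2\<close> unfolding e by linarith
  qed
  then have "sin (t / 2) * \<bar>\<Sum>n=M..<K. cos (real n * t)\<bar> \<le> 1" by simp
  moreover have "t / pi * \<bar>\<Sum>n=M..<K. cos (real n * t)\<bar> \<le> sin (t / 2) * \<bar>\<Sum>n=M..<K. cos (real n * t)\<bar>"
    using mult_right_mono[OF s, of "\<bar>\<Sum>n=M..<K. cos (real n * t)\<bar>"] by simp
  ultimately have "t / pi * \<bar>\<Sum>n=M..<K. cos (real n * t)\<bar> \<le> 1" by linarith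
  then have "t * \<bar>\<Sum>n=M..<K. cos (real n * t)\<bar> \<le> pi" by (simp add: divide_le_eq)
  then show ?thesis using t by (simp add: le_divide_eq mult.commute)
qed

text \<open>The fourth Taylor term of the exponential, x^4 / 24, is already quadratic in u when x is
  a multiple of sqrt |u|.\<close>

lemma exp_neg_sqrt_bound:
  assumes k: "k > 0"
  shows "exp (- (k * sqrt \<bar>u\<bar>)) \<le> (1 + 24 / k^4) / (1 + u^2)"
proof -
  define x where "x = k * sqrt \<bar>u\<bar>"
  have x: "x \<ge> 0" using k by (simp add: x_def)
  have x4: "x^4 = k^4 * u^2"
  proof -
    have "x^2 = k^2 * \<bar>u\<bar>" by (simp add: x_def power_mult_distrib)
    then have "(x^2)^2 = (k^2 * \<bar>u\<bar>)^2" by simp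
    then show ?thesis by (simp add: power_mult_distrib flip: power_mult)
  qed
  have "x^4 / fact 4 \<le> exp x"
  proof -
    have "summable (\<lambda>n. x^n /\<^sub>R fact n)" by (rule summable_exp_generic)
    then have "(\<Sum>n\<in>{4}. x^n /\<^sub>R fact n) \<le> (\<Sum>n. x^n /\<^sub>R fact n)"
      using x by (intro sum_le_suminf) auto
    then show ?thesis by (simp add: exp_def divide_inverse mult.commute)
  qed
  then have "k^4 * u^2 \<le> 24 * exp x" by (simp add: x4 fact_numeral)
  then have "u^2 \<le> 24 / k^4 * exp x" using k by (simp add: field_simps)
  moreover have "1 \<le> exp x" using x by simp
  ultimately have "1 + u^2 \<le> (1 + 24 / k^4) * exp x" unfolding distrib_right mult_1_left by linarith
  then have "(1 + u^2) * exp (- x) \<le> (1 + 24 / k^4) * exp x * exp (- x)" by (rule mult_right_mono) simp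
  also have "\<dots> = 1 + 24 / k^4" by (simp add: mult.assoc flip: exp_add)
  finally show ?thesis unfolding x_def by (simp add: pos_le_divide_eq add_pos_nonneg mult.commute)
qed

context weighted_schwartz_density
begin

text \<open>The full series has only terms with nonnegative weights and factors 1 - cos, so any
  finite subset of it gives a bound. The window is chosen later; the empty set gives Re <= 0 for
  small |u|.\<close>

lemma Re_log_ratio:
  assumes L: "L > 1" and S: "finite S" "0 \<notin> S"
  shows "Re (log_ratio L u) \<le> - (\<Sum>n\<in>S. W \<theta> \<phi> L n / real n * (1 - 1 / L^2) ^ n * (1 - cos (real n * (u / L^2))))"
proof -
  define r where "r = 1 - 1 / L^2"
  define a where "a n = (if n = 0 then 0 else W \<theta> \<phi> L n / real n) * r ^ n * (1 - cos (real n * (u / L^2)))" for n :: nat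
  have r: "r > 0"
  proof -
    have "L^2 > 1" using L by (simp add: power2_eq_square less_1_mult)
    then have "1 / L^2 < 1" by (subst divide_less_eq_1_pos) linarith+
    then show ?thesis by (simp add: r_def)
  qed
  have L0: "L > 0" using L by simp
  have s: "summable (\<lambda>n. G_coeff L n * circle_pt L u ^ n)" for u
    using G_coeff_summable[OF L0 norm_circle_pt_less[OF L, of u]] by (rule summable_norm_cancel)
  have t: "Re (G_coeff L n * circle_pt L 0 ^ n - G_coeff L n * circle_pt L u ^ n) = a n" for n
  proof -
    have "circle_pt L u ^ n = of_real (r ^ n) * iexp (real n * (u / L^2))" for u
      by (simp add: circle_pt_def r_def power_mult_distrib exp_of_nat_mult[symmetric] mult_ac)
    then have "G_coeff L n * circle_pt L 0 ^ n - G_coeff L n * circle_pt L u ^ n = of_real ((if n = 0 then 0 else W \<theta> \<phi> L n / real n) * r ^ n) * (1 - iexp (real n * (u / L^2)))"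
      unfolding G_coeff_def by (simp add: algebra_simps)
    then show ?thesis by (simp only: a_def) (simp add: Re_exp)
  qed
  have d: "(\<lambda>n. G_coeff L n * circle_pt L 0 ^ n - G_coeff L n * circle_pt L u ^ n) sums (- log_ratio L u)"
    using sums_diff[OF summable_sums[OF s[of 0]] summable_sums[OF s[of u]]] by (simp add: log_ratio_def G_complex_def)
  then have "(\<lambda>n. Re (G_coeff L n * circle_pt L 0 ^ n - G_coeff L n * circle_pt L u ^ n)) sums Re (- log_ratio L u)"
    by (rule sums_Re)
  then have a: "a sums - Re (log_ratio L u)" by (simp only: t) simp
  have a0: "a n \<ge> 0" for n
    using W_lower(2)[OF L0, of n] r by (cases "n = 0") (auto simp: a_def)
  have "sum a S \<le> suminf a" using a S a0 by (intro sum_le_suminf) (auto simp: sums_iff)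
  also have "suminf a = - Re (log_ratio L u)" using a by (simp add: sums_iff)
  also have "sum a S = (\<Sum>n\<in>S. W \<theta> \<phi> L n / real n * (1 - 1 / L^2) ^ n * (1 - cos (real n * (u / L^2))))"
    using S(2) by (intro sum.cong) (auto simp: a_def r_def)
  finally show ?thesis by simp
qed

text \<open>For \<open>|u| \<le> pi * L^2\<close> put \<open>t = |u| / L^2\<close>; the terms with index between \<open>M\<close> and \<open>2 * M\<close>,
  \<open>M\<close> of order \<open>1 / t\<close>, already contribute a multiple of \<open>L * sqrt t = sqrt |u|\<close>.\<close>
lemma Re_log_ratio_window:
  "\<exists>k>0. \<exists>u0\<ge>0. \<forall>L>1. \<forall>u. u0 \<le> \<bar>u\<bar> \<longrightarrow> \<bar>u\<bar> \<le> pi * L^2 \<longrightarrow> Re (log_ratio L u) \<le> - (k * sqrt \<bar>u\<bar>)"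
proof -
  obtain c j0 where c: "c > 0" and j0: "j0 > 0" and low: "\<And>j. j \<ge> j0 \<Longrightarrow> conv_pow \<phi> j 0 \<ge> c / sqrt (real j)"
    using conv_pow_at_0_lower by blast
  \<comment> \<open>Since t <= pi, the estimate M <= 2 pi / t + 1 + j0 becomes M <= C / t.\<close>
  define C where "C = 2 * pi + pi * (1 + real j0)"
  have C: "C > 0" unfolding C_def using j0 by (intro add_pos_pos mult_pos_pos) auto
  \<comment> \<open>The value of m M / 2 computed below, after replacing 1 / sqrt M by its lower
    bound sqrt t / sqrt C.\<close>
  define k where "k = \<theta> * c / (8 * sqrt 2 * sqrt C)"
  have k: "k > 0" using \<theta>_pos c C by (simp add: k_def)
  \<comment> \<open>The threshold 4 C gives 2 M <= L^2 / 2, so by Bernoulli the damping (1 -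
    1/L^2)^n is at least 1/2 throughout the window.\<close>
  have "Re (log_ratio L u) \<le> - (k * sqrt \<bar>u\<bar>)" if L: "L > 1" and u: "4 * C \<le> \<bar>u\<bar>" "\<bar>u\<bar> \<le> pi * L^2" for L u
  proof -
    define t where "t = \<bar>u\<bar> / L^2"
    have L0: "L > 0" "L^2 > 0" using L by auto
    have t: "0 < t" "t \<le> pi" using u C L0 by (auto simp: t_def field_simps)
    \<comment> \<open>At least 2 pi / t, so that the cosines over the window sum to at most M / 2;
      at least \<open>j0\<close>, so that the local lower bound holds there.\<close>
    define M where "M = nat \<lceil>2 * pi / t\<rceil> + j0"
    have M1: "2 * pi / t \<le> real M" unfolding M_def by linarith
    have M0: "M > 0" "M \<ge> j0" using j0 by (auto simp: M_def)
    have "real M \<le> 2 * pi / t + 1 + real j0"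
      unfolding M_def using t by simp
    also have "\<dots> = (2 * pi + t * (1 + real j0)) / t" using t by (simp add: field_simps)
    also have "\<dots> \<le> C / t" using t unfolding C_def by (intro divide_right_mono add_left_mono mult_right_mono) auto
    finally have M2: "real M \<le> C / t" .
    have CL: "4 * (C / t) \<le> L^2" using u L0 t by (simp add: t_def field_simps)
    then have M3: "2 * real M \<le> L^2 / 2" using M2 by simp
    \<comment> \<open>A common lower bound for the coefficients in the window: n < 2 M in the two
      denominators, and the final 1/2 for the damping.\<close>
    define m where "m = \<theta> * L * c / (2 * real M * sqrt (2 * real M)) * (1 / 2)"
    have m0: "m \<ge> 0" using \<theta>_pos L c by (simp add: m_def)
    have tm: "m * (1 - cos (real n * t)) \<le> W \<theta> \<phi> L n / real n * (1 - 1 / L^2) ^ n * (1 - cos (real n * (u / L^2)))"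
      if n: "n \<in> {M..<2*M}" for n
    proof -
      have n0: "n > 0" "n \<ge> j0" and n2: "real n \<le> 2 * real M" using n M0 by auto
      have "real n * t = \<bar>real n * (u / L^2)\<bar>" by (simp add: t_def abs_mult)
      then have cs: "cos (real n * t) = cos (real n * (u / L^2))" by (metis cos_abs_real)
      have "\<theta> * L * (c / sqrt (2 * real M)) \<le> \<theta> * L * (c / sqrt (real n))"
        using n0 n2 \<theta>_pos L c by (intro mult_left_mono divide_left_mono) auto
      also have "\<dots> \<le> \<theta> * L * conv_pow \<phi> n 0" using low[OF n0(2)] \<theta>_pos L by (intro mult_left_mono) auto
      also have "\<dots> \<le> W \<theta> \<phi> L n" using W_lower(1)[OF L0(1) n0(1)] .
      finally have w: "\<theta> * L * (c / sqrt (2 * real M)) \<le> W \<theta> \<phi> L n" .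
      have w1: "\<theta> * L * (c / sqrt (2 * real M)) / (2 * real M) \<le> W \<theta> \<phi> L n / real n"
        using w n0 n2 \<theta>_pos L c M0 W_lower(2)[OF L0(1) n0(1)] by (intro frac_le) auto
      have "1 + real n * (- (1 / L^2)) \<le> (1 + - (1 / L^2)) ^ n"
      proof (rule Bernoulli_inequality)
        have "1 / L^2 \<le> 1" using L by (simp add: divide_le_eq power2_eq_square less_1_mult order.strict_implies_order)
        then show "- 1 \<le> - (1 / L^2)" by simp
      qed
      moreover have "real n * (1 / L^2) \<le> 1 / 2"
      proof -
        have "real n \<le> L^2 / 2" using n2 M3 by linarith
        then show ?thesis using L0 by (simp add: field_simps)
      qed
      ultimately have r: "1 / 2 \<le> (1 - 1 / L^2) ^ n" by simp
      have "m \<le> W \<theta> \<phi> L n / real n * (1 - 1 / L^2) ^ n"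
      proof -
        have "m = \<theta> * L * (c / sqrt (2 * real M)) / (2 * real M) * (1 / 2)" by (simp add: m_def)
        also have "\<dots> \<le> W \<theta> \<phi> L n / real n * (1 - 1 / L^2) ^ n"
          using w1 r \<theta>_pos L c W_lower(2)[OF L0(1) n0(1)] by (intro mult_mono) auto
        finally show ?thesis .
      qed
      then show ?thesis unfolding cs by (intro mult_right_mono) auto
    qed
    have "real M / 2 \<le> (\<Sum>n=M..<2*M. 1 - cos (real n * t))"
    proof -
      have "2 * pi / t = 2 * (pi / t)" by simp
      then have "pi / t \<le> real M / 2" using M1 by linarith
      moreover have "\<bar>\<Sum>n=M..<2*M. cos (real n * t)\<bar> \<le> pi / t" using t by (intro sum_cos_bound) auto
      ultimately have "(\<Sum>n=M..<2*M. cos (real n * t)) \<le> real M / 2" by linarith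
      then show ?thesis by (simp add: sum_subtractf)
    qed
    then have "m * (real M / 2) \<le> m * (\<Sum>n=M..<2*M. 1 - cos (real n * t))" using m0 by (rule mult_left_mono)
    also have "\<dots> = (\<Sum>n=M..<2*M. m * (1 - cos (real n * t)))" by (rule sum_distrib_left)
    also have "\<dots> \<le> (\<Sum>n=M..<2*M. W \<theta> \<phi> L n / real n * (1 - 1 / L^2) ^ n * (1 - cos (real n * (u / L^2))))"
      by (rule sum_mono[OF tm])
    also have "\<dots> \<le> - Re (log_ratio L u)" using Re_log_ratio[OF L, of "{M..<2*M}" u] M0 by simp
    finally have A: "m * (real M / 2) \<le> - Re (log_ratio L u)" .
    have "k * sqrt \<bar>u\<bar> \<le> m * (real M / 2)"
    proof -
      have su: "sqrt \<bar>u\<bar> = L * sqrt t" using L0 by (simp add: t_def real_sqrt_divide)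
      have "sqrt (real M) \<le> sqrt (C / t)" using M2 by simp
      then have "sqrt (real M) * sqrt t \<le> sqrt C" using t by (simp add: real_sqrt_divide field_simps)
      then have st: "sqrt t / sqrt C \<le> 1 / sqrt (real M)" using M0 C by (simp add: field_simps)
      have "k * sqrt \<bar>u\<bar> = \<theta> * c * L / (8 * sqrt 2) * (sqrt t / sqrt C)" by (simp add: k_def su)
      also have "\<dots> \<le> \<theta> * c * L / (8 * sqrt 2) * (1 / sqrt (real M))"
        using st \<theta>_pos c L by (intro mult_left_mono) auto
      also have "\<dots> = m * (real M / 2)" using M0 by (simp add: m_def real_sqrt_mult field_simps)
      finally show ?thesis .
    qed
    then show ?thesis using A by linarith
  qed
  then show ?thesis using k C by (intro exI[of _ k] conjI exI[of _ "4 * C"]) auto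
qed

text \<open>The restriction |u| <= pi L^2 is one full turn of the circle. The bound is independent
  of L, which makes it the majorant for the limit of the Cauchy integrals.\<close>

lemma exp_log_ratio_bound: "\<exists>B\<ge>0. \<forall>L>1. \<forall>u. \<bar>u\<bar> \<le> pi * L^2 \<longrightarrow> norm (exp (log_ratio L u)) \<le> B / (1 + u^2)"
proof -
  obtain k u0 where k: "k > 0" and u0: "u0 \<ge> 0"
    and b: "\<And>L u. L > 1 \<Longrightarrow> u0 \<le> \<bar>u\<bar> \<Longrightarrow> \<bar>u\<bar> \<le> pi * L^2 \<Longrightarrow> Re (log_ratio L u) \<le> - (k * sqrt \<bar>u\<bar>)"
    using Re_log_ratio_window by blast
  \<comment> \<open>The first entry serves |u| < u0, where the norm is merely at most 1; the second
    is the constant of \<open>exp_neg_sqrt_bound\<close>.\<close>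
  define B where "B = max (1 + u0^2) (1 + 24 / k^4)"
  have "norm (exp (log_ratio L u)) \<le> B / (1 + u^2)" if L: "L > 1" and u: "\<bar>u\<bar> \<le> pi * L^2" for L u
  proof (cases "u0 \<le> \<bar>u\<bar>")
    case True
    have "norm (exp (log_ratio L u)) \<le> exp (- (k * sqrt \<bar>u\<bar>))" using b[OF L True u] by simp
    also have "\<dots> \<le> (1 + 24 / k^4) / (1 + u^2)" by (rule exp_neg_sqrt_bound[OF k])
    also have "\<dots> \<le> B / (1 + u^2)" by (intro divide_right_mono) (auto simp: B_def)
    finally show ?thesis .
  next
    case False
    have "Re (log_ratio L u) \<le> 0" using Re_log_ratio[OF L, of "{}" u] by simp
    then have "norm (exp (log_ratio L u)) \<le> 1" by simp
    also have "1 \<le> B / (1 + u^2)"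
    proof -
      have "\<bar>u\<bar>^2 \<le> u0^2" using False by (intro power_mono) auto
      then have "1 + u^2 \<le> B" by (simp add: B_def)
      then show ?thesis by (simp add: le_divide_eq add_pos_nonneg)
    qed
    finally show ?thesis .
  qed
  moreover have "B \<ge> 0" by (simp add: B_def le_max_iff_disj)
  ultimately show ?thesis by blast
qed

text \<open>Inherited from the approximants: for fixed \<open>u\<close> the constraint |u| <= pi L^2
  holds once L is large.\<close>

lemma exp_log_limit_bound: "\<exists>B\<ge>0. \<forall>u. norm (exp (log_limit u)) \<le> B / (1 + u^2)"
proof -
  obtain B where B: "B \<ge> 0" "\<And>L u. L > 1 \<Longrightarrow> \<bar>u\<bar> \<le> pi * L^2 \<Longrightarrow> norm (exp (log_ratio L u)) \<le> B / (1 + u^2)"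
    using exp_log_ratio_bound by blast
  have "norm (exp (log_limit u)) \<le> B / (1 + u^2)" for u
  proof (rule tendsto_upperbound)
    show "((\<lambda>L. norm (exp (log_ratio L u))) \<longlongrightarrow> norm (exp (log_limit u))) at_top"
      by (intro tendsto_norm tendsto_exp log_ratio_tendsto)
    have "filterlim (\<lambda>L::real. pi * L^2) at_top at_top" by real_asymp
    then have "eventually (\<lambda>L. \<bar>u\<bar> \<le> pi * L^2) at_top" by (simp add: filterlim_at_top)
    then show "eventually (\<lambda>L. norm (exp (log_ratio L u)) \<le> B / (1 + u^2)) at_top"
      using eventually_gt_at_top[of 1] by eventually_elim (rule B(2))
  qed simp
  then show ?thesis using B(1) by blast
qed

end

section \<open>Coefficient extraction\<close>

context weighted_schwartz_density
begin

text \<open>\<open>H\<close> is defined with real formal power series, Cauchy's formula concerns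
  complex ones; the embedding commutes with products coefficient by coefficient.\<close>

lemma H_eq_fps:
  "fps_nth (fps_exp 1 oo Abs_fps (G_coeff L)) n = of_real (H \<theta> \<phi> L n)"
proof -
  let ?g = "G_fps \<theta> \<phi> L" and ?G = "Abs_fps (G_coeff L)"
  have pw: "fps_nth (?G ^ i) n = of_real (fps_nth (?g ^ i) n)" for i n
  proof (induction i arbitrary: n)
    case (Suc i)
    have "fps_nth ?G n = of_real (fps_nth ?g n)" for n by (simp add: G_fps_def G_coeff_def)
    then show ?case using Suc by (simp add: fps_mult_nth)
  qed simp
  show ?thesis unfolding H_def fps_compose_nth pw by simp
qed

lemma exp_Gc_deriv:
  assumes L: "L > 0"
  shows "(deriv ^^ n) (\<lambda>z. exp (G_complex L z)) 0 = fact n * of_real (H \<theta> \<phi> L n)"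
proof -
  let ?G = "Abs_fps (G_coeff L)"
  have "fps_conv_radius ?G \<ge> 1"
    unfolding fps_conv_radius_def
  proof (rule conv_radius_geI_ex')
    fix r :: real assume "0 < r" "ereal r < 1"
    then show "summable (\<lambda>n. fps_nth ?G n * of_real r ^ n)"
      using G_coeff_summable[OF L, of "of_real r"] by (auto dest: summable_norm_cancel)
  qed
  then have "fps_conv_radius ?G > 0" by (rule less_le_trans[rotated]) simp
  then have "G_complex L has_fps_expansion ?G"
    by (simp add: has_fps_expansion_def eval_fps_def G_complex_def)
  then have "(exp \<circ> G_complex L) has_fps_expansion (fps_exp 1 oo ?G)"
    by (intro has_fps_expansion_compose has_fps_expansion_exp1) (simp_all add: G_coeff_def)
  from fps_nth_fps_expansion[OF this, of n] show ?thesis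
    unfolding H_eq_fps by (simp add: o_def field_simps)
qed

text \<open>Cauchy's formula on the circle, moved from [0, 2 pi] to the symmetric period so that the
  dominant point, angle 0, is interior, and then stretched by L^2. Dividing by the value at angle 0
  produces \<open>log_ratio\<close>.\<close>

lemma H_Cauchy:
  assumes L: "L > 1"
  shows "(LINT u|lborel. indicator {-(pi * L^2)..pi * L^2} u *\<^sub>R (exp (log_ratio L u) * iexp (- (real n / L^2 * u))))
    = of_real (2 * pi * L^2 * H \<theta> \<phi> L n * (1 - 1 / L^2) ^ n / exp (G_val \<theta> \<phi> L (1 - 1 / L^2)))"
proof -
  define r where "r = 1 - 1 / L^2"
  have L2: "L^2 > 1" using L by (simp add: power2_eq_square less_1_mult)
  then have "1 / L^2 < 1" by (subst divide_less_eq_1_pos) linarith+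
  then have r: "0 < r" "r < 1" using L by (auto simp: r_def)
  have L0: "L > 0" using L by simp
  define f where "f z = exp (G_complex L z)" for z
  define P where "P t = f (r * cis t) * cis (- (real n * t))" for t
  have hol: "f holomorphic_on ball 0 1" unfolding f_def by (intro holomorphic_intros G_complex_holomorphic L0)
  have cf: "continuous_on (cball 0 r) f"
    by (rule continuous_on_subset[OF holomorphic_on_imp_continuous_on[OF hol]]) (use r in auto)
  have "((\<lambda>u. f u / (u - 0) ^ Suc n) has_contour_integral (2 * pi * \<i> / fact n * (deriv ^^ n) f 0)) (circlepath 0 r)"
    by (rule Cauchy_has_contour_integral_higher_derivative_circlepath[OF cf])
       (use r in \<open>auto intro: holomorphic_on_subset[OF hol]\<close>)
  then have "((\<lambda>t. f (0 + r * cis t) / ((0 + r * cis t) - 0) ^ Suc n * r * \<i> * cis t) has_integral (2 * pi * \<i> / fact n * (deriv ^^ n) f 0)) {0..2*pi}"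
    unfolding circlepath_def by (subst (asm) has_contour_integral_part_circlepath_iff) auto
  moreover have "f (0 + r * cis t) / ((0 + r * cis t) - 0) ^ Suc n * r * \<i> * cis t = \<i> / of_real (r ^ n) * P t" for t
  proof -
    have "cis (- (real n * t)) = inverse (cis (real n * t))" by simp
    moreover have "cis t ^ n = cis (real n * t)" by (rule Complex.DeMoivre)
    ultimately have "cis (- (real n * t)) = 1 / cis t ^ n" by (simp only: inverse_eq_divide)
    moreover have "cis t \<noteq> 0" by simp
    ultimately show ?thesis using r by (simp add: P_def power_mult_distrib field_simps)
  qed
  ultimately have "((\<lambda>t. \<i> / of_real (r ^ n) * P t) has_integral (\<i> * (2 * pi * of_real (H \<theta> \<phi> L n)))) {0..2*pi}"
    using exp_Gc_deriv[OF L0, of n] by (simp add: f_def[abs_def] mult_ac)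
  from has_integral_mult_right[OF this, of "of_real (r ^ n) / \<i>"]
  have hP: "(P has_integral (of_real (2 * pi * H \<theta> \<phi> L n * r ^ n))) {0..2*pi}"
    using r by (simp add: mult_ac)
  have nr: "norm (of_real r * cis t) < 1" for t using r by (simp add: norm_mult)
  have cP: "continuous_on S P" for S
    unfolding P_def using nr
    by (intro continuous_intros continuous_on_compose2[OF holomorphic_on_imp_continuous_on[OF hol]]) auto
  have per: "P (t + 2 * pi) = P t" for t
  proof -
    have "cis (t + 2 * pi) = cis t" by (simp add: complex_eq_iff)
    moreover have "cis (- (real n * (t + 2 * pi))) = cis (- (real n * t))"
    proof -
      \<comment> \<open>Periodicity of the phase rests on n being an integer.\<close>
      have "- (real n * (t + 2 * pi)) = - (real n * t) - 2 * pi * of_int (int n)" by (simp add: algebra_simps)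
      then have "cis (- (real n * (t + 2 * pi))) = cis (- (real n * t)) / cis (2 * pi * of_int (int n))"
        by (simp only: cis_divide[symmetric])
      also have "cis (2 * pi * of_int (int n)) = 1" by (rule cis_multiple_2pi) simp
      finally show ?thesis by simp
    qed
    ultimately show ?thesis by (simp add: P_def)
  qed
  have int: "P integrable_on {a..b}" for a b by (rule integrable_continuous_real[OF cP])
  have "integral {0..2*pi} P = integral {0..pi} P + integral {pi..2*pi} P"
    by (rule Henstock_Kurzweil_Integration.integral_combine[symmetric]) (use int in auto)
  also have "integral {pi..2*pi} P = integral {-pi..0} P"
    using integral_shift[of "-pi" "2 * pi" 0 P] cP per by (simp add: o_def)
  also have "integral {0..pi} P + integral {-pi..0} P = integral {-pi..pi} P"
    using Henstock_Kurzweil_Integration.integral_combine[of "-pi" 0 pi P] int by (simp add: add.commute)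
  finally have I: "integral {-pi..pi} P = of_real (2 * pi * H \<theta> \<phi> L n * r ^ n)"
    using hP by (simp add: integral_unique)
  have "set_integrable lborel {-pi..pi} P" by (intro borel_integrable_atLeastAtMost' cP)
  from set_borel_integral_eq_integral(2)[OF this]
  have "(LINT t|lborel. indicator {-pi..pi} t *\<^sub>R P t) = of_real (2 * pi * H \<theta> \<phi> L n * r ^ n)"
    unfolding I set_lebesgue_integral_def .
  also have "(LINT t|lborel. indicator {-pi..pi} t *\<^sub>R P t) = (1 / L^2) *\<^sub>R (LINT u|lborel. indicator {-pi..pi} (u / L^2) *\<^sub>R P (u / L^2))"
    using lborel_integral_real_affine[of "1 / L^2" "\<lambda>t. indicator {-pi..pi} t *\<^sub>R P t" 0] L0 by simp
  also have "(\<lambda>u. indicator {-pi..pi} (u / L^2) *\<^sub>R P (u / L^2)) =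
      (\<lambda>u. exp (G_val \<theta> \<phi> L r) * (indicator {-(pi * L^2)..pi * L^2} u *\<^sub>R (exp (log_ratio L u) * iexp (- (real n / L^2 * u)))))"
  proof (rule ext)
    fix u
    have i: "indicator {-pi..pi} (u / L^2) = (indicator {-(pi * L^2)..pi * L^2} u :: real)"
      using L0 by (auto simp: indicator_def field_simps)
    have z: "of_real r * cis (u / L^2) = circle_pt L u" by (simp add: circle_pt_def r_def cis_conv_exp)
    have z0: "circle_pt L 0 = of_real r" by (simp add: circle_pt_def r_def)
    have "complex_of_real (exp (G_val \<theta> \<phi> L r)) = exp (G_complex L (circle_pt L 0))"
    proof -
      have "\<bar>r\<bar> < 1" using r by simp
      from G_val_eq[OF L0 this] show ?thesis unfolding z0 exp_of_real[symmetric] by (rule arg_cong)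
    qed
    then have "P (u / L^2) = exp (G_val \<theta> \<phi> L r) * (exp (log_ratio L u) * iexp (- (real n / L^2 * u)))"
      unfolding P_def z f_def log_ratio_def by (simp add: exp_diff cis_conv_exp)
    then show "indicator {-pi..pi} (u / L^2) *\<^sub>R P (u / L^2) = exp (G_val \<theta> \<phi> L r) * (indicator {-(pi * L^2)..pi * L^2} u *\<^sub>R (exp (log_ratio L u) * iexp (- (real n / L^2 * u))))"
      unfolding i by simp
  qed
  also have "(LINT u|lborel. exp (G_val \<theta> \<phi> L r) * (indicator {-(pi * L^2)..pi * L^2} u *\<^sub>R (exp (log_ratio L u) * iexp (- (real n / L^2 * u)))))
     = of_real (exp (G_val \<theta> \<phi> L r)) * (LINT u|lborel. indicator {-(pi * L^2)..pi * L^2} u *\<^sub>R (exp (log_ratio L u) * iexp (- (real n / L^2 * u))))"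
    by (rule integral_mult_right_zero)
  finally show ?thesis using L0 unfolding r_def by (simp add: scaleR_conv_of_real field_simps)
qed

definition limit_ft :: "real \<Rightarrow> complex" where
  "limit_ft s = (LINT u|lborel. exp (log_limit u) * iexp (- (s * u)))"

lemma log_limit_cont: "continuous_on UNIV log_limit"
  using log_limit_deriv by (meson has_vector_derivative_continuous continuous_at_imp_continuous_on)

lemma log_ratio_cont: "L > 1 \<Longrightarrow> continuous_on UNIV (log_ratio L)"
  using log_ratio_deriv by (meson has_vector_derivative_continuous continuous_at_imp_continuous_on)

text \<open>The index n appears only in a factor of modulus one, so a single L^1 distance between
  the two integrands bounds the error for all n simultaneously.\<close>

lemma H_uniform_limit:
  assumes e: "e > 0"
  shows "\<forall>\<^sub>F L in at_top. \<forall>n. norm (of_real (2 * pi * L^2 * H \<theta> \<phi> L n * (1 - 1 / L^2) ^ n / exp (G_val \<theta> \<phi> L (1 - 1 / L^2))) - limit_ft (real n / L^2)) < e"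
proof -
  obtain B where B: "B \<ge> 0" "\<And>L u. L > 1 \<Longrightarrow> \<bar>u\<bar> \<le> pi * L^2 \<Longrightarrow> norm (exp (log_ratio L u)) \<le> B / (1 + u^2)"
    using exp_log_ratio_bound by blast
  obtain B' where B': "B' \<ge> 0" "\<And>u. norm (exp (log_limit u)) \<le> B' / (1 + u^2)" using exp_log_limit_bound by blast
  \<comment> \<open>Extension by zero beyond one turn lets all the Cauchy integrals live on the
    whole line.\<close>
  define D where "D L u = indicator {-(pi * L^2)..pi * L^2} u *\<^sub>R exp (log_ratio L u)" for L u
  have Db: "norm (D L u) \<le> B / (1 + u^2)" if "L > 1" for L u
    using B(2)[OF that, of u] B(1) by (auto simp: D_def indicator_def intro!: divide_nonneg_nonneg add_nonneg_nonneg)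
  have Lm: "(\<lambda>u. exp (log_limit u)) \<in> borel_measurable borel"
    by (intro borel_measurable_continuous_onI continuous_intros log_limit_cont)
  have Dm: "D L \<in> borel_measurable borel" if "L > 1" for L
  proof -
    have "(\<lambda>u. exp (log_ratio L u)) \<in> borel_measurable borel"
      by (intro borel_measurable_continuous_onI continuous_intros log_ratio_cont that)
    then show ?thesis unfolding D_def[abs_def] by measurable
  qed
  define E where "E L = (LINT u|lborel. norm (D L u - exp (log_limit u)))" for L
  have "((\<lambda>L. E (max L 2)) \<longlongrightarrow> (LINT u::real|lborel. 0)) at_top"
    unfolding E_def
  proof (rule integral_dominated_convergence_at_top[where w="\<lambda>u. (B + B') * (1 / (1 + u^2))"])
    show "integrable lborel (\<lambda>u. (B + B') * (1 / (1 + u^2)))"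
      by (intro integrable_mult_right integrable_inverse_1_plus_square)
    show "(\<lambda>u. norm (D (max L 2) u - exp (log_limit u))) \<in> borel_measurable lborel" for L
      using Lm Dm[of "max L 2"] by simp
    show "AE u in lborel. ((\<lambda>L. norm (D (max L 2) u - exp (log_limit u))) \<longlongrightarrow> 0) at_top"
    proof (rule AE_I2)
      fix u
      have "filterlim (\<lambda>L::real. pi * L^2) at_top at_top" by real_asymp
      then have "eventually (\<lambda>L. \<bar>u\<bar> \<le> pi * L^2) at_top" by (simp add: filterlim_at_top)
      then have "eventually (\<lambda>L. exp (log_ratio L u) = D (max L 2) u) at_top"
        using eventually_gt_at_top[of 2] by eventually_elim (auto simp: D_def indicator_def)
      from Lim_transform_eventually[OF tendsto_exp[OF log_ratio_tendsto] this]
      have "((\<lambda>L. D (max L 2) u - exp (log_limit u)) \<longlongrightarrow> 0) at_top" by (rule LIM_zero)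
      then show "((\<lambda>L. norm (D (max L 2) u - exp (log_limit u))) \<longlongrightarrow> 0) at_top" by (rule tendsto_norm_zero)
    qed
    show "\<forall>\<^sub>F L in at_top. AE u in lborel. norm (norm (D (max L 2) u - exp (log_limit u))) \<le> (B + B') * (1 / (1 + u^2))"
    proof (intro always_eventually allI AE_I2)
      fix L u :: real
      have "norm (D (max L 2) u - exp (log_limit u)) \<le> norm (D (max L 2) u) + norm (exp (log_limit u))" by (rule norm_triangle_ineq4)
      also have "\<dots> \<le> B / (1 + u^2) + B' / (1 + u^2)" using Db[of "max L 2" u] B'(2)[of u] by linarith
      finally show "norm (norm (D (max L 2) u - exp (log_limit u))) \<le> (B + B') * (1 / (1 + u^2))"
        by (simp add: add_divide_distrib)
    qed
  qed simp
  then have "eventually (\<lambda>L. E (max L 2) < e) at_top" using e by (intro order_tendstoD(2)[of _ 0]) simp_all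
  then show ?thesis using eventually_gt_at_top[of 2]
  proof eventually_elim
    case (elim L)
    then have L: "L > 1" by simp
    have iD: "integrable lborel (D L)"
      by (rule integrable_quadratic_bound[of _ B]) (use Dm[OF L] Db[OF L] in auto)
    have iL: "integrable lborel (\<lambda>u. exp (log_limit u))"
      by (rule integrable_quadratic_bound[of _ B']) (use Lm B' in auto)
    have mult: "integrable lborel (\<lambda>u. g u * iexp (- (s * u)))" if "integrable lborel g" for g :: "real \<Rightarrow> complex" and s
    proof (rule Bochner_Integration.integrable_bound[OF that])
      show "(\<lambda>u. g u * iexp (- (s * u))) \<in> borel_measurable lborel" using that by measurable
    qed (simp add: norm_mult)
    show ?case
    proof
      fix n
      let ?e = "\<lambda>u. iexp (- (real n / L^2 * u))"
      have "of_real (2 * pi * L^2 * H \<theta> \<phi> L n * (1 - 1 / L^2) ^ n / exp (G_val \<theta> \<phi> L (1 - 1 / L^2))) = (LINT u|lborel. D L u * ?e u)"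
        unfolding H_Cauchy[OF L, symmetric] by (simp add: D_def)
      then have "of_real (2 * pi * L^2 * H \<theta> \<phi> L n * (1 - 1 / L^2) ^ n / exp (G_val \<theta> \<phi> L (1 - 1 / L^2))) - limit_ft (real n / L^2)
          = (LINT u|lborel. D L u * ?e u - exp (log_limit u) * ?e u)"
        unfolding limit_ft_def using Bochner_Integration.integral_diff[OF mult[OF iD, of "real n / L^2"] mult[OF iL, of "real n / L^2"]]
        by simp
      moreover have "norm (LINT u|lborel. D L u * ?e u - exp (log_limit u) * ?e u) \<le> E L"
        unfolding E_def
      proof (rule norm_integral_le)
        show "integrable lborel (\<lambda>u. norm (D L u - exp (log_limit u)))" using iD iL by simp
        show "norm (D L u * ?e u - exp (log_limit u) * ?e u) \<le> norm (D L u - exp (log_limit u))" for u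
          unfolding left_diff_distrib[symmetric] norm_mult by simp
      qed
      ultimately show "norm (of_real (2 * pi * L^2 * H \<theta> \<phi> L n * (1 - 1 / L^2) ^ n / exp (G_val \<theta> \<phi> L (1 - 1 / L^2))) - limit_ft (real n / L^2)) < e"
        using elim by (simp add: max_def)
    qed
  qed
qed

end

section \<open>The inverse Laplace transform\<close>

lemma integral_gaussian:
  assumes s: "s > 0"
  shows "integrable lborel (\<lambda>y::real. exp (- (s * y^2)))" "(LINT y|lborel. exp (- (s * y^2))) = sqrt (pi / s)"
proof -
  define t where "t = 1 / sqrt (2 * s)"
  have t: "t > 0" "2 * t^2 = 1 / s" using s by (auto simp: t_def power_divide)
  have e: "exp (- (s * y^2)) = sqrt (pi / s) * normal_density 0 t y" for y
  proof -
    have "2 * pi * t^2 = pi * (2 * t^2)" by simp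
    then have "2 * pi * t^2 = pi / s" unfolding t(2) by simp
    then have "normal_density 0 t y = 1 / sqrt (pi / s) * exp (- (y^2) / (1 / s))"
      unfolding normal_density_def t(2) by simp
    then show ?thesis using s by simp
  qed
  show "integrable lborel (\<lambda>y::real. exp (- (s * y^2)))"
    unfolding e using t by (intro integrable_mult_right) simp
  show "(LINT y|lborel. exp (- (s * y^2))) = sqrt (pi / s)"
    unfolding e integral_mult_right_zero using t by simp
qed

text \<open>This is the integrand on the vertical line through \<open>c\<close> after completing the
  square. The part odd in y integrates to 0.\<close>

lemma integral_gaussian_shifted_line:
  fixes c s :: real
  assumes s: "s > 0"
  shows "integrable lborel (\<lambda>y. 2 * (of_real c + \<i> * of_real y) * exp (- (of_real (s * y^2))))" (is ?i)
    and "(LINT y|lborel. 2 * (of_real c + \<i> * of_real y) * exp (- (of_real (s * y^2)))) = of_real (2 * c * sqrt (pi / s))" (is ?v)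
proof -
  have i1: "integrable lborel (\<lambda>y. complex_of_real (2 * c * exp (- (s * y^2))))"
    using integral_gaussian(1)[OF s] by (simp only: complex_of_real_integrable_eq) simp
  have i2: "integrable lborel (\<lambda>y::real. y * exp (- (s * y^2)))"
  proof (rule integrable_quadratic_bound)
    fix y :: real
    have "exp (- (s * \<bar>y^2\<bar>)) \<le> (1 + 2 / s^2) / (1 + (y^2)^2)" by (rule exp_abs_bound[OF s])
    then have "\<bar>y\<bar> * exp (- (s * y^2)) \<le> \<bar>y\<bar> * ((1 + 2 / s^2) / (1 + (y^2)^2))" by (intro mult_left_mono) auto
    also have "\<dots> \<le> (1 + 2 / s^2) / (1 + y^2)"
    proof -
      have "2 * \<bar>y\<bar> \<le> 1 + y^2" using zero_le_power2[of "\<bar>y\<bar> - 1"] by (simp add: power2_eq_square algebra_simps)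
      then have "2 * \<bar>y\<bar> * (1 + y^2) \<le> (1 + y^2) * (1 + y^2)" by (rule mult_right_mono) simp
      also have "\<dots> \<le> 2 * (1 + (y^2)^2)"
        using zero_le_power2[of "y^2 - 1"] by (simp add: power2_eq_square algebra_simps)
      finally have "\<bar>y\<bar> * (1 + y^2) \<le> 1 + (y^2)^2" by simp
      then have "\<bar>y\<bar> / (1 + (y^2)^2) \<le> 1 / (1 + y^2)"
        by (simp add: divide_simps add_pos_nonneg)
      then have "(1 + 2 / s^2) * (\<bar>y\<bar> / (1 + (y^2)^2)) \<le> (1 + 2 / s^2) * (1 / (1 + y^2))"
        by (rule mult_left_mono) simp
      then show ?thesis by (simp add: mult.commute)
    qed
    finally show "norm (y * exp (- (s * y^2))) \<le> (1 + 2 / s^2) / (1 + y^2)" by (simp add: abs_mult)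
  qed simp
  then have i2': "integrable lborel (\<lambda>y. 2 * \<i> * complex_of_real (y * exp (- (s * y^2))))"
    by (intro integrable_mult_right) (simp only: complex_of_real_integrable_eq)
  have e: "2 * (of_real c + \<i> * of_real y) * exp (- (of_real (s * y^2))) = complex_of_real (2 * c * exp (- (s * y^2))) + 2 * \<i> * complex_of_real (y * exp (- (s * y^2)))" for y
  proof -
    have "exp (- complex_of_real (s * y^2)) = of_real (exp (- (s * y^2)))"
      by (simp only: of_real_minus[symmetric] exp_of_real)
    then show ?thesis by (simp only:) (simp add: algebra_simps)
  qed
  show ?i unfolding e using i1 i2' by (rule Bochner_Integration.integrable_add)
  have "(LINT y|lborel. y * exp (- (s * y^2))) = - (LINT y|lborel. y * exp (- (s * y^2)))"
    using lborel_integral_real_affine[of "-1" "\<lambda>y::real. y * exp (- (s * y^2))" 0] by simp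
  then have z: "(LINT y|lborel. y * exp (- (s * y^2))) = 0" by simp
  show ?v unfolding e Bochner_Integration.integral_add[OF i1 i2'] integral_mult_right_zero integral_complex_of_real z integral_gaussian(2)[OF s]
    by simp
qed

lemma tendsto_truncated_integral:
  fixes f :: "real \<Rightarrow> complex"
  assumes f: "integrable lborel f" and Y: "filterlim Y at_top at_top"
  shows "((\<lambda>U::real. LINT y|lborel. indicator {-Y U..Y U} y *\<^sub>R f y) \<longlongrightarrow> (LINT y|lborel. f y)) at_top"
proof (rule integral_dominated_convergence_at_top[where w="\<lambda>y. norm (f y)"])
  have [measurable]: "f \<in> borel_measurable borel" using f by auto
  show "f \<in> borel_measurable lborel" "\<And>U. (\<lambda>y. indicator {-Y U..Y U} y *\<^sub>R f y) \<in> borel_measurable lborel" by measurable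
  show "integrable lborel (\<lambda>y. norm (f y))" using f by simp
  show "AE y in lborel. ((\<lambda>U. indicator {-Y U..Y U} y *\<^sub>R f y) \<longlongrightarrow> f y) at_top"
  proof (rule AE_I2)
    fix y
    have "eventually (\<lambda>U. \<bar>y\<bar> \<le> Y U) at_top" using Y by (simp add: filterlim_at_top)
    then have "eventually (\<lambda>U. f y = indicator {-Y U..Y U} y *\<^sub>R f y) at_top"
      by eventually_elim (auto simp: indicator_def)
    from Lim_transform_eventually[OF tendsto_const this]
    show "((\<lambda>U. indicator {-Y U..Y U} y *\<^sub>R f y) \<longlongrightarrow> f y) at_top" .
  qed
  show "\<forall>\<^sub>F U in at_top. AE y in lborel. norm (indicator {-Y U..Y U} y *\<^sub>R f y) \<le> norm (f y)"
    by (intro always_eventually allI AE_I2) (auto simp: indicator_def)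
qed

text \<open>Substituting \<open>w = v^2\<close> turns the integrand into the entire function \<open>2 * v * exp (s * v^2 - a * v)\<close>;
  the hyperbola \<open>Re (v^2) = 1\<close> is then moved to the vertical line through the saddle point \<open>a / (2 * s)\<close>.\<close>
lemma levy_integral:
  fixes a s :: real
  assumes a: "a > 0" and s: "s > 0"
  shows "integrable lborel (\<lambda>u. exp (- a * csqrt (1 - \<i> * of_real u)) * iexp (- (s * u)))"
    and "(LINT u|lborel. exp (- a * csqrt (1 - \<i> * of_real u)) * iexp (- (s * u))) =
       of_real (exp (- s) * exp (- (a^2 / (4 * s))) * a * sqrt pi / (s * sqrt s))"
proof -
  define vv where "vv u = csqrt (1 - \<i> * complex_of_real u)" for u
  define c where "c = a / (2 * s)"
  have c: "c > 0" using a s by (simp add: c_def)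
  define h where "h v = 2 * v * exp (s * v^2 - a * v)" for v :: complex
  \<comment> \<open>Here s (1 - iu) exceeds the phase -isu by the constant s, which accounts for the
    factor exp(-s) in the result.\<close>
  define f where "f u = exp (s * (1 - \<i> * complex_of_real u) - a * vv u)" for u
  have vv2: "vv u ^ 2 = 1 - \<i> * u" for u by (simp add: vv_def)
  have Rv: "Re (vv u) > 0" "Re (vv u) \<ge> sqrt (\<bar>u\<bar> / 2)" for u
  proof -
    show "Re (vv u) > 0" unfolding vv_def by (rule Re_csqrt_pos) simp
    have "\<bar>u\<bar> \<le> norm (1 - \<i> * complex_of_real u)" using abs_Im_le_cmod[of "1 - \<i> * complex_of_real u"] by simp
    then have "sqrt (\<bar>u\<bar> / 2) \<le> sqrt (norm (1 - \<i> * complex_of_real u) / 2)" by (intro real_sqrt_le_mono divide_right_mono) auto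
    also have "\<dots> \<le> Re (vv u)" unfolding vv_def by (rule Re_csqrt_ge(2)) simp
    finally show "Re (vv u) \<ge> sqrt (\<bar>u\<bar> / 2)" .
  qed
  have vc: "isCont vv u" for u
    unfolding vv_def by (rule isCont_o2[where g=csqrt, rotated], rule continuous_at_csqrt)
      (auto simp: complex_nonpos_Reals_iff intro!: continuous_intros)
  then have vc': "continuous_on S vv" for S by (simp add: continuous_at_imp_continuous_on)
  have fc: "continuous_on S f" for S unfolding f_def by (intro continuous_intros vc')
  have fint: "integrable lborel f"
  proof (rule integrable_quadratic_bound)
    show "f \<in> borel_measurable lborel" using borel_measurable_continuous_onI[OF fc] by simp
    fix u
    have "norm (f u) = exp (s - a * Re (vv u))" by (simp add: f_def)
    also have "\<dots> \<le> exp (s - a * sqrt (\<bar>u\<bar> / 2))" using Rv(2)[of u] a by simp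
    also have "\<dots> = exp s * exp (- (a / sqrt 2 * sqrt \<bar>u\<bar>))" by (simp add: real_sqrt_divide flip: exp_add)
    also have "\<dots> \<le> exp s * ((1 + 24 / (a / sqrt 2)^4) / (1 + u^2))"
      using a by (intro mult_left_mono exp_neg_sqrt_bound) auto
    finally show "norm (f u) \<le> exp s * (1 + 24 / (a / sqrt 2)^4) / (1 + u^2)" by simp
  qed
  have fe: "exp (- a * csqrt (1 - \<i> * of_real u)) * iexp (- (s * u)) = of_real (exp (- s)) * f u" for u
    by (simp add: f_def vv_def exp_of_real[symmetric] algebra_simps flip: exp_add)
  show "integrable lborel (\<lambda>u. exp (- a * csqrt (1 - \<i> * of_real u)) * iexp (- (s * u)))"
    unfolding fe by (rule integrable_mult_right[OF fint])
  \<comment> \<open>A global primitive of the entire integrand reduces the contour shift to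
    comparing values of \<open>P\<close> at endpoints.\<close>
  obtain P where P: "\<And>v. (P has_field_derivative h v) (at v)"
  proof -
    have "h holomorphic_on UNIV" unfolding h_def by (intro holomorphic_intros)
    from holomorphic_convex_primitive'[OF convex_UNIV open_UNIV this]
    obtain g where "\<And>v. v \<in> UNIV \<Longrightarrow> (g has_field_derivative h v) (at v within UNIV)" by blast
    then show ?thesis using that by auto
  qed
  \<comment> \<open>The truncated hyperbola ends at x - iY and x + iY; the relation x^2 - Y^2 = 1
    says that the squares of these points have real part 1.\<close>
  define x where "x U = Re (vv U)" for U
  define Y where "Y U = sqrt (x U ^ 2 - 1)" for U
  have x1: "x U \<ge> 1" for U
    unfolding x_def vv_def by (rule order_trans[OF _ Re_csqrt_ge(1)]) auto
  have xlim: "filterlim x at_top at_top"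
  proof (rule filterlim_at_top_mono)
    show "filterlim (\<lambda>U::real. sqrt (U / 2)) at_top at_top" by real_asymp
    show "\<forall>\<^sub>F U in at_top. sqrt (U / 2) \<le> x U"
      using eventually_gt_at_top[of 0]
    proof eventually_elim
      case (elim U)
      then show ?case using Rv(2)[of U] by (simp add: x_def)
    qed
  qed
  have Ylim: "filterlim Y at_top at_top"
  proof -
    have "filterlim (\<lambda>t::real. sqrt (t^2 - 1)) at_top at_top" by real_asymp
    then show ?thesis unfolding Y_def by (rule filterlim_compose[OF _ xlim])
  qed
  have vU: "vv U = Complex (x U) (- Y U)" "vv (- U) = Complex (x U) (Y U)" if U: "U > 0" for U
  proof -
    have n: "norm (1 - \<i> * complex_of_real U) = norm (1 + \<i> * complex_of_real U)"
      by (simp add: cmod_def)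
    have r: "Re (vv U) ^ 2 - Im (vv U) ^ 2 = 1" using arg_cong[OF vv2[of U], of Re] by (simp add: power2_eq_square)
    have i: "2 * Re (vv U) * Im (vv U) = - U" using arg_cong[OF vv2[of U], of Im] by (simp add: power2_eq_square mult_ac)
    then have "Re (vv U) * Im (vv U) < 0" using U by linarith
    then have "Im (vv U) < 0" using Rv(1)[of U] by (simp add: mult_less_0_iff)
    moreover have "Y U = \<bar>Im (vv U)\<bar>" unfolding Y_def x_def using r by (metis add_diff_cancel_left' diff_add_cancel real_sqrt_abs add.commute diff_eq_eq)
    ultimately have im: "Im (vv U) = - Y U" by simp
    then show "vv U = Complex (x U) (- Y U)" by (simp add: complex_eq_iff x_def)
    have "vv (- U) = cnj (vv U)"
    proof -
      have "cnj (csqrt (1 - \<i> * complex_of_real U)) = csqrt (cnj (1 - \<i> * complex_of_real U))"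
        by (rule csqrt_unique[symmetric, OF _]) (use Rv(1)[of U] in \<open>auto simp: vv_def simp flip: complex_cnj_power\<close>)
      then show ?thesis by (simp add: vv_def)
    qed
    then show "vv (- U) = Complex (x U) (Y U)" using im by (simp add: complex_eq_iff x_def)
  qed
  have I1: "(LINT u|lborel. indicator {-U..U} u *\<^sub>R f u) = \<i> * (P (vv U) - P (vv (- U)))" if U: "U > 0" for U
  proof -
    have "(LINT u|lborel. indicator {-U..U} u *\<^sub>R f u) = \<i> * P (vv U) - \<i> * P (vv (- U))"
    proof (rule integral_FTC_atLeastAtMost)
      fix u :: real
      have nz: "vv u \<noteq> 0" using Rv(1)[of u] by auto
      have w: "1 - \<i> * complex_of_real u \<notin> \<real>\<^sub>\<le>\<^sub>0" by (auto simp: complex_nonpos_Reals_iff)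
      have "((\<lambda>u. csqrt (1 - \<i> * u)) has_field_derivative (inverse (2 * vv u) * - \<i>)) (at (complex_of_real u))"
        unfolding vv_def
        by (rule DERIV_chain2[where f=csqrt and g="\<lambda>u. 1 - \<i> * u" and x="complex_of_real u", OF has_field_derivative_csqrt[OF w]])
           (auto intro!: derivative_eq_intros)
      from DERIV_chain2[where f=P and g="\<lambda>u. csqrt (1 - \<i> * u)" and x="complex_of_real u", OF P this]
      have "((\<lambda>u. P (csqrt (1 - \<i> * u))) has_field_derivative (h (vv u) * (inverse (2 * vv u) * - \<i>))) (at (complex_of_real u))"
        by (simp add: vv_def)
      then have "((\<lambda>u. \<i> * P (csqrt (1 - \<i> * u))) has_field_derivative (\<i> * (h (vv u) * (inverse (2 * vv u) * - \<i>)))) (at (complex_of_real u))"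
        by (rule DERIV_cmult)
      also have "\<i> * (h (vv u) * (inverse (2 * vv u) * - \<i>)) = f u"
      proof -
        have "\<i> * (2 * V * E * (inverse (2 * V) * - \<i>)) = E" if "V \<noteq> 0" for V E :: complex
          using that by (simp add: field_simps)
        from this[OF nz] show ?thesis unfolding h_def f_def vv2 .
      qed
      finally have "((\<lambda>u. \<i> * P (csqrt (1 - \<i> * u))) has_field_derivative f u) (at (complex_of_real u))" .
      from has_vector_derivative_real_field[OF this]
      show "((\<lambda>u. \<i> * P (vv u)) has_vector_derivative f u) (at u within {-U..U})" unfolding vv_def .
    qed (use U fc in auto)
    then show ?thesis by (simp add: right_diff_distrib)
  qed
  define g where "g y = 2 * (of_real c + \<i> * of_real y) * exp (- (of_real (s * y^2)))" for y :: real
  have gc: "continuous_on S g" for S unfolding g_def by (intro continuous_intros)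
  have I2: "(LINT y|lborel. indicator {-Y..Y} y *\<^sub>R g y) = - \<i> * exp (a^2 / (4 * s)) * (P (Complex c Y) - P (Complex c (- Y)))" if Y: "Y \<ge> 0" for Y
  proof -
    let ?K = "- \<i> * complex_of_real (exp (a^2 / (4 * s)))"
    have "(LINT y|lborel. indicator {-Y..Y} y *\<^sub>R g y) = ?K * P (of_real c + \<i> * of_real Y) - ?K * P (of_real c + \<i> * of_real (- Y))"
    proof (rule integral_FTC_atLeastAtMost)
      fix y :: real
      have "((\<lambda>y. of_real c + \<i> * y) has_field_derivative \<i>) (at (complex_of_real y))" by (auto intro!: derivative_eq_intros)
      from DERIV_cmult[OF DERIV_chain2[OF P this], of ?K]
      have "((\<lambda>y. ?K * P (of_real c + \<i> * y)) has_field_derivative (?K * (h (of_real c + \<i> * of_real y) * \<i>))) (at (complex_of_real y))" .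
      also have "?K * (h (of_real c + \<i> * of_real y) * \<i>) = g y"
      proof -
        \<comment> \<open>Completing the square at c = a / (2 s): the linear terms in y cancel and
          the constant a^2 / (4 s) splits off.\<close>
        have ex: "of_real s * (of_real c + \<i> * of_real y)^2 - of_real a * (of_real c + \<i> * of_real y) = complex_of_real (- (s * y^2)) - of_real (a^2 / (4 * s))"
        proof -
          have "a = 2 * s * c" using s by (simp add: c_def)
          moreover have "a^2 / (4 * s) = s * c^2" using s by (simp add: c_def power2_eq_square field_simps)
          ultimately show ?thesis by (simp add: power2_eq_square algebra_simps)
        qed
        have "h (of_real c + \<i> * of_real y) = 2 * (of_real c + \<i> * of_real y) * (exp (of_real (- (s * y^2))) / of_real (exp (a^2 / (4 * s))))"
          unfolding h_def ex exp_diff exp_of_real ..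
        moreover have "- \<i> * X * (A * (E / X) * \<i>) = A * E" if "X \<noteq> 0" for X A E :: complex
          using that by (simp add: field_simps)
        moreover have "complex_of_real (exp (a^2 / (4 * s))) \<noteq> 0" by simp
        ultimately show ?thesis unfolding g_def of_real_minus[symmetric] by (simp only:)
      qed
      finally have "((\<lambda>y. ?K * P (of_real c + \<i> * y)) has_field_derivative g y) (at (complex_of_real y))" .
      from has_vector_derivative_real_field[OF this]
      show "((\<lambda>y. ?K * P (of_real c + \<i> * of_real y)) has_vector_derivative g y) (at y within {-Y..Y})" .
    qed (use Y gc in auto)
    then show ?thesis by (simp add: Complex_eq right_diff_distrib)
  qed
  \<comment> \<open>The two paths differ by horizontal segments joining the ends of the hyperbola to
    the vertical line; their contribution decays because \<open>x U\<close> grows.\<close>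
  have seg: "norm (P (Complex (x U) y) - P (Complex c y)) \<le> 4 * x U ^ 2 * exp (s - a * x U)"
    if U: "U > 0" "c \<le> x U" and y: "\<bar>y\<bar> = Y U" for U y
  proof -
    let ?S = "{v. Im v = y \<and> c \<le> Re v \<and> Re v \<le> x U}"
    have Y2: "Y U ^ 2 = x U ^ 2 - 1" using x1[of U] by (simp add: Y_def)
    have Yx: "Y U \<le> x U" unfolding Y_def using x1[of U] by (intro real_le_lsqrt) auto
    have cv: "convex ?S"
    proof -
      have "?S = ({v. Im v \<ge> y} \<inter> {v. Im v \<le> y}) \<inter> ({v. Re v \<ge> c} \<inter> {v. Re v \<le> x U})" by auto
      then show ?thesis
        by (simp only:) (intro convex_Int convex_halfspace_Re_le convex_halfspace_Re_ge convex_halfspace_Im_le convex_halfspace_Im_ge)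
    qed
    have "norm (P (Complex (x U) y) - P (Complex c y)) \<le> (4 * x U * exp (s - a * x U)) * norm (Complex (x U) y - Complex c y)"
    proof (rule field_differentiable_bound[OF cv])
      show "(P has_field_derivative h v) (at v within ?S)" for v using P by (rule has_field_derivative_at_within)
      fix v assume v: "v \<in> ?S"
      have "norm v \<le> \<bar>Re v\<bar> + \<bar>Im v\<bar>" by (rule cmod_le)
      also have "\<dots> \<le> x U + x U" using v y Yx c by auto
      finally have nv: "norm v \<le> 2 * x U" by simp
      have "Re (s * v^2 - a * v) = s * (Re v)^2 - a * Re v - s * y^2" using v by (simp add: power2_eq_square algebra_simps)
      also have "y^2 = x U ^ 2 - 1" using y Y2 by (metis power2_abs)
      also have "s * (Re v)^2 - a * Re v - s * (x U ^ 2 - 1) \<le> s - a * x U"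
      proof -
        \<comment> \<open>For p >= c the function s p^2 - a p = s p (p - 2 c) is increasing, so its
          maximum on the segment is at the end on the hyperbola.\<close>
        have "s * (x U - Re v) * (x U + Re v - 2 * c) \<ge> 0" using v s c U by (intro mult_nonneg_nonneg) auto
        moreover have "a = 2 * s * c" using s by (simp add: c_def)
        ultimately show ?thesis by (simp add: power2_eq_square algebra_simps)
      qed
      finally have "norm (exp (s * v^2 - a * v)) \<le> exp (s - a * x U)" by simp
      then have "2 * norm v * norm (exp (s * v^2 - a * v)) \<le> 2 * (2 * x U) * exp (s - a * x U)"
        using nv x1[of U] by (intro mult_mono) auto
      then show "norm (h v) \<le> 4 * x U * exp (s - a * x U)" by (simp add: h_def norm_mult)
    qed (use U in auto)
    also have "norm (Complex (x U) y - Complex c y) = x U - c" using U by (simp add: cmod_def)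
    also have "4 * x U * exp (s - a * x U) * (x U - c) \<le> 4 * x U * exp (s - a * x U) * x U"
      using c x1[of U] by (intro mult_left_mono) auto
    finally show ?thesis by (simp add: power2_eq_square mult_ac)
  qed
  have L1: "((\<lambda>U. LINT u|lborel. indicator {-U..U} u *\<^sub>R f u) \<longlongrightarrow> (LINT u|lborel. f u)) at_top"
    by (rule tendsto_truncated_integral[OF fint filterlim_ident])
  have L2: "((\<lambda>U. LINT y|lborel. indicator {-Y U..Y U} y *\<^sub>R g y) \<longlongrightarrow> of_real (2 * c * sqrt (pi / s))) at_top"
    using tendsto_truncated_integral[OF integral_gaussian_shifted_line(1)[OF s, of c] Ylim]
    unfolding integral_gaussian_shifted_line(2)[OF s] g_def .
  let ?E = "complex_of_real (exp (- (a^2 / (4 * s))))"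
  have "((\<lambda>U. (LINT u|lborel. indicator {-U..U} u *\<^sub>R f u) - ?E * (LINT y|lborel. indicator {-Y U..Y U} y *\<^sub>R g y)) \<longlongrightarrow> 0) at_top"
  proof (rule Lim_null_comparison)
    have "((\<lambda>t. t^2 * exp (- (a * t))) \<longlongrightarrow> 0) at_top" using a by real_asymp
    then have "((\<lambda>U. x U ^ 2 * exp (- (a * x U))) \<longlongrightarrow> 0) at_top" by (rule filterlim_compose[OF _ xlim])
    then have "((\<lambda>U. 8 * exp s * (x U ^ 2 * exp (- (a * x U)))) \<longlongrightarrow> 8 * exp s * 0) at_top" by (intro tendsto_intros)
    then show "((\<lambda>U. 8 * exp s * (x U ^ 2 * exp (- (a * x U)))) \<longlongrightarrow> 0) at_top" by simp
    have "eventually (\<lambda>U. c \<le> x U) at_top" using xlim by (simp add: filterlim_at_top)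
    then show "\<forall>\<^sub>F U in at_top. norm ((LINT u|lborel. indicator {-U..U} u *\<^sub>R f u) - ?E * (LINT y|lborel. indicator {-Y U..Y U} y *\<^sub>R g y)) \<le> 8 * exp s * (x U ^ 2 * exp (- (a * x U)))"
      using eventually_gt_at_top[of 0]
    proof eventually_elim
      case (elim U)
      have Y0: "Y U \<ge> 0" using x1[of U] by (simp add: Y_def)
      have EE: "?E * exp (a^2 / (4 * s)) = 1" by (simp flip: of_real_mult exp_add)
      have "(LINT u|lborel. indicator {-U..U} u *\<^sub>R f u) - ?E * (LINT y|lborel. indicator {-Y U..Y U} y *\<^sub>R g y)
        = \<i> * (P (vv U) - P (vv (- U))) + (?E * exp (a^2 / (4 * s))) * (\<i> * (P (Complex c (Y U)) - P (Complex c (- Y U))))"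
        unfolding I1[OF elim(2)] I2[OF Y0] by (simp add: algebra_simps)
      also have "\<dots> = \<i> * ((P (Complex (x U) (- Y U)) - P (Complex c (- Y U))) - (P (Complex (x U) (Y U)) - P (Complex c (Y U))))"
        unfolding EE vU[OF elim(2)] by (simp add: algebra_simps)
      finally have "norm ((LINT u|lborel. indicator {-U..U} u *\<^sub>R f u) - ?E * (LINT y|lborel. indicator {-Y U..Y U} y *\<^sub>R g y))
        = norm ((P (Complex (x U) (- Y U)) - P (Complex c (- Y U))) - (P (Complex (x U) (Y U)) - P (Complex c (Y U))))"
        by (simp add: norm_mult)
      also have "\<dots> \<le> 4 * x U ^ 2 * exp (s - a * x U) + 4 * x U ^ 2 * exp (s - a * x U)"
        using Y0 elim by (intro order_trans[OF norm_triangle_ineq4] add_mono seg) auto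
      also have "\<dots> = 8 * exp s * (x U ^ 2 * exp (- (a * x U)))" by (simp add: exp_diff exp_minus field_simps)
      finally show ?case .
    qed
  qed
  from tendsto_add[OF this tendsto_mult[OF tendsto_const[of ?E] L2]]
  have "((\<lambda>U. LINT u|lborel. indicator {-U..U} u *\<^sub>R f u) \<longlongrightarrow> ?E * of_real (2 * c * sqrt (pi / s))) at_top" by simp
  from tendsto_unique[OF _ L1 this] have "(LINT u|lborel. f u) = ?E * of_real (2 * c * sqrt (pi / s))" by simp
  moreover have "2 * c * sqrt (pi / s) = a * sqrt pi / (s * sqrt s)" using s by (simp add: c_def real_sqrt_divide)
  ultimately show "(LINT u|lborel. exp (- a * csqrt (1 - \<i> * of_real u)) * iexp (- (s * u))) =
       of_real (exp (- s) * exp (- (a^2 / (4 * s))) * a * sqrt pi / (s * sqrt s))"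
    unfolding fe integral_mult_right_zero by simp
qed

section \<open>Series for the limit\<close>

context weighted_schwartz_density
begin

definition bin_coeff :: "nat \<Rightarrow> real" where "bin_coeff n = (-1) ^ n * ((- 2 * \<theta>) gchoose n)"

definition an :: "nat \<Rightarrow> real" where "an n = (\<theta> + real n) * rate"

text \<open>The normalisation of \<open>exp (log_limit u)\<close> to value 1 at u = 0, namely the
  reciprocal of the unnormalised power at w = 1. It is the numerator of C_0.\<close>

definition limit_const :: real where "limit_const = exp (\<theta> * rate) * (1 - exp (- rate)) powr (2 * \<theta>)"

text \<open>The value of \<open>levy_integral\<close> at a = \<open>an n\<close>, weighted by the
  binomial coefficient and without the factor exp(-s), which later cancels against (1 -
  1/L^2)^n.\<close>

definition limit_term :: "real \<Rightarrow> nat \<Rightarrow> real" where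
  "limit_term s n = bin_coeff n * exp (- ((an n)^2 / (4 * s))) * an n * sqrt pi / (s * sqrt s)"

definition limit_fn :: "real \<Rightarrow> real" where "limit_fn s = limit_const * (\<Sum>n. limit_term s n)"

text \<open>The sign turns the binomial coefficient into the rising factorial of 2 theta over n!.
  Positivity of the limit function, and with it the passage to relative errors, rests on
  this.\<close>

lemma bin_coeff_pos: "bin_coeff n > 0"
proof -
  have "bin_coeff n = pochhammer (2 * \<theta>) n / fact n"
    unfolding bin_coeff_def gbinomial_pochhammer by (simp flip: power_add mult_2)
  then show ?thesis using \<theta>_pos by (simp add: pochhammer_pos)
qed

lemma an_pos: "an n > 0"
  using \<theta>_pos rate(1) by (simp add: an_def)

lemma limit_const_pos: "limit_const > 0"
  using rate(1) by (simp add: limit_const_def)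

lemma bin_coeff_series:
  fixes y :: complex
  assumes "norm y < 1"
  shows "(\<lambda>n. of_real (bin_coeff n) * y ^ n) sums ((1 - y) powr (of_real (- 2 * \<theta>)))"
proof -
  have g: "complex_of_real ((- 2 * \<theta>) gchoose n) = (of_real (- 2 * \<theta>)) gchoose n" for n
    unfolding gbinomial_prod_rev by simp
  have "(\<lambda>n. (of_real (- 2 * \<theta>) gchoose n) * (- y) ^ n) sums ((1 + - y) powr (of_real (- 2 * \<theta>)))"
    using assms by (intro gen_binomial_complex) simp
  moreover have "of_real (bin_coeff n) * y ^ n = (of_real (- 2 * \<theta>) gchoose n) * (- y) ^ n" for n
    unfolding bin_coeff_def of_real_mult g by (simp add: power_minus[of y])
  ultimately show ?thesis by simp
qed

lemma bin_coeff_summable: "0 \<le> y \<Longrightarrow> y < 1 \<Longrightarrow> summable (\<lambda>n. bin_coeff n * y ^ n)"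
proof -
  assume "0 \<le> y" "y < 1"
  then have "summable (\<lambda>n. complex_of_real (bin_coeff n * y ^ n))"
    using bin_coeff_series[of "of_real y"] by (auto simp: sums_iff)
  then show ?thesis by (simp only: summable_complex_of_real)
qed

lemma exp_log_limit_sums:
  "(\<lambda>n. of_real (limit_const * bin_coeff n) * exp (- an n * csqrt (1 - \<i> * of_real u))) sums exp (log_limit u)"
proof -
  define s where "s = csqrt (1 - \<i> * of_real u)"
  define y where "y = exp (- rate * s)"
  have "Re s > 0" unfolding s_def by (rule Re_csqrt_pos) simp
  then have y: "norm y < 1" using rate(1) by (simp add: y_def)
  then have y1: "1 - y \<noteq> 0" by auto
  have e1: "1 - exp (- rate) > 0" using rate(1) by simp
  have "exp (log_limit u) = exp (- \<theta> * rate * s) * exp (of_real (\<theta> * rate)) * exp (of_real (- 2 * \<theta>) * Ln (1 - y)) * exp (of_real (2 * \<theta>) * Ln (1 - exp (- complex_of_real rate)))"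
    unfolding log_limit_def log_limit_w_def y_def s_def exp_add[symmetric] by (rule arg_cong[of _ _ exp]) (simp add: algebra_simps)
  also have "exp (of_real (- 2 * \<theta>) * Ln (1 - y)) = (1 - y) powr (of_real (- 2 * \<theta>))"
    using y1 by (simp add: powr_def)
  also have "exp (of_real (2 * \<theta>) * Ln (1 - exp (- complex_of_real rate))) = of_real ((1 - exp (- rate)) powr (2 * \<theta>))"
  proof -
    have "1 - exp (- complex_of_real rate) = of_real (1 - exp (- rate))" by (simp flip: exp_of_real of_real_minus)
    then have "Ln (1 - exp (- complex_of_real rate)) = of_real (ln (1 - exp (- rate)))" using e1 by (simp only: Ln_of_real)
    then have "of_real (2 * \<theta>) * Ln (1 - exp (- complex_of_real rate)) = of_real (2 * \<theta> * ln (1 - exp (- rate)))" by (simp only: of_real_mult)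
    then show ?thesis unfolding powr_def using e1 by (simp only: exp_of_real) simp
  qed
  finally have E0: "exp (log_limit u) = exp (- \<theta> * rate * s) * exp (of_real (\<theta> * rate)) * (1 - y) powr (of_real (- 2 * \<theta>)) * of_real ((1 - exp (- rate)) powr (2 * \<theta>))" .
  have KKc: "complex_of_real limit_const = exp (of_real (\<theta> * rate)) * of_real ((1 - exp (- rate)) powr (2 * \<theta>))"
    by (subst exp_of_real) (simp add: limit_const_def)
  have E: "exp (log_limit u) = of_real limit_const * exp (- \<theta> * rate * s) * (1 - y) powr (of_real (- 2 * \<theta>))"
    unfolding KKc E0 by (simp only: mult_ac)
  have "(\<lambda>n. of_real limit_const * exp (- \<theta> * rate * s) * (of_real (bin_coeff n) * y ^ n)) sums exp (log_limit u)"
    unfolding E by (intro sums_mult bin_coeff_series y)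
  moreover have "of_real limit_const * exp (- \<theta> * rate * s) * (of_real (bin_coeff n) * y ^ n) = of_real (limit_const * bin_coeff n) * exp (- an n * s)" for n
  proof -
    have "exp (- an n * s) = exp (- \<theta> * rate * s) * y ^ n"
      unfolding y_def an_def exp_of_nat_mult[symmetric] exp_add[symmetric]
      by (rule arg_cong[of _ _ exp]) (simp add: algebra_simps)
    then show ?thesis by simp
  qed
  ultimately have "(\<lambda>n. of_real (limit_const * bin_coeff n) * exp (- an n * s)) sums exp (log_limit u)" by (simp only:)
  then show ?thesis unfolding s_def .
qed

lemma limit_ft_sums:
  assumes s: "s > 0"
  shows "(\<lambda>n. complex_of_real (limit_const * exp (- s) * limit_term s n)) sums limit_ft s"
proof -
  let ?f = "\<lambda>n u. of_real (limit_const * bin_coeff n) * exp (- an n * csqrt (1 - \<i> * of_real u)) * iexp (- (s * u))"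
  define w where "w u = exp (- (\<theta> * rate / sqrt 2 * sqrt \<bar>u\<bar>))" for u :: real
  have k: "\<theta> * rate / sqrt 2 > 0" using \<theta>_pos rate(1) by simp
  have wi: "integrable lborel w"
    by (rule integrable_quadratic_bound[of _ "1 + 24 / (\<theta> * rate / sqrt 2)^4"])
       (auto simp: w_def[abs_def] exp_neg_sqrt_bound[OF k, simplified])
  \<comment> \<open>The real part of the square root is at least 1 and at least sqrt(|u|/2). The
    first bound is spent on the n-part of \<open>an n\<close> and gives a geometric factor, the
    second on the theta-part and gives decay in u, so the majorant factors.\<close>
  have le: "norm (?f n u) \<le> limit_const * bin_coeff n * exp (- rate) ^ n * w u" for n u
  proof -
    let ?r = "Re (csqrt (1 - \<i> * complex_of_real u))"
    have r1: "1 \<le> ?r" by (rule order_trans[OF _ Re_csqrt_ge(1)]) auto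
    have "\<bar>u\<bar> \<le> norm (1 - \<i> * complex_of_real u)" using abs_Im_le_cmod[of "1 - \<i> * complex_of_real u"] by simp
    then have "sqrt (\<bar>u\<bar> / 2) \<le> sqrt (norm (1 - \<i> * complex_of_real u) / 2)" by (intro real_sqrt_le_mono divide_right_mono) auto
    also have "\<dots> \<le> ?r" by (rule Re_csqrt_ge(2)) simp
    finally have r2: "sqrt (\<bar>u\<bar> / 2) \<le> ?r" .
    have "norm (exp (- an n * csqrt (1 - \<i> * complex_of_real u))) = exp (- (an n * ?r))"
      by (simp del: csqrt.sel)
    also have "\<dots> = exp (- (real n * rate * ?r)) * exp (- (\<theta> * rate * ?r))"
      by (simp add: an_def algebra_simps flip: exp_add del: csqrt.sel)
    also have "\<dots> \<le> exp (- (real n * rate)) * exp (- (\<theta> * rate * sqrt (\<bar>u\<bar> / 2)))"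
    proof (intro mult_mono)
      have "real n * rate * 1 \<le> real n * rate * ?r" using r1 rate(1) by (intro mult_left_mono) (auto simp del: csqrt.sel)
      then show "exp (- (real n * rate * ?r)) \<le> exp (- (real n * rate))" by (simp del: csqrt.sel)
      have "\<theta> * rate * sqrt (\<bar>u\<bar> / 2) \<le> \<theta> * rate * ?r" using r2 rate(1) \<theta>_pos by (intro mult_left_mono) (auto simp del: csqrt.sel)
      then show "exp (- (\<theta> * rate * ?r)) \<le> exp (- (\<theta> * rate * sqrt (\<bar>u\<bar> / 2)))" by (simp del: csqrt.sel)
    qed auto
    also have "exp (- (real n * rate)) = exp (- rate) ^ n" by (simp flip: exp_of_nat_mult)
    also have "exp (- (\<theta> * rate * sqrt (\<bar>u\<bar> / 2))) = w u" by (simp add: w_def real_sqrt_divide)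
    finally have e: "norm (exp (- an n * csqrt (1 - \<i> * complex_of_real u))) \<le> exp (- rate) ^ n * w u" .
    have "norm (?f n u) = limit_const * bin_coeff n * norm (exp (- an n * csqrt (1 - \<i> * complex_of_real u)))"
      using limit_const_pos bin_coeff_pos[of n] by (simp add: norm_mult del: csqrt.sel)
    also have "\<dots> \<le> limit_const * bin_coeff n * (exp (- rate) ^ n * w u)"
      using e limit_const_pos bin_coeff_pos[of n] by (intro mult_left_mono) auto
    finally show ?thesis by (simp add: mult.assoc)
  qed
  have L: "integrable lborel (\<lambda>u. exp (- an n * csqrt (1 - \<i> * of_real u)) * iexp (- (s * u)))"
     "(LINT u|lborel. exp (- an n * csqrt (1 - \<i> * of_real u)) * iexp (- (s * u))) =
       of_real (exp (- s) * exp (- ((an n)^2 / (4 * s))) * an n * sqrt pi / (s * sqrt s))" for n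
    using levy_integral[OF an_pos s, of n] by simp_all
  have fi: "integrable lborel (?f n)" for n
    using integrable_mult_right[OF L(1), of "of_real (limit_const * bin_coeff n)" n] by (simp add: mult.assoc)
  have fv: "(LINT u|lborel. ?f n u) = complex_of_real (limit_const * exp (- s) * limit_term s n)" for n
    unfolding mult.assoc integral_mult_right_zero L(2)[unfolded mult.assoc] by (simp add: limit_term_def mult_ac)
  have ys: "0 \<le> exp (- rate)" "exp (- rate) < 1" using rate(1) by auto
  have sums: "(\<lambda>n. LINT u|lborel. ?f n u) sums (LINT u|lborel. (\<Sum>n. ?f n u))"
  proof (rule sums_integral)
    show "integrable lborel (?f n)" for n by (rule fi)
    show "AE u in lborel. summable (\<lambda>n. norm (?f n u))"
    proof (rule AE_I2)
      fix u
      show "summable (\<lambda>n. norm (?f n u))"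
      proof (rule summable_comparison_test')
        show "summable (\<lambda>n. limit_const * (bin_coeff n * exp (- rate) ^ n) * w u)"
          by (intro summable_mult2 summable_mult bin_coeff_summable ys)
        show "norm (norm (?f n u)) \<le> limit_const * (bin_coeff n * exp (- rate) ^ n) * w u" for n
          using le[of n u] by (simp only: mult.assoc real_norm_def abs_norm_cancel)
      qed
    qed
    show "summable (\<lambda>n. LINT u|lborel. norm (?f n u))"
    proof (rule summable_comparison_test')
      show "summable (\<lambda>n. limit_const * (bin_coeff n * exp (- rate) ^ n) * (LINT u|lborel. w u))"
        by (intro summable_mult2 summable_mult bin_coeff_summable ys)
      fix n
      have "norm (LINT u|lborel. norm (?f n u)) \<le> (LINT u|lborel. limit_const * bin_coeff n * exp (- rate) ^ n * w u)"
        by (rule norm_integral_le[OF integrable_mult_right[OF wi]]) (use le in \<open>simp only: real_norm_def abs_norm_cancel\<close>)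
      also have "\<dots> = limit_const * (bin_coeff n * exp (- rate) ^ n) * (LINT u|lborel. w u)" by (simp add: mult.assoc)
      finally show "norm (LINT u|lborel. norm (?f n u)) \<le> limit_const * (bin_coeff n * exp (- rate) ^ n) * (LINT u|lborel. w u)" .
    qed
  qed
  have "(\<Sum>n. ?f n u) = exp (log_limit u) * iexp (- (s * u))" for u
    using sums_mult2[OF exp_log_limit_sums[of u], of "iexp (- (s * u))"] by (rule sums_unique[symmetric])
  then show ?thesis using sums unfolding fv limit_ft_def by simp
qed

lemma limit_fn_props:
  assumes s: "s > 0"
  shows "summable (limit_term s)" "limit_fn s > 0" "limit_ft s = of_real (exp (- s) * limit_fn s)"
proof -
  have "(\<lambda>n. complex_of_real (limit_const * exp (- s) * limit_term s n)) sums of_real (Re (limit_ft s))"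
  proof -
    have "(\<lambda>n. limit_const * exp (- s) * limit_term s n) sums Re (limit_ft s)"
      using sums_Re[OF limit_ft_sums[OF s]] by simp
    then show ?thesis by (rule sums_of_real)
  qed
  then have P: "limit_ft s = of_real (Re (limit_ft s))" using limit_ft_sums[OF s] sums_unique2 by blast
  have r: "(\<lambda>n. limit_const * exp (- s) * limit_term s n) sums Re (limit_ft s)"
    using sums_Re[OF limit_ft_sums[OF s]] by simp
  then have "(\<lambda>n. 1 / (limit_const * exp (- s)) * (limit_const * exp (- s) * limit_term s n)) sums (1 / (limit_const * exp (- s)) * Re (limit_ft s))"
    by (rule sums_mult)
  then have t: "limit_term s sums (1 / (limit_const * exp (- s)) * Re (limit_ft s))" using limit_const_pos by simp
  then show sm: "summable (limit_term s)" by (rule sums_summable)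
  have "limit_term s n > 0" for n
    using bin_coeff_pos[of n] an_pos[of n] s by (simp add: limit_term_def)
  then have "(\<Sum>n. limit_term s n) > 0" using sm by (intro suminf_pos) auto
  then show "limit_fn s > 0" using limit_const_pos by (simp add: limit_fn_def)
  have "Re (limit_ft s) = exp (- s) * limit_fn s"
    unfolding limit_fn_def sums_unique[OF t, symmetric] using limit_const_pos by simp
  then show "limit_ft s = of_real (exp (- s) * limit_fn s)" using P by simp
qed

lemma limit_ft_cont: "continuous_on UNIV limit_ft"
  unfolding continuous_on_sequentially o_def
proof (intro allI ballI impI)
  fix X :: "nat \<Rightarrow> real" and a assume X: "(\<forall>n. X n \<in> UNIV) \<and> X \<longlonglongrightarrow> a"
  obtain B where B: "B \<ge> 0" "\<And>u. norm (exp (log_limit u)) \<le> B / (1 + u^2)" using exp_log_limit_bound by blast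
  have [measurable]: "(\<lambda>u. exp (log_limit u)) \<in> borel_measurable borel"
    by (intro borel_measurable_continuous_onI continuous_intros log_limit_cont)
  show "(\<lambda>n. limit_ft (X n)) \<longlonglongrightarrow> limit_ft a"
    unfolding limit_ft_def
  proof (rule integral_dominated_convergence[where w="\<lambda>u. B * (1 / (1 + u^2))"])
    show "integrable lborel (\<lambda>u. B * (1 / (1 + u^2)))" by (intro integrable_mult_right integrable_inverse_1_plus_square)
    show "AE u in lborel. (\<lambda>n. exp (log_limit u) * iexp (- (X n * u))) \<longlonglongrightarrow> exp (log_limit u) * iexp (- (a * u))"
      using X by (intro AE_I2 tendsto_intros) auto
    show "AE u in lborel. norm (exp (log_limit u) * iexp (- (X n * u))) \<le> B * (1 / (1 + u^2))" for n
      using B(2) by (auto simp: norm_mult)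
  qed measurable
qed

text \<open>Continuity is read off the Fourier integral, where the parameter sits only in a
  phase.\<close>

lemma limit_fn_cont: "continuous_on {0<..} limit_fn"
proof -
  have "continuous_on {0<..} (\<lambda>s. exp s * Re (limit_ft s))"
    by (intro continuous_intros continuous_on_subset[OF limit_ft_cont]) auto
  then show ?thesis
    by (rule continuous_on_eq) (auto simp: limit_fn_props(3) simp flip: exp_add mult.assoc)
qed

end

section \<open>Asymptotics of the coefficients\<close>

context weighted_schwartz_density
begin

text \<open>The uniform limit gives an absolute error; the positive minimum of
  \<open>limit_fn\<close> on a compact interval turns it into a relative one. Three errors combine:
  coefficient against limit, s against its limiting value, and (1 - 1/L^2)^n against
  exp(-s).\<close>

lemma H_asymptotics:
  fixes \<rho> :: "nat \<Rightarrow> real"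
  assumes \<alpha>: "\<alpha> > 0" and \<rho>: "(\<lambda>N. \<rho> N / sqrt (real N)) \<longlonglongrightarrow> \<alpha>"
    and \<epsilon>: "0 < \<epsilon>" "\<epsilon> \<le> 1" and \<delta>: "\<delta> > 0"
  shows "\<forall>\<^sub>F N in sequentially. \<forall>j::nat. real j \<le> (1 - \<epsilon>) * real N \<longrightarrow>
     (let L = real N / \<rho> N; R = exp (G_val \<theta> \<phi> L (1 - 1 / L^2)) / (2 * pi * real N) * (\<alpha>^2 * limit_fn ((1 - real j / real N) * \<alpha>^2))
      in \<bar>H \<theta> \<phi> L (N - j) - R\<bar> \<le> \<delta> * \<bar>R\<bar>)"
proof -
  \<comment> \<open>A compact interval that holds both the actual parameter s = n / L^2, for large
    N, and the limiting one t alpha^2, for all admissible j; the factors 1/2 and 2 leave room for N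
    / L^2 to differ from alpha^2.\<close>
  define I where "I = {\<epsilon> * \<alpha>^2 / 2 .. 2 * \<alpha>^2}"
  have a2: "\<alpha>^2 > 0" using \<alpha> by simp
  have Ipos: "0 < s" if "s \<in> I" for s
  proof -
    have "0 < \<epsilon> * \<alpha>^2 / 2" using \<epsilon> a2 by simp
    then show ?thesis using that unfolding I_def by (auto intro: less_le_trans)
  qed
  have "\<epsilon> * \<alpha>^2 \<le> 1 * \<alpha>^2" using \<epsilon> a2 by (intro mult_right_mono) auto
  then have Ine: "\<alpha>^2 \<in> I" using a2 by (auto simp: I_def)
  have Ic: "compact I" by (simp add: I_def)
  have cT: "continuous_on I limit_fn" by (rule continuous_on_subset[OF limit_fn_cont]) (use Ipos in auto)
  obtain s0 where s0: "s0 \<in> I" "\<And>s. s \<in> I \<Longrightarrow> limit_fn s0 \<le> limit_fn s"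
    using continuous_attains_inf[OF Ic _ cT] Ine by blast
  define m where "m = limit_fn s0"
  have m: "m > 0" using limit_fn_props(2)[OF Ipos[OF s0(1)]] by (simp add: m_def)
  obtain s1 where s1: "s1 \<in> I" "\<And>s. s \<in> I \<Longrightarrow> limit_fn s \<le> limit_fn s1"
    using continuous_attains_sup[OF Ic _ cT] Ine by blast
  define B where "B = limit_fn s1"
  have B: "B > 0" using limit_fn_props(2)[OF Ipos[OF s1(1)]] by (simp add: B_def)
  \<comment> \<open>Chosen backwards from the final error eta (B + 2) + 2 alpha^2 eta, which must be
    at most delta alpha^2 m. The cap at 1 gives |A| <= B + 2.\<close>
  define \<eta> where "\<eta> = min 1 (\<delta> * \<alpha>^2 * m / (B + 2 + 2 * \<alpha>^2))"
  have \<eta>: "0 < \<eta>" "\<eta> \<le> 1" using \<delta> a2 m B by (auto simp: \<eta>_def intro!: divide_pos_pos mult_pos_pos add_pos_pos)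
  have \<eta>2: "\<eta> * (B + 2 + 2 * \<alpha>^2) \<le> \<delta> * \<alpha>^2 * m"
  proof -
    have "\<eta> \<le> \<delta> * \<alpha>^2 * m / (B + 2 + 2 * \<alpha>^2)" by (simp add: \<eta>_def)
    then show ?thesis using B a2 by (simp add: pos_le_divide_eq add_pos_pos)
  qed
  have "uniformly_continuous_on I limit_fn" using compact_uniformly_continuous[OF cT Ic] .
  then obtain d where d: "d > 0" "\<And>s s'. s \<in> I \<Longrightarrow> s' \<in> I \<Longrightarrow> \<bar>s - s'\<bar> < d \<Longrightarrow> \<bar>limit_fn s - limit_fn s'\<bar> < \<eta>"
    using \<eta>(1) unfolding uniformly_continuous_on_def dist_real_def by metis
  define L where "L N = real N / \<rho> N" for N
  define x where "x N = real N / (L N)^2" for N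
  have rho2: "(\<lambda>N. (\<rho> N / sqrt (real N))^2) \<longlonglongrightarrow> \<alpha>^2" by (intro tendsto_intros \<rho>)
  have evr: "\<forall>\<^sub>F N in sequentially. \<rho> N / sqrt (real N) > 0" using order_tendstoD(1)[OF \<rho> \<alpha>] .
  have evr': "\<forall>\<^sub>F N in sequentially. \<rho> N > 0 \<and> N > 0"
    using evr eventually_gt_at_top[of 0] by eventually_elim (simp add: zero_less_divide_iff)
  have xl: "x \<longlonglongrightarrow> \<alpha>^2"
  proof (rule Lim_transform_eventually[OF rho2])
    show "\<forall>\<^sub>F N in sequentially. (\<rho> N / sqrt (real N))^2 = x N"
      using evr' by eventually_elim (simp add: x_def L_def power_divide power2_eq_square field_simps)
  qed
  have Ll: "filterlim L at_top sequentially"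
  proof -
    have sq: "filterlim (\<lambda>N. sqrt (real N)) at_top sequentially" by real_asymp
    have inv: "(\<lambda>N. inverse (\<rho> N / sqrt (real N))) \<longlonglongrightarrow> inverse \<alpha>" using \<rho> \<alpha> by (intro tendsto_intros) auto
    have "filterlim (\<lambda>N. inverse (\<rho> N / sqrt (real N)) * sqrt (real N)) at_top sequentially"
      by (rule filterlim_tendsto_pos_mult_at_top[OF inv _ sq]) (use \<alpha> in simp)
    moreover have "inverse (\<rho> N / sqrt (real N)) * sqrt (real N) = L N" for N
      by (simp add: L_def)
    ultimately show ?thesis by simp
  qed
  \<comment> \<open>The relative defect in the exponent: (1 - 1/L^2)^n = exp(-s (1 + kappa)) with s
    = n / L^2. It is nonnegative and tends to 0.\<close>
  define \<kappa> where "\<kappa> L = - (L^2 * ln (1 - 1 / L^2)) - 1" for L :: real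
  have \<kappa>l: "((\<lambda>N. x N * exp (2 * \<alpha>^2 * \<kappa> (L N)) ) \<longlongrightarrow> \<alpha>^2 * exp (2 * \<alpha>^2 * 0)) sequentially"
  proof -
    have "(\<kappa> \<longlongrightarrow> 0) at_top" unfolding \<kappa>_def by real_asymp
    then have "(\<lambda>N. \<kappa> (L N)) \<longlonglongrightarrow> 0" by (rule filterlim_compose[OF _ Ll])
    then show ?thesis by (intro tendsto_intros xl)
  qed
  \<comment> \<open>Compensates in advance for the later multiplication by exp s, at most exp(2
    alpha^2) on the interval.\<close>
  define e1 where "e1 = \<eta> * exp (- (2 * \<alpha>^2))"
  have e1: "e1 > 0" using \<eta> by (simp add: e1_def)
  have ev1: "\<forall>\<^sub>F N in sequentially. \<forall>n. norm (of_real (2 * pi * (L N)^2 * H \<theta> \<phi> (L N) n * (1 - 1 / (L N)^2) ^ n / exp (G_val \<theta> \<phi> (L N) (1 - 1 / (L N)^2))) - limit_ft (real n / (L N)^2)) < e1"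
    by (rule filterlim_iff[THEN iffD1, OF Ll, rule_format, OF H_uniform_limit[OF e1]])
  define dx where "dx = min (min d \<eta>) (\<alpha>^2 / 2)"
  have dx: "dx > 0" using d(1) \<eta> a2 by (simp add: dx_def)
  have ev2: "\<forall>\<^sub>F N in sequentially. \<bar>x N - \<alpha>^2\<bar> < dx"
    using tendstoD[OF xl dx] by (simp add: dist_real_def)
  have ev3: "\<forall>\<^sub>F N in sequentially. x N * exp (2 * \<alpha>^2 * \<kappa> (L N)) < \<alpha>^2 + \<eta>"
    using \<eta> by (intro order_tendstoD(2)[OF \<kappa>l]) simp
  have ev4: "\<forall>\<^sub>F N in sequentially. L N > 1" using Ll by (simp add: filterlim_at_top_dense)
  show ?thesis
    using ev1 ev2 ev3 ev4 evr'
  proof eventually_elim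
    case (elim N)
    show ?case
    proof (intro allI impI)
      fix j :: nat assume j: "real j \<le> (1 - \<epsilon>) * real N"
      define l where "l = L N"
      have l: "l > 1" "l^2 > 0" using elim by (auto simp: l_def)
      have l2: "1 / l^2 < 1"
      proof -
        have "l^2 > 1" using l by (simp add: power2_eq_square less_1_mult)
        then show ?thesis by (subst divide_less_eq_1_pos) linarith+
      qed
      have N: "real N > 0" using elim by simp
      define t where "t = 1 - real j / real N"
      have t: "\<epsilon> \<le> t" "t \<le> 1" using j N by (auto simp: t_def field_simps)
      have "(1 - \<epsilon>) * real N \<le> 1 * real N" using \<epsilon> by (intro mult_right_mono) auto
      then have "real j \<le> real N" using j by linarith
      \<comment> \<open>Since j <= N, the truncated subtraction on naturals is the true
        difference.\<close>
      then have nt: "real (N - j) = t * real N" using N by (simp add: t_def of_nat_diff field_simps)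
      define n where "n = N - j"
      define s where "s = real n / l^2"
      have sx: "s = t * x N" by (simp add: s_def n_def nt x_def l_def)
      have xb: "\<bar>x N - \<alpha>^2\<bar> < d" "\<bar>x N - \<alpha>^2\<bar> < \<eta>" "\<bar>x N - \<alpha>^2\<bar> < \<alpha>^2 / 2"
        using elim(2) by (auto simp: dx_def)
      then have x2: "\<alpha>^2 / 2 \<le> x N" "x N \<le> 2 * \<alpha>^2" by linarith+
      have t0: "0 \<le> t" using t \<epsilon> by linarith
      have sI: "s \<in> I"
      proof -
        have "\<epsilon> * (\<alpha>^2 / 2) \<le> t * x N" using t x2 \<epsilon> a2 by (intro mult_mono) auto
        moreover have "t * x N \<le> 1 * (2 * \<alpha>^2)" using t x2 t0 a2 by (intro mult_mono) auto
        ultimately show ?thesis by (simp add: I_def sx)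
      qed
      have tI: "t * \<alpha>^2 \<in> I"
      proof -
        have "\<epsilon> * \<alpha>^2 \<le> t * \<alpha>^2" "t * \<alpha>^2 \<le> 1 * \<alpha>^2" using t a2 by (intro mult_right_mono; simp)+
        moreover have "\<epsilon> * \<alpha>^2 > 0" using \<epsilon> a2 by simp
        ultimately show ?thesis unfolding I_def atLeastAtMost_iff using a2 by linarith
      qed
      have s0: "s > 0" "s \<le> 2 * \<alpha>^2" using Ipos[OF sI] sI by (auto simp: I_def)
      have "\<bar>s - t * \<alpha>^2\<bar> = t * \<bar>x N - \<alpha>^2\<bar>" using t0 by (simp add: sx abs_mult flip: right_diff_distrib)
      also have "\<dots> \<le> 1 * \<bar>x N - \<alpha>^2\<bar>" using t by (intro mult_right_mono) auto
      finally have Td: "\<bar>limit_fn s - limit_fn (t * \<alpha>^2)\<bar> < \<eta>" using xb(1) by (intro d(2)[OF sI tI]) simp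
      define r where "r = 1 - 1 / l^2"
      have r: "0 < r" using l2 by (simp add: r_def)
      define EG where "EG = exp (G_val \<theta> \<phi> l r)"
      have EG: "EG > 0" by (simp add: EG_def)
      define Q where "Q = 2 * pi * l^2 * H \<theta> \<phi> l n * r ^ n / EG"
      have "norm (complex_of_real Q - of_real (exp (- s) * limit_fn s)) < e1"
        using elim(1)[rule_format, of n] limit_fn_props(3)[OF s0(1)] unfolding Q_def EG_def r_def l_def s_def by simp
      then have Qb: "\<bar>Q - exp (- s) * limit_fn s\<bar> < e1" unfolding of_real_diff[symmetric] norm_of_real .
      define A where "A = exp s * Q"
      have AT: "\<bar>A - limit_fn s\<bar> \<le> \<eta>"
      proof -
        have "A - limit_fn s = exp s * (Q - exp (- s) * limit_fn s)" by (simp add: A_def right_diff_distrib flip: exp_add mult.assoc)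
        then have "\<bar>A - limit_fn s\<bar> = exp s * \<bar>Q - exp (- s) * limit_fn s\<bar>" by (simp add: abs_mult)
        also have "\<dots> \<le> exp (2 * \<alpha>^2) * e1" using Qb s0 by (intro mult_mono) auto
        also have "\<dots> = \<eta>" by (simp add: e1_def flip: exp_add)
        finally show ?thesis .
      qed
      \<comment> \<open>The exact correction between exp(-s) and r^n; it lies between 1 and a bound
        that does not depend on n.\<close>
      define q where "q = exp (s * \<kappa> l)"
      have rn: "r ^ n * (q * exp s) = 1"
      proof -
        have "r ^ n = exp (real n * ln r)" using r by (simp add: exp_of_nat_mult)
        moreover have "s * \<kappa> l + s + real n * ln r = 0"
          using l by (simp add: \<kappa>_def s_def r_def field_simps)
        ultimately show ?thesis by (simp add: q_def add_ac flip: exp_add)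
      qed
      have \<kappa>0: "\<kappa> l \<ge> 0"
      proof -
        have "ln (1 - 1 / l^2) \<le> - (1 / l^2)" using ln_le_minus_one[of "1 - 1 / l^2"] l2 by simp
        then have "l^2 * ln (1 - 1 / l^2) \<le> l^2 * (- (1 / l^2))" using l by (intro mult_left_mono) auto
        then show ?thesis using l by (simp add: \<kappa>_def)
      qed
      have q1: "1 \<le> q" using \<kappa>0 s0 by (simp add: q_def)
      have q2: "q \<le> exp (2 * \<alpha>^2 * \<kappa> l)" using \<kappa>0 s0 by (simp add: q_def mult_right_mono)
      have xq: "\<bar>x N * q - \<alpha>^2\<bar> \<le> \<eta>"
      proof -
        have x0: "x N > 0" using x2 a2 by linarith
        have "x N * 1 \<le> x N * q" "x N * q \<le> x N * exp (2 * \<alpha>^2 * \<kappa> l)"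
          using q1 q2 x0 by (intro mult_left_mono; simp)+
        then show ?thesis using xb(2) elim(3) by (simp add: l_def)
      qed
      define T where "T = limit_fn (t * \<alpha>^2)"
      have T: "m \<le> T" "T \<le> B" "T > 0" using s0 s1(2)[OF tI] tI m by (auto simp: T_def m_def B_def intro: limit_fn_props Ipos \<open>\<And>s. s \<in> I \<Longrightarrow> limit_fn s0 \<le> limit_fn s\<close>)
      have AB: "\<bar>A\<bar> \<le> B + 2" "\<bar>A - T\<bar> \<le> 2 * \<eta>"
        using AT Td T \<eta> by (auto simp: T_def)
      have "\<bar>x N * q * A - \<alpha>^2 * T\<bar> \<le> \<bar>x N * q - \<alpha>^2\<bar> * \<bar>A\<bar> + \<alpha>^2 * \<bar>A - T\<bar>"
      proof -
        have "x N * q * A - \<alpha>^2 * T = (x N * q - \<alpha>^2) * A + \<alpha>^2 * (A - T)" by (simp add: algebra_simps)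
        then show ?thesis using a2 by (metis abs_mult abs_of_pos abs_triangle_ineq)
      qed
      also have "\<dots> \<le> \<eta> * (B + 2) + \<alpha>^2 * (2 * \<eta>)"
        using xq AB a2 \<eta> by (intro add_mono mult_mono mult_left_mono) auto
      also have "\<dots> = \<eta> * (B + 2 + 2 * \<alpha>^2)" by (simp add: algebra_simps)
      also have "\<dots> \<le> \<delta> * \<alpha>^2 * m" by (rule \<eta>2)
      also have "\<dots> \<le> \<delta> * \<alpha>^2 * T" using T \<delta> a2 by (intro mult_left_mono) auto
      finally have key: "\<bar>x N * q * A - \<alpha>^2 * T\<bar> \<le> \<delta> * (\<alpha>^2 * T)" by (simp add: mult.assoc)
      define c where "c = EG / (2 * pi * real N)"
      have c: "c > 0" using EG N by (simp add: c_def)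
      have "H \<theta> \<phi> l n = c * (x N * q * A)"
      proof -
        have "c * (x N * q * A) = EG / (2 * pi * real N) * (real N / l^2) * (q * exp s) * (2 * pi * l^2 * H \<theta> \<phi> l n * r ^ n / EG)"
          by (simp add: c_def x_def A_def Q_def l_def)
        also have "\<dots> = H \<theta> \<phi> l n * (r ^ n * (q * exp s))" using EG N l by simp
        finally show ?thesis by (simp add: rn)
      qed
      then have "\<bar>H \<theta> \<phi> l n - c * (\<alpha>^2 * T)\<bar> = c * \<bar>x N * q * A - \<alpha>^2 * T\<bar>"
        using c by (simp add: abs_mult flip: right_diff_distrib)
      also have "\<dots> \<le> c * (\<delta> * (\<alpha>^2 * T))" using key c by (intro mult_left_mono) auto
      also have "\<dots> = \<delta> * \<bar>c * (\<alpha>^2 * T)\<bar>" using c a2 T(3) by (simp add: abs_mult)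
      finally show "let L = real N / \<rho> N; R = exp (G_val \<theta> \<phi> L (1 - 1 / L^2)) / (2 * pi * real N) * (\<alpha>^2 * limit_fn ((1 - real j / real N) * \<alpha>^2))
        in \<bar>H \<theta> \<phi> L (N - j) - R\<bar> \<le> \<delta> * \<bar>R\<bar>"
        by (simp add: Let_def c_def EG_def r_def l_def L_def n_def T_def t_def)
    qed
  qed
qed

lemma rate_eq: "rate = sqrt 2 / sqrt v"
  by (simp add: rate_def real_sqrt_divide)

lemma limit_fn_eq:
  assumes \<alpha>: "\<alpha> > 0" and t: "t > 0"
  shows "\<alpha>^2 * limit_fn (t * \<alpha>^2) / (2 * pi) =
    limit_const / (sqrt (2 * pi) * \<alpha> * sqrt v) * t powr (- 3 / 2) *
    (\<Sum>n. (-1)^n * ((- 2 * \<theta>) gchoose n) * (\<theta> + real n) * exp (- ((\<theta> + real n)^2 / (2 * \<alpha>^2 * v * t))))"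
proof -
  define D where "D = rate * sqrt pi / (t * \<alpha>^2 * sqrt (t * \<alpha>^2))"
  let ?e = "\<lambda>n. bin_coeff n * (\<theta> + real n) * exp (- ((\<theta> + real n)^2 / (2 * \<alpha>^2 * v * t)))"
  have D0: "D \<noteq> 0" using \<alpha> t rate(1) by (simp add: D_def)
  have e: "limit_term (t * \<alpha>^2) n = D * ?e n" for n
  proof -
    \<comment> \<open>Here \<open>rate\<close>^2 = 2 / v is what brings the variance into the
      Gaussian exponent.\<close>
    have "(an n)^2 / (4 * (t * \<alpha>^2)) = (\<theta> + real n)^2 / (2 * \<alpha>^2 * v * t)"
      unfolding an_def power_mult_distrib rate(2) using v_pos \<alpha> t by (simp add: field_simps)
    then show ?thesis unfolding limit_term_def D_def an_def by simp
  qed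
  have "t * \<alpha>^2 > 0" using \<alpha> t by simp
  from limit_fn_props(1)[OF this] have "summable (\<lambda>n. 1 / D * limit_term (t * \<alpha>^2) n)" by (rule summable_mult)
  then have sm: "summable ?e" using D0 by (simp add: e)
  have limit_fn: "limit_fn (t * \<alpha>^2) = limit_const * (D * suminf ?e)"
    unfolding limit_fn_def e by (simp add: suminf_mult[OF sm])
  have "\<alpha>^2 * D / (2 * pi) = 1 / (sqrt (2 * pi) * \<alpha> * sqrt v) * t powr (- 3 / 2)"
  proof -
    have p: "t powr (- 3 / 2) = 1 / (t * sqrt t)"
    proof -
      have "t powr (- 3 / 2) = t powr (- (1 + 1/2))" by simp
      also have "\<dots> = 1 / (t powr 1 * t powr (1/2))" unfolding powr_minus_divide powr_add ..
      finally show ?thesis using t by (simp add: powr_half_sqrt)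
    qed
    have sa: "sqrt (t * \<alpha>^2) = sqrt t * \<alpha>" using \<alpha> by (simp add: real_sqrt_mult)

    have "\<alpha>^2 * D / (2 * pi) = (sqrt 2 * sqrt pi / (2 * pi)) * (1 / (sqrt v * \<alpha> * (t * sqrt t)))"
      unfolding D_def rate_eq sa using \<alpha> by (simp add: power2_eq_square)
    also have "sqrt 2 * sqrt pi / (2 * pi) = 1 / sqrt (2 * pi)"
    proof -
      have "X \<noteq> 0 \<Longrightarrow> X / (X * X) = 1 / X" for X :: real by simp
      from this[of "sqrt (2 * pi)"] have "sqrt (2 * pi) / (2 * pi) = 1 / sqrt (2 * pi)" by simp
      then show ?thesis by (simp only: real_sqrt_mult[symmetric])
    qed
    finally show ?thesis unfolding p by simp
  qed
  then have "limit_const * suminf ?e * (\<alpha>^2 * D / (2 * pi)) = limit_const * suminf ?e * (1 / (sqrt (2 * pi) * \<alpha> * sqrt v) * t powr (- 3 / 2))"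
    by (rule arg_cong)
  then show ?thesis unfolding limit_fn bin_coeff_def by (simp add: mult_ac)
qed

end

theorem mainTheorem20:
  fixes \<theta> \<alpha> :: real and \<phi> :: "real \<Rightarrow> real" and \<rho> :: "nat \<Rightarrow> real"
  assumes "\<theta> > 0"
    and "schwartz \<phi>" and "is_density \<phi>" and "mean_of \<phi> = 0"
    and "\<alpha> > 0"
    and "(\<lambda>N. \<rho> N / sqrt (real N)) \<longlonglongrightarrow> \<alpha>"
  defines "\<sigma> \<equiv> sqrt (var_of \<phi>)"
  defines "C0 \<equiv> exp (sqrt 2 / \<sigma> * \<theta>) * (1 - exp (- sqrt 2 / \<sigma>)) powr (2 * \<theta>)
                  / (sqrt (2 * pi) * \<alpha> * \<sigma>)"
  defines "R \<equiv> (\<lambda>N j. let L = real N / \<rho> N; t = 1 - real j / real N in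
      C0 * exp (G_val \<theta> \<phi> L (1 - 1 / L^2)) / real N * t powr (-3/2) *
      (\<Sum>n. (-1)^n * ((- 2 * \<theta>) gchoose n) * (\<theta> + real n) *
             exp (- (((\<theta> + real n) ^ 2) / (2 * \<alpha> ^ 2 * \<sigma> ^ 2 * t)))))"
  shows "\<forall>\<epsilon>>0. \<forall>\<delta>>0. \<forall>\<^sub>F N in sequentially. \<forall>j::nat. real j \<le> (1 - \<epsilon>) * real N \<longrightarrow>
           \<bar>H \<theta> \<phi> (real N / \<rho> N) (N - j) - R N j\<bar> \<le> \<delta> * \<bar>R N j\<bar>"
proof (intro allI impI)
  fix \<epsilon> \<delta> :: real assume \<epsilon>: "\<epsilon> > 0" and \<delta>: "\<delta> > 0"
  interpret weighted_schwartz_density \<phi> \<theta> using assms by unfold_locales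
  have \<sigma>2: "\<sigma>^2 = var_of \<phi>" using v_pos by (simp add: \<sigma>_def)
  have C0: "C0 = limit_const / (sqrt (2 * pi) * \<alpha> * sqrt (var_of \<phi>))"
    by (simp add: C0_def limit_const_def rate_eq \<sigma>_def mult.commute)
  \<comment> \<open>Capping at 1 only enlarges the range of j; for epsilon > 1 and N > 0 the
    original range is empty.\<close>
  define \<epsilon>' where "\<epsilon>' = min \<epsilon> 1"
  have \<epsilon>': "0 < \<epsilon>'" "\<epsilon>' \<le> 1" using \<epsilon> by (auto simp: \<epsilon>'_def)
  show "\<forall>\<^sub>F N in sequentially. \<forall>j::nat. real j \<le> (1 - \<epsilon>) * real N \<longrightarrow>
           \<bar>H \<theta> \<phi> (real N / \<rho> N) (N - j) - R N j\<bar> \<le> \<delta> * \<bar>R N j\<bar>"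
    using H_asymptotics[OF assms(5,6) \<epsilon>' \<delta>] eventually_gt_at_top[of 0]
  proof eventually_elim
    case (elim N)
    show ?case
    proof (intro allI impI)
      fix j :: nat assume "real j \<le> (1 - \<epsilon>) * real N"
      also have "\<dots> \<le> (1 - \<epsilon>') * real N" by (intro mult_right_mono) (auto simp: \<epsilon>'_def)
      finally have j: "real j \<le> (1 - \<epsilon>') * real N" .
      define L where "L = real N / \<rho> N"
      define t where "t = 1 - real j / real N"
      have "\<epsilon>' \<le> t" using j elim(2) by (simp add: t_def field_simps)
      then have t: "t > 0" using \<epsilon>' by linarith
      have "R N j = exp (G_val \<theta> \<phi> L (1 - 1 / L^2)) / real N * (\<alpha>^2 * limit_fn (t * \<alpha>^2) / (2 * pi))"
        unfolding R_def Let_def L_def[symmetric] t_def[symmetric] limit_fn_eq[OF assms(5) t] C0 \<sigma>2 by (simp add: mult_ac)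
      then have "R N j = exp (G_val \<theta> \<phi> L (1 - 1 / L^2)) / (2 * pi * real N) * (\<alpha>^2 * limit_fn (t * \<alpha>^2))" by simp
      then show "\<bar>H \<theta> \<phi> (real N / \<rho> N) (N - j) - R N j\<bar> \<le> \<delta> * \<bar>R N j\<bar>"
        using elim(1)[rule_format, OF j] by (simp add: Let_def L_def t_def)
    qed
  qed
qed

end
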